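(* Let $k\ge1$ and $\ell\ge1$ be integers, $\epsilon=1/\ell$, $n=k+2$, and $w=(1,1,\epsilon^{(k)})$ (two entries $1$ followed by $k$ entries $\epsilon$). Then $\widetilde H_d(\Delta_{0,w})\ne 0$ if and only if $d=n-4-t(\ell-1)$ for some integer $t$ with $0\le t\le\lfloor (n-2)/(\ell+1)\rfloor$.
   Context: For a weight vector $w\in(0,1]^n$ with $\sum w_i>2$, a $w$-stable $n$-marked tree is a finite tree $T$ with a marking $m_T:\{1,\dots,n\}\to V(T)$ such that every vertex has (number of edges) $+$ (sum of weights of marks at it) $>2$; $\Delta_{0,w}$ is the simplicial complex of such trees with positive edge lengths summing to $1$, one simplex $\{\ell\in\mathbf{R}_{\ge0}^{E(T)}:\sum\ell_e=1\}$ per tree, faces with vanishing lengths identified with the simplices of contracted trees. $\widetilde H_d$ denotes reduced (integral) homology. *)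

theory Defs
  imports "HOL-Homology.Homology"
begin

section \<open>Weighted stable marked trees\<close>

text \<open>
  The names of the vertices are irrelevant: isomorphic trees are identified by the gluing below,
  and every finite tree is isomorphic to one whose vertices are natural numbers.
\<close>

record marked_tree =
  tverts :: "nat set"
  tedges :: "nat set set"
  tmark :: "nat \<Rightarrow> nat"

definition has_cycle :: "'a set set \<Rightarrow> bool" where
  "has_cycle E \<longleftrightarrow>
     (\<exists>p. length p \<ge> 3 \<and> distinct p \<and>
          (\<forall>i<length p. {p ! i, p ! (Suc i mod length p)} \<in> E))"

definition finite_tree :: "'a set \<Rightarrow> 'a set set \<Rightarrow> bool" where
  "finite_tree V E \<longleftrightarrow>
     finite V \<and> V \<noteq> {} \<and> E \<subseteq> {{u, v} |u v. u \<in> V \<and> v \<in> V \<and> u \<noteq> v} \<and>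
     (\<forall>u\<in>V. \<forall>v\<in>V. (u, v) \<in> {(a, b). {a, b} \<in> E}\<^sup>*) \<and>
     \<not> has_cycle E"

definition stable_tree :: "nat \<Rightarrow> (nat \<Rightarrow> real) \<Rightarrow> marked_tree \<Rightarrow> bool" where
  "stable_tree n w T \<longleftrightarrow>
     finite_tree (tverts T) (tedges T) \<and>
     tmark T ` {1..n} \<subseteq> tverts T \<and>
     (\<forall>v\<in>tverts T. real (card {e \<in> tedges T. v \<in> e})
                     + (\<Sum>i | i \<in> {1..n} \<and> tmark T i = v. w i) > 2)"

text \<open>
  Contractions of marked trees, given by their effect on vertices: every fibre is connected
  through the edges that are collapsed. The edges of the target are the images of the edges
  that are not collapsed. Isomorphisms are the contractions that are injective on vertices.
\<close>

definition contraction :: "nat \<Rightarrow> (nat \<Rightarrow> nat) \<Rightarrow> marked_tree \<Rightarrow> marked_tree \<Rightarrow> bool" where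
  "contraction n f T T' \<longleftrightarrow>
     f ` tverts T = tverts T' \<and>
     (\<forall>i\<in>{1..n}. tmark T' i = f (tmark T i)) \<and>
     tedges T' = {{f u, f v} |u v. {u, v} \<in> tedges T \<and> f u \<noteq> f v} \<and>
     (\<forall>u\<in>tverts T. \<forall>v\<in>tverts T. f u = f v \<longrightarrow>
        (u, v) \<in> {(a, b). {a, b} \<in> tedges T \<and> f a = f b}\<^sup>*)"

section \<open>The complex\<close>

definition length_simplex :: "marked_tree \<Rightarrow> (nat set \<Rightarrow> real) topology" where
  "length_simplex T =
     subtopology (powertop_real (tedges T))
       {len. (\<forall>e\<in>tedges T. 0 \<le> len e) \<and> (\<Sum>e\<in>tedges T. len e) = 1}"

text \<open>
  Length functions on a contracted tree, extended by zero to the collapsed edges. This embeds the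
  simplex of the contracted tree as the face on which the lengths of the collapsed edges vanish.
\<close>

definition extend_lengths ::
  "(nat \<Rightarrow> nat) \<Rightarrow> marked_tree \<Rightarrow> marked_tree \<Rightarrow> (nat set \<Rightarrow> real) \<Rightarrow> nat set \<Rightarrow> real" where
  "extend_lengths f T T' len =
     (\<lambda>e\<in>tedges T. if f ` e \<in> tedges T' then len (f ` e) else 0)"

definition face_glue ::
  "nat \<Rightarrow> (nat \<Rightarrow> real) \<Rightarrow> marked_tree \<times> (nat set \<Rightarrow> real) \<Rightarrow>
   marked_tree \<times> (nat set \<Rightarrow> real) \<Rightarrow> bool" where
  "face_glue n w p q \<longleftrightarrow>
     (\<exists>f T T' len. stable_tree n w T \<and> stable_tree n w T' \<and> contraction n f T T' \<and>
        len \<in> topspace (length_simplex T') \<and>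
        p = (T, extend_lengths f T T' len) \<and> q = (T', len))"

definition quotient_topology :: "'a topology \<Rightarrow> ('a \<Rightarrow> 'b) \<Rightarrow> 'b topology" where
  "quotient_topology X f =
     topology (\<lambda>U. U \<subseteq> f ` topspace X \<and> openin X {x \<in> topspace X. f x \<in> U})"

lemma istopology_quotient_topology:
  "istopology (\<lambda>U. U \<subseteq> f ` topspace X \<and> openin X {x \<in> topspace X. f x \<in> U})"
proof -
  have 1: "{x \<in> topspace X. f x \<in> S \<inter> T} =
           {x \<in> topspace X. f x \<in> S} \<inter> {x \<in> topspace X. f x \<in> T}" for S T
    by auto
  have 2: "{x \<in> topspace X. f x \<in> \<Union>K} = (\<Union>U\<in>K. {x \<in> topspace X. f x \<in> U})" for K
    by auto
  show ?thesis
    unfolding istopology_def 1 2 by blast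
qed

lemma openin_quotient_topology:
  "openin (quotient_topology X f) U \<longleftrightarrow>
     U \<subseteq> f ` topspace X \<and> openin X {x \<in> topspace X. f x \<in> U}"
  by (simp add: quotient_topology_def istopology_quotient_topology)

lemma topspace_quotient_topology [simp]:
  "topspace (quotient_topology X f) = f ` topspace X"
proof -
  have "{x \<in> topspace X. f x \<in> f ` topspace X} = topspace X"
    by auto
  then have "openin (quotient_topology X f) (f ` topspace X)"
    by (simp add: openin_quotient_topology)
  then show ?thesis
    by (metis openin_quotient_topology openin_subset openin_topspace subset_antisym)
qed

lemma quotient_map_quotient_topology:
  "quotient_map X (quotient_topology X f) f"
  by (auto simp: quotient_map_def openin_quotient_topology)

definition Delta0 ::
  "nat \<Rightarrow> (nat \<Rightarrow> real) \<Rightarrow> (marked_tree \<times> (nat set \<Rightarrow> real)) set topology" where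
  "Delta0 n w =
     quotient_topology (sum_topology length_simplex {T. stable_tree n w T})
       (\<lambda>p. {q. equivclp (face_glue n w) p q})"

section \<open>Reduced homology\<close>

text \<open>
  The library's integral reduced homology groups of the empty space all vanish. By the usual
  convention for the augmented chain complex, the empty space has one nonzero reduced homology
  group, namely the integers in degree -1.
\<close>

definition reduced_homology_nonzero :: "int \<Rightarrow> 'a topology \<Rightarrow> bool" where
  "reduced_homology_nonzero d X \<longleftrightarrow>
     (if topspace X = {} then d = -1 else \<not> trivial_group (reduced_homology_group d X))"

end

theory Submission
  imports Defs "HOL-Library.Nat_Bijection"
begin

text \<open>
  Root every tree at the mark \<open>2\<close>. An edge is then determined by the set of marks below it, and a
  stable tree by the laminar family of these sets. Over \<open>{1, 3, \<dots>, n}\<close> the sets that occur are the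
  proper non-singleton subsets that contain \<open>1\<close> or have more than \<open>l\<close> elements. So \<open>\<Delta>\<close> is
  the flag complex of the relation ``nested or disjoint'' on these sets.

  Its homology is computed by deleting vertices. If the link of a vertex lies in an acyclic
  subcomplex that avoids the vertex, the long exact sequence of the pair splits and the vertex
  contributes the homology of its link, shifted by one. Fix a light mark \<open>x\<close>. The sets \<open>S\<close> containing
  \<open>x\<close> for which \<open>S - {x}\<close> is still a vertex are dominated by \<open>S - {x}\<close>, and what remains after their
  removal is a cone over the complement of \<open>x\<close>. The other sets containing \<open>x\<close> either pair \<open>x\<close> with
  one heavy element, or consist of \<open>l + 1\<close> light marks. The link of such a set is the complex
  obtained by merging the set into one heavy element. A merge of the first kind removes a light
  element; a merge of the second kind removes \<open>l + 1\<close> light elements and creates a heavy one. The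
  number \<open>t\<close> counts the merges of the second kind.
\<close>

section \<open>Flag complexes and their reduced homology\<close>

text \<open>Degrees are counted by merges. The induction ends at two blocks, where the complex is
  empty and contributes degree -1, and every merge adds one to the degree. Starting from h heavy and
  k light blocks, a merge of the first kind lowers the number of blocks by 1 and one of the second
  kind by \<open>m - 1\<close>, where \<open>m = l + 1\<close>. With t merges of the second kind
  there are h + k - 2 - t(m - 2) merges in all, hence the degree h + k - 3 - t(m - 2); for h = 1 and
  k = n - 2 this is n - 4 - t(l - 1). Since merging changes the number of heavy blocks, the
  induction must speak of arbitrary block systems. Contributions never cancel, so it suffices to
  follow whether groups are trivial.

  On the geometric side, the gluing is generated by contractions between trees with arbitrary vertex
  names. It is controlled by an invariant, the length as a function of splits, and by a canonical
  representative of each class. The resulting continuous bijection is a homeomorphism because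
  finitely many canonical trees cover the quotient, which is therefore compact.\<close>

definition flagreal :: "('v \<Rightarrow> 'v \<Rightarrow> bool) \<Rightarrow> 'v set \<Rightarrow> ('v \<Rightarrow> real) set" where
  "flagreal R V = {x. (\<forall>v. 0 \<le> x v) \<and> (\<forall>v. x v \<noteq> 0 \<longrightarrow> v \<in> V) \<and>
                      (\<forall>u v. x u \<noteq> 0 \<longrightarrow> x v \<noteq> 0 \<longrightarrow> R u v) \<and> (\<Sum>v\<in>V. x v) = 1}"

abbreviation flag_nonzero :: "int \<Rightarrow> ('v \<Rightarrow> 'v \<Rightarrow> bool) \<Rightarrow> 'v set \<Rightarrow> bool" where
  "flag_nonzero d R V \<equiv> reduced_homology_nonzero d (top_of_set (flagreal R V))"

text \<open>The target carries the product topology, so continuity of the segment homotopy is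
  checked one coordinate at a time.\<close>

lemma homotopic_with_linear_fun:
  fixes f g :: "'a::topological_space \<Rightarrow> 'b \<Rightarrow> real"
  assumes "continuous_on S f" and "continuous_on S g"
    and "\<And>x t. x \<in> S \<Longrightarrow> 0 \<le> t \<Longrightarrow> t \<le> 1 \<Longrightarrow> (\<lambda>u. (1 - t) * f x u + t * g x u) \<in> T"
  shows "homotopic_with (\<lambda>_. True) (top_of_set S) (top_of_set T) f g"
proof -
  let ?h = "\<lambda>p. (\<lambda>u. (1 - fst p) * f (snd p) u + fst p * g (snd p) u)"
  have *: "continuous_on ({0..1::real} \<times> S) (\<lambda>p. F (snd p) u)"
    if "continuous_on S F" for F :: "'a \<Rightarrow> 'b \<Rightarrow> real" and u
    by (rule continuous_on_compose2 [OF continuous_on_product_then_coordinatewise [OF that]])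
       (auto intro: continuous_on_snd continuous_on_id)
  have "continuous_on ({0..1} \<times> S) ?h"
    by (intro continuous_on_coordinatewise_then_product continuous_intros * assms)
  moreover have "?h ` ({0..1} \<times> S) \<subseteq> T"
    using assms(3) by auto
  ultimately show ?thesis
    unfolding homotopic_with_def
    by (intro exI[of _ ?h]) (simp add: prod_topology_subtopology_eu image_subset_iff_funcset)
qed

lemma flagrealD:
  assumes "x \<in> flagreal R V"
  shows "0 \<le> x v" and "x v \<noteq> 0 \<Longrightarrow> v \<in> V" and "x u \<noteq> 0 \<Longrightarrow> x v \<noteq> 0 \<Longrightarrow> R u v"
    and "(\<Sum>v\<in>V. x v) = 1"
  using assms by (auto simp: flagreal_def)

lemma flagreal_le_one:
  assumes "finite V" "x \<in> flagreal R V"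
  shows "x v \<le> 1"
proof (cases "v \<in> V")
  case True
  then have "x v \<le> (\<Sum>u\<in>V. x u)"
    using assms by (intro member_le_sum) (auto simp: flagreal_def)
  then show ?thesis using assms by (auto simp: flagreal_def)
next
  case False
  then have "x v = 0" using assms(2) by (auto simp: flagreal_def)
  then show ?thesis by simp
qed

text \<open>Points are total functions vanishing off the vertex set, so subcomplexes are literal
  subsets and every inclusion is \<open>id\<close>.\<close>

lemma flagreal_mono:
  assumes "W \<subseteq> V" "finite V" "x \<in> flagreal R W"
  shows "x \<in> flagreal R V"
proof -
  have "(\<Sum>v\<in>V. x v) = (\<Sum>v\<in>W. x v)"
    using assms by (intro sum.mono_neutral_right) (auto simp: flagreal_def)
  then show ?thesis using assms by (auto simp: flagreal_def)
qed

lemma flagreal_restrict: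
  assumes "W \<subseteq> V" "finite V" "x \<in> flagreal R V" "\<And>v. x v \<noteq> 0 \<Longrightarrow> v \<in> W"
  shows "x \<in> flagreal R W"
proof -
  have "(\<Sum>v\<in>V. x v) = (\<Sum>v\<in>W. x v)"
    using assms by (intro sum.mono_neutral_right) (auto simp: flagreal_def)
  then show ?thesis using assms by (auto simp: flagreal_def)
qed

text \<open>The last hypothesis makes the union of the two supports a clique, so the segment stays
  inside one simplex. Both orientations are required because \<open>R\<close> is not assumed
  symmetric.\<close>

lemma flagreal_convex_comb:
  assumes "x \<in> flagreal R V" "y \<in> flagreal R V" "0 \<le> t" "t \<le> 1"
    and "\<And>u v. x u \<noteq> 0 \<Longrightarrow> y v \<noteq> 0 \<Longrightarrow> R u v \<and> R v u"
  shows "(\<lambda>u. (1 - t) * x u + t * y u) \<in> flagreal R V"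
proof -
  have "(\<Sum>u\<in>V. (1 - t) * x u + t * y u) = 1"
    using assms by (simp add: sum.distrib flagreal_def flip: sum_distrib_left)
  moreover have "x u \<noteq> 0 \<or> y u \<noteq> 0" if "(1 - t) * x u + t * y u \<noteq> 0" for u
    using that by auto
  moreover have "u \<in> V" if "(1 - t) * x u + t * y u \<noteq> 0" for u
    using calculation(2)[OF that] assms(1,2) unfolding flagreal_def by blast
  moreover have "R u v" if "(1 - t) * x u + t * y u \<noteq> 0" "(1 - t) * x v + t * y v \<noteq> 0" for u v
    using calculation(2)[OF that(1)] calculation(2)[OF that(2)] assms(1,2,5)
    unfolding flagreal_def by blast
  moreover have "0 \<le> (1 - t) * x u + t * y u" for u
    using assms(1-4) by (auto simp: flagreal_def)
  ultimately show ?thesis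
    unfolding flagreal_def by blast
qed

definition vertex_point :: "'v \<Rightarrow> 'v \<Rightarrow> real" where
  "vertex_point v = (\<lambda>u. if u = v then 1 else 0)"

lemma vertex_point_in_flagreal:
  assumes "finite V" "v \<in> V" "R v v"
  shows "vertex_point v \<in> flagreal R V"
  using assms by (auto simp: flagreal_def vertex_point_def)

text \<open>Every point can be moved straight to the apex. The apex also makes the complex nonempty,
  which settles degree -1.\<close>

lemma flag_nonzero_cone:
  assumes "finite V" "a \<in> V" "\<And>v. v \<in> V \<Longrightarrow> R a v \<and> R v a"
  shows "\<not> flag_nonzero d R V"
proof -
  have a: "vertex_point a \<in> flagreal R V"
    using assms by (intro vertex_point_in_flagreal) auto
  have "homotopic_with (\<lambda>_. True) (top_of_set (flagreal R V)) (top_of_set (flagreal R V))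
           id (\<lambda>x. vertex_point a)"
  proof (rule homotopic_with_linear_fun)
    fix x t assume *: "x \<in> flagreal R V" "0 \<le> (t::real)" "t \<le> 1"
    have "R u v \<and> R v u" if "x u \<noteq> 0" "vertex_point a v \<noteq> 0" for u v
    proof -
      have "v = a" 
        using that by (metis vertex_point_def)
      moreover have "u \<in> V"
        using that flagrealD(2)[OF *(1)] by blast
      ultimately show ?thesis using assms(3) by blast
    qed
    then show "(\<lambda>u. (1 - t) * id x u + t * vertex_point a u) \<in> flagreal R V"
      unfolding id_apply
      using flagreal_convex_comb[OF *(1) a *(2,3)] by blast
  qed simp_all
  then have "contractible_space (top_of_set (flagreal R V))"
    unfolding contractible_space_def by blast
  then show ?thesis
    using a by (auto simp: reduced_homology_nonzero_def trivial_reduced_homology_group_contractible_space)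
qed

text \<open>A short exact sequence decides triviality of its middle term without being split. The
  lists in \<open>exact_seq\<close> run from right to left.\<close>

lemma trivial_group_middle:
  assumes ex: "exact_seq ([C, B, A], [g, f])"
    and inj: "inj_on f (carrier A)" and surj: "g ` carrier B = carrier C"
  shows "trivial_group B \<longleftrightarrow> trivial_group A \<and> trivial_group C"
proof -
  have gr: "group_hom A B f" "group_hom B C g" and ker: "kernel B C g = f ` carrier A"
    using ex by (auto simp: group_hom_def group_hom_axioms_def)
  interpret f: group_hom A B f by (rule gr)
  interpret g: group_hom B C g by (rule gr)
  show ?thesis
  proof
    assume B: "trivial_group B"
    then have cB: "carrier B = {\<one>\<^bsub>B\<^esub>}" by (simp add: trivial_group_def)
    have "carrier A \<subseteq> {\<one>\<^bsub>A\<^esub>}"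
      using inj cB f.hom_closed f.hom_one by (force simp: inj_on_def)
    moreover have "carrier C = {\<one>\<^bsub>C\<^esub>}"
      using surj cB by auto
    ultimately show "trivial_group A \<and> trivial_group C"
      by (auto simp: trivial_group_def)
  next
    assume AC: "trivial_group A \<and> trivial_group C"
    then have "kernel B C g = {\<one>\<^bsub>B\<^esub>}"
      by (simp add: ker trivial_group_def)
    moreover have "kernel B C g = carrier B"
      using AC g.hom_closed by (auto simp: kernel_def trivial_group_def)
    ultimately show "trivial_group B"
      by (simp add: trivial_group_def)
  qed
qed

section \<open>Deleting a vertex: links, radial projection and open stars\<close>

definition link :: "('v \<Rightarrow> 'v \<Rightarrow> bool) \<Rightarrow> 'v set \<Rightarrow> 'v \<Rightarrow> 'v set" where
  "link R V v = {u \<in> V - {v}. R u v \<and> R v u}"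

text \<open>Radial projection away from the vertex \<open>v\<close> onto the opposite faces. It is
  meaningful only where \<open>x v \<noteq> 1\<close>; at the vertex itself the division by zero
  yields the zero function, which is not a point of the complex.\<close>

definition push_off :: "'v \<Rightarrow> ('v \<Rightarrow> real) \<Rightarrow> 'v \<Rightarrow> real" where
  "push_off v x = (\<lambda>u. if u = v then 0 else x u / (1 - x v))"

lemma continuous_on_fun_apply [continuous_intros]:
  "continuous_on S (\<lambda>x :: 'v \<Rightarrow> real. x u)"
  by (rule continuous_on_product_then_coordinatewise[OF continuous_on_id])

lemma continuous_on_push_off:
  assumes "\<And>x. x \<in> S \<Longrightarrow> x v \<noteq> 1"
  shows "continuous_on S (push_off v)"
  unfolding push_off_def
proof (rule continuous_on_coordinatewise_then_product)
  fix u
  show "continuous_on S (\<lambda>x. if u = v then 0 else x u / (1 - x v))"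
    using assms by (cases "u = v") (force intro!: continuous_intros)+
qed

text \<open>Hence the condition \<open>x v \<noteq> 1\<close> removes at most a single point from
  the complex.\<close>

lemma flagreal_eq_vertex_point:
  assumes "finite V" "x \<in> flagreal R V" "x v = 1"
  shows "x = vertex_point v"
proof
  fix u
  have v: "v \<in> V" using flagrealD(2)[OF assms(2), of v] assms(3) by simp
  have "(\<Sum>w\<in>V - {v}. x w) = 0"
    using flagrealD(4)[OF assms(2)] sum.remove[OF assms(1) v, of x] assms(3) by simp
  then have "\<forall>w\<in>V - {v}. x w = 0"
    using assms(1) flagrealD(1)[OF assms(2)] by (subst (asm) sum_nonneg_eq_0_iff) auto
  then show "x u = vertex_point v u"
    using assms(3) flagrealD(2)[OF assms(2), of u] by (auto simp: vertex_point_def)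
qed

lemma push_off_in_flagreal:
  assumes V: "finite V" and x: "x \<in> flagreal R V" and "x v \<noteq> 1"
  shows "push_off v x \<in> flagreal R (V - {v})"
proof -
  have lt: "x v < 1"
    using flagreal_le_one[OF V x, of v] assms(3) by simp
  have "(\<Sum>u\<in>V - {v}. x u) = 1 - x v"
  proof (cases "v \<in> V")
    case True
    then show ?thesis using flagrealD(4)[OF x] sum.remove[OF V True, of x] by simp
  next
    case False
    then have "x v = 0" using flagrealD(2)[OF x] by blast
    then show ?thesis using False flagrealD(4)[OF x] by simp
  qed
  then have "(\<Sum>u\<in>V - {v}. push_off v x u) = 1"
    using lt by (simp add: push_off_def flip: sum_divide_distrib)
  moreover have "0 \<le> push_off v x u" for u
    using lt flagrealD(1)[OF x] by (simp add: push_off_def)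
  moreover have nz: "u \<noteq> v \<and> x u \<noteq> 0" if "push_off v x u \<noteq> 0" for u
    using that by (auto simp: push_off_def split: if_splits)
  moreover have "u \<in> V - {v}" if "push_off v x u \<noteq> 0" for u
    using nz[OF that] flagrealD(2)[OF x] by blast
  moreover have "R u w" if "push_off v x u \<noteq> 0" "push_off v x w \<noteq> 0" for u w
    using nz[OF that(1)] nz[OF that(2)] flagrealD(3)[OF x] by blast
  ultimately show ?thesis
    unfolding flagreal_def by blast
qed

lemma push_off_convex_comb:
  assumes V: "finite V" and x: "x \<in> flagreal R V" "x v \<noteq> 1" and t: "0 \<le> t" "t \<le> 1"
  shows "(\<lambda>u. (1 - t) * x u + t * push_off v x u) \<in> {x \<in> flagreal R V. x v \<noteq> 1}"
proof -
  have "R u w \<and> R w u" if "x u \<noteq> 0" "push_off v x w \<noteq> 0" for u w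
    using that flagrealD(3)[OF x(1)] by (auto simp: push_off_def split: if_splits)
  then have "(\<lambda>u. (1 - t) * x u + t * push_off v x u) \<in> flagreal R V"
    using flagreal_convex_comb[OF x(1) flagreal_mono[OF _ V push_off_in_flagreal[OF V x]] t] by blast
  moreover have "(1 - t) * x v < 1"
  proof -
    have "x v < 1" using flagreal_le_one[OF V x(1), of v] x(2) by simp
    moreover have "(1 - t) * x v \<le> 1 * x v"
      using t flagrealD(1)[OF x(1)] by (intro mult_right_mono) auto
    ultimately show ?thesis by simp
  qed
  ultimately show ?thesis by (simp add: push_off_def)
qed

text \<open>The subset \<open>S\<close> is kept general because the homotopy serves twice: on the
  whole complex without the point \<open>v\<close>, and on the punctured open star.\<close>

lemma homotopic_push_off:
  assumes V: "finite V" and S: "S \<subseteq> {x \<in> flagreal R V. x v \<noteq> 1}"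
  shows "homotopic_with (\<lambda>_. True) (top_of_set S) (top_of_set {x \<in> flagreal R V. x v \<noteq> 1})
           id (push_off v)"
proof (rule homotopic_with_linear_fun)
  show "continuous_on S (push_off v)"
    using S by (intro continuous_on_push_off) auto
  fix x t assume "x \<in> S" "0 \<le> (t::real)" "t \<le> 1"
  then show "(\<lambda>u. (1 - t) * id x u + t * push_off v x u) \<in> {x \<in> flagreal R V. x v \<noteq> 1}"
    using push_off_convex_comb[OF V, of x R v t] S unfolding id_apply by blast
qed simp

lemma push_off_id: "x v = 0 \<Longrightarrow> push_off v x = x"
  by (auto simp: push_off_def)

text \<open>Radial projection fixes every point with \<open>x v = 0\<close>, and the segment from a
  point to its projection avoids the vertex, so the projection is a deformation retraction.\<close>

lemma deletion_homotopy_equivalent: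
  assumes V: "finite V"
  shows "top_of_set {x \<in> flagreal R V. x v \<noteq> 1} homotopy_equivalent_space top_of_set (flagreal R (V - {v}))"
proof -
  let ?P = "{x \<in> flagreal R V. x v \<noteq> 1}"
  have zero: "x v = 0" if "x \<in> flagreal R (V - {v})" for x
    using flagrealD(2)[OF that, of v] by blast
  have sub: "x \<in> ?P" if "x \<in> flagreal R (V - {v})" for x
    using flagreal_mono[OF _ V that] zero[OF that] by simp
  have "homotopic_with (\<lambda>_. True) (top_of_set ?P) (top_of_set ?P) (id \<circ> push_off v) id"
    using homotopic_push_off[OF V order_refl] by (simp add: homotopic_with_symD)
  moreover have "homotopic_with (\<lambda>_. True) (top_of_set (flagreal R (V - {v})))
     (top_of_set (flagreal R (V - {v}))) (push_off v \<circ> id) id"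
    by (rule homotopic_with_equal)
       (auto simp: push_off_id zero intro!: continuous_map_into_fulltopology intro: continuous_on_eq[OF continuous_on_id])
  moreover have "continuous_map (top_of_set ?P) (top_of_set (flagreal R (V - {v}))) (push_off v)"
    using push_off_in_flagreal[OF V] by (auto intro!: continuous_on_push_off)
  moreover have "continuous_map (top_of_set (flagreal R (V - {v}))) (top_of_set ?P) id"
    using sub by auto
  ultimately show ?thesis
    unfolding homotopy_equivalent_space_def by blast
qed

lemma push_off_in_link:
  assumes V: "finite V" and x: "x \<in> flagreal R V" "x v \<noteq> 1" "x v \<noteq> 0"
  shows "push_off v x \<in> flagreal R (link R V v)"
proof (rule flagreal_restrict[OF _ _ push_off_in_flagreal[OF V x(1,2)]])
  fix u assume u: "push_off v x u \<noteq> 0"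
  then have "u \<noteq> v" "x u \<noteq> 0" by (auto simp: push_off_def split: if_splits)
  then show "u \<in> link R V v"
    using x flagrealD(2,3)[OF x(1)] by (auto simp: link_def)
qed (use V in \<open>auto simp: link_def\<close>)

lemma punctured_star_homotopy_equivalent:
  assumes V: "finite V" and v: "v \<in> V" "R v v"
  shows "top_of_set {x \<in> flagreal R V. x v \<noteq> 0 \<and> x v \<noteq> 1} homotopy_equivalent_space
         top_of_set (flagreal R (link R V v))"
proof -
  let ?O = "{x \<in> flagreal R V. x v \<noteq> 0 \<and> x v \<noteq> 1}" and ?L = "flagreal R (link R V v)"
  \<comment> \<open>Places the link inside the punctured star at height one half; any height
    strictly between 0 and 1 would serve.\<close>
  define h where "h = (\<lambda>y u. (1 - 1/2) * y u + 1/2 * vertex_point v u)"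
  have L: "y v = 0" "y \<in> flagreal R V" if "y \<in> ?L" for y
    using flagrealD(2)[OF that, of v] flagreal_mono[OF _ V that] by (auto simp: link_def)
  have vp: "vertex_point v \<in> flagreal R V"
    by (rule vertex_point_in_flagreal[where R=R, OF V v])
  have comb: "(\<lambda>u. (1 - t) * y u + t * vertex_point v u) \<in> flagreal R V"
    if "y \<in> flagreal R V" "\<And>u. y u \<noteq> 0 \<Longrightarrow> R u v \<and> R v u" "0 \<le> t" "t \<le> 1" for t y
    by (rule flagreal_convex_comb[OF that(1) vp that(3,4)])
       (use that(2) in \<open>auto simp: vertex_point_def split: if_splits\<close>)
  have "h y \<in> ?O" if "y \<in> ?L" for y
  proof -
    have "R u v \<and> R v u" if "y u \<noteq> 0" for u
      using flagrealD(2)[OF \<open>y \<in> ?L\<close> that] by (simp add: link_def)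
    then have "h y \<in> flagreal R V"
      unfolding h_def using L[OF that] by (intro comb) auto
    moreover have "h y v = 1/2"
      using L(1)[OF that] by (simp add: h_def vertex_point_def)
    ultimately show ?thesis by simp
  qed
  moreover have conth: "continuous_on S h" for S
    unfolding h_def by (intro continuous_on_coordinatewise_then_product continuous_intros)
  ultimately have "continuous_map (top_of_set ?L) (top_of_set ?O) h"
    by auto
  moreover have contp: "continuous_on ?O (push_off v)"
    by (rule continuous_on_push_off) auto
  moreover have "push_off v \<in> ?O \<rightarrow> ?L"
    using push_off_in_link[OF V] by auto
  ultimately have 1: "continuous_map (top_of_set ?L) (top_of_set ?O) h"
    "continuous_map (top_of_set ?O) (top_of_set ?L) (push_off v)"
    by auto
  have "push_off v (h y) = y" if "y \<in> ?L" for y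
    using L(1)[OF that] by (auto simp: push_off_def h_def vertex_point_def)
  then have 2: "homotopic_with (\<lambda>_. True) (top_of_set ?L) (top_of_set ?L) (push_off v \<circ> h) id"
    by (intro homotopic_with_equal continuous_map_compose[OF 1]) auto
  have "homotopic_with (\<lambda>_. True) (top_of_set ?O) (top_of_set ?O) id (h \<circ> push_off v)"
  proof (rule homotopic_with_linear_fun)
    show "continuous_on ?O (h \<circ> push_off v)"
      by (intro continuous_on_compose contp conth)
    fix x t assume x: "x \<in> ?O" and t: "0 \<le> (t::real)" "t \<le> 1"
    have nz: "x u \<noteq> 0" if "(h \<circ> push_off v) x u \<noteq> 0" for u
      using that x by (auto simp: h_def push_off_def vertex_point_def split: if_splits)
    have hp: "(h \<circ> push_off v) x \<in> flagreal R V"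
      using \<open>push_off v \<in> ?O \<rightarrow> ?L\<close> \<open>\<And>y. y \<in> ?L \<Longrightarrow> h y \<in> ?O\<close> x by fastforce
    have "(\<lambda>u. (1 - t) * x u + t * (h \<circ> push_off v) x u) \<in> flagreal R V"
      by (rule flagreal_convex_comb[OF _ hp t])
         (use x nz flagrealD(3)[of x R V] in auto)
    moreover have half: "(h \<circ> push_off v) x v = 1/2"
      by (simp add: h_def push_off_def vertex_point_def)
    moreover have "0 < (1 - t) * x v + t * (h \<circ> push_off v) x v"
      "(1 - t) * x v + t * (h \<circ> push_off v) x v < 1"
      unfolding half
    proof -
      have xv: "0 < x v" "x v < 1"
        using x flagrealD(1)[of x R V v] flagreal_le_one[OF V, of x R v] by auto
      show "0 < (1 - t) * x v + t * (1/2)"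
        using xv t by (cases "t = 0") (auto intro: add_nonneg_pos)
      have "(1 - t) * x v \<le> (1 - t) * 1"
        using xv t by (intro mult_left_mono) auto
      then show "(1 - t) * x v + t * (1/2) < 1"
        using xv t by (cases "t = 0") auto
    qed
    ultimately show "(\<lambda>u. (1 - t) * id x u + t * (h \<circ> push_off v) x u) \<in> ?O"
      unfolding mem_Collect_eq id_apply by (metis less_irrefl)
  qed simp
  then have 3: "homotopic_with (\<lambda>_. True) (top_of_set ?O) (top_of_set ?O) (h \<circ> push_off v) id"
    by (simp add: homotopic_with_symD)
  show ?thesis
    unfolding homotopy_equivalent_space_def using 1 2 3 by blast
qed

text \<open>The open star is star-shaped about \<open>v\<close>: along a segment towards
  \<open>v\<close> the coordinate at \<open>v\<close> stays positive.\<close>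

lemma open_star_contractible:
  assumes V: "finite V" and v: "v \<in> V" "R v v"
  shows "contractible_space (top_of_set {x \<in> flagreal R V. x v \<noteq> 0})"
proof -
  let ?O = "{x \<in> flagreal R V. x v \<noteq> 0}"
  have vp: "vertex_point v \<in> flagreal R V"
    by (rule vertex_point_in_flagreal[where R=R, OF V v])
  have "homotopic_with (\<lambda>_. True) (top_of_set ?O) (top_of_set ?O) id (\<lambda>_. vertex_point v)"
  proof (rule homotopic_with_linear_fun)
    fix x t assume x: "x \<in> ?O" and t: "0 \<le> (t::real)" "t \<le> 1"
    have "(\<lambda>u. (1 - t) * x u + t * vertex_point v u) \<in> flagreal R V"
      by (rule flagreal_convex_comb[OF _ vp t])
         (use x flagrealD(3)[of x R V] in \<open>auto simp: vertex_point_def split: if_splits\<close>)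
    moreover have "0 < (1 - t) * x v + t * vertex_point v v"
    proof -
      have "0 < x v"
        using x flagrealD(1)[of x R V v] by auto
      then show ?thesis
        using t by (cases "t = 0") (auto simp: vertex_point_def intro: add_nonneg_pos)
    qed
    ultimately show "(\<lambda>u. (1 - t) * id x u + t * vertex_point v u) \<in> ?O"
      by simp
  qed simp_all
  then show ?thesis
    unfolding contractible_space_def by blast
qed

lemma subtopology_top_of_set_eq: "A \<inter> B = C \<Longrightarrow> subtopology (top_of_set A) B = top_of_set C"
  by (simp add: subtopology_subtopology)

lemma homotopy_equivalent_space_topspace_empty:
  assumes "X homotopy_equivalent_space Y"
  shows "topspace X = {} \<longleftrightarrow> topspace Y = {}"
proof -
  obtain f g where "continuous_map X Y f" "continuous_map Y X g"
    using assms unfolding homotopy_equivalent_space_def by blast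
  then have "f ` topspace X \<subseteq> topspace Y" "g ` topspace Y \<subseteq> topspace X"
    by (simp_all add: continuous_map_image_subset_topspace)
  then show ?thesis by auto
qed

lemma relative_homology_group_cong:
  "topspace X \<inter> S = topspace X \<inter> T \<Longrightarrow> relative_homology_group p X S = relative_homology_group p X T"
  by (metis relative_homology_group_restrict)

text \<open>For a contractible space the connecting map identifies relative homology with the
  reduced homology of the subspace one degree lower; here the subspace is the punctured star, which
  is equivalent to the link.\<close>

lemma open_star_homology_nonzero_iff:
  assumes V: "finite V" and v: "v \<in> V" and R: "\<And>u. u \<in> V \<Longrightarrow> R u u"
  shows "\<not> trivial_group (relative_homology_group d (top_of_set {x \<in> flagreal R V. x v \<noteq> 0})
             {x \<in> flagreal R V. x v \<noteq> 1}) \<longleftrightarrow> flag_nonzero (d - 1) R (link R V v)"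
proof -
  let ?P = "{x \<in> flagreal R V. x v \<noteq> 1}" and ?O = "{x \<in> flagreal R V. x v \<noteq> 0}"
    and ?L = "flagreal R (link R V v)"
  have vp: "vertex_point v \<in> ?O"
    using vertex_point_in_flagreal[where R=R, OF V v R[OF v]] by (simp add: vertex_point_def)
  have contr: "contractible_space (top_of_set ?O)"
    by (rule open_star_contractible[where R=R, OF V v R[OF v]])
  have OP: "subtopology (top_of_set ?O) ?P = top_of_set {x \<in> flagreal R V. x v \<noteq> 0 \<and> x v \<noteq> 1}"
    by (rule subtopology_top_of_set_eq) auto
  have equiv: "top_of_set {x \<in> flagreal R V. x v \<noteq> 0 \<and> x v \<noteq> 1} homotopy_equivalent_space top_of_set ?L"
    by (rule punctured_star_homotopy_equivalent[where R=R, OF V v R[OF v]])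
  have OL: "{x \<in> flagreal R V. x v \<noteq> 0 \<and> x v \<noteq> 1} = {} \<longleftrightarrow> ?L = {}"
    using homotopy_equivalent_space_topspace_empty[OF equiv] by simp
  have OPset: "?O \<inter> ?P = {x \<in> flagreal R V. x v \<noteq> 0 \<and> x v \<noteq> 1}"
    by auto
  show ?thesis
  proof (cases "?L = {}")
    case False
    then have ne: "topspace (top_of_set ?O) \<inter> ?P \<noteq> {}"
      using OL by (simp only: topspace_euclidean_subtopology OPset) simp
    have "relative_homology_group d (top_of_set ?O) ?P \<cong>
               reduced_homology_group (d - 1) (subtopology (top_of_set ?O) ?P)"
      by (rule isomorphic_group_relative_homology_of_contractible[OF contr ne])
    also have "\<dots> \<cong> reduced_homology_group (d - 1) (top_of_set ?L)"
      unfolding OP by (rule homotopy_equivalent_space_imp_isomorphic_reduced_homology_groups[OF equiv])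
    finally have iso: "relative_homology_group d (top_of_set ?O) ?P \<cong> reduced_homology_group (d - 1) (top_of_set ?L)" .
    then show ?thesis
      using False isomorphic_group_triviality[OF iso] by (simp add: reduced_homology_nonzero_def)
  next
    \<comment> \<open>An empty link means that the open star is the single point \<open>v\<close>
      and the punctured star is empty. The relative group is then the homology of a point, nonzero
      exactly in degree 0, which agrees with degree -1 for the empty space.\<close>
    case True
    then have disj: "?O \<inter> ?P = {}"
      using OL by (simp only: OPset)
    then have "relative_homology_group d (top_of_set ?O) ?P = homology_group d (top_of_set ?O)"
      by (intro relative_homology_group_cong) (simp only: topspace_euclidean_subtopology disj Int_empty_right)
    moreover have only: "x = vertex_point v" if "x \<in> ?O" for x
      using that disj flagreal_eq_vertex_point[OF V, of x R v] by blast
    have O: "topspace (top_of_set ?O) = {vertex_point v}"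
      unfolding topspace_euclidean_subtopology using vp only by blast
    have "trivial_group (homology_group d (top_of_set ?O)) \<longleftrightarrow> d \<noteq> 0"
    proof (cases "d = 0")
      case True
      have "path_connected_space (top_of_set ?O)"
        using contr contractible_imp_path_connected_space by blast
      then have iso: "homology_group 0 (top_of_set ?O) \<cong> integer_group"
        using vp by (intro isomorphic_integer_zeroth_homology_group) auto
      then show ?thesis
        using True isomorphic_group_triviality[OF iso] nontrivial_integer_group by simp
    next
      case False
      then show ?thesis
        using homology_dimension_axiom[OF O False] by simp
    qed
    ultimately show ?thesis
      using True by (auto simp: reduced_homology_nonzero_def)
  qed
qed

text \<open>Reduced homology is a subgroup of ordinary homology with the same unit, so the
  factorisation is carried out on elements, with the maps acting on the unreduced groups.\<close>

lemma trivial_hom_induced_reduced_through: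
  assumes f: "continuous_map X Y f" and g: "continuous_map Y Z g"
    and Y: "trivial_group (reduced_homology_group p Y)"
    and c: "c \<in> carrier (reduced_homology_group p X)"
  shows "hom_induced p X {} Z {} (g \<circ> f) c = \<one>\<^bsub>reduced_homology_group p Z\<^esub>"
proof -
  have "hom_induced p X {} Y {} f c = \<one>\<^bsub>homology_group p Y\<^esub>"
    using hom_induced_reduced[OF c, of Y f] Y
    by (simp add: trivial_group_def one_reduced_homology_group)
  moreover have "hom_induced p X {} Z {} (g \<circ> f) c = hom_induced p Y {} Z {} g (hom_induced p X {} Y {} f c)"
    using hom_induced_compose_empty[OF f g] by simp
  moreover have "hom_induced p Y {} Z {} g \<one>\<^bsub>homology_group p Y\<^esub> = \<one>\<^bsub>homology_group p Z\<^esub>"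
    by (intro hom_one[OF hom_induced_empty_hom]) auto
  ultimately show ?thesis
    by (simp add: one_reduced_homology_group)
qed

text \<open>
  Excising the deletion of \<open>v\<close> turns the pair of the complex and its complement of the point \<open>v\<close> into
  the open star of \<open>v\<close> and the punctured star, which retracts to the link. The connecting map is zero
  because it factors through the acyclic complex on \<open>C\<close>.
\<close>

lemma flag_nonzero_vertex_deletion:
  assumes V: "finite V" and v: "v \<in> V" and R: "\<And>u. u \<in> V \<Longrightarrow> R u u"
    and C: "link R V v \<subseteq> C" "C \<subseteq> V - {v}" and acyclic: "\<And>d. \<not> flag_nonzero d R C"
  shows "flag_nonzero d R V \<longleftrightarrow> flag_nonzero d R (V - {v}) \<or> flag_nonzero (d - 1) R (link R V v)"
proof -
  let ?X = "top_of_set (flagreal R V)"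
  let ?P = "{x \<in> flagreal R V. x v \<noteq> 1}" and ?O = "{x \<in> flagreal R V. x v \<noteq> 0}"
    and ?L = "flagreal R (link R V v)"
  let ?XP = "top_of_set ?P" and ?XO = "top_of_set ?O"
  let ?OP = "{x \<in> flagreal R V. x v \<noteq> 0 \<and> x v \<noteq> 1}"
  have subP: "subtopology ?X ?P = ?XP"
    by (rule subtopology_top_of_set_eq) auto
  have subOP: "subtopology ?XO ?P = top_of_set ?OP"
    by (rule subtopology_top_of_set_eq) auto
  have Cfin: "finite C"
    using C(2) V finite_subset by blast
  \<comment> \<open>An empty complex would be nonzero in degree -1, so acyclicity in all degrees
    includes nonemptiness.\<close>
  have "flagreal R C \<noteq> {}"
    using acyclic[of "-1"] by (auto simp: reduced_homology_nonzero_def)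
  then have Cac: "trivial_group (reduced_homology_group p (top_of_set (flagreal R C)))" for p
    using acyclic[of p] by (auto simp: reduced_homology_nonzero_def)
  have CP: "x \<in> ?P" if "x \<in> flagreal R C" for x
    using flagreal_mono[OF _ V that] flagrealD(2)[OF that, of v] C(2) by force
  have Cne: "?P \<noteq> {}"
    using CP \<open>flagreal R C \<noteq> {}\<close> by blast
  have excision: "hom_induced p ?XO ?OP ?X ?P id
      \<in> iso (relative_homology_group p ?XO ?OP) (relative_homology_group p ?X ?P)" for p
  proof -
    let ?U = "{x \<in> flagreal R V. x v = 0}"
    have closed: "closedin ?X ?U"
      by (rule continuous_closedin_preimage_constant) (rule continuous_intros)
    have "closedin ?X {x \<in> flagreal R V. x v = 1}"
      by (rule continuous_closedin_preimage_constant) (rule continuous_intros)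
    then have "openin ?X (flagreal R V - {x \<in> flagreal R V. x v = 1})"
      by (intro openin_diff) auto
    moreover have "flagreal R V - {x \<in> flagreal R V. x v = 1} = ?P"
      by auto
    ultimately have "openin ?X ?P"
      by metis
    with closed have "?X closure_of ?U \<subseteq> ?X interior_of ?P"
      by (auto simp: closure_of_closedin interior_of_openin)
    then have "hom_induced p (subtopology ?X (flagreal R V - ?U)) (?P - ?U) (subtopology ?X (flagreal R V)) ?P id
      \<in> iso (relative_homology_group p (subtopology ?X (flagreal R V - ?U)) (?P - ?U))
            (relative_homology_group p (subtopology ?X (flagreal R V)) ?P)"
      by (intro homology_excision_axiom) auto
    moreover have "?P - ?U = ?OP" "flagreal R V - ?U = ?O" by auto
    moreover have "subtopology ?X ?O = ?XO"
      by (rule subtopology_top_of_set_eq) auto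
    ultimately show ?thesis
      by (simp add: subtopology_subtopology)
  qed
  have relOP: "relative_homology_group p ?XO ?OP = relative_homology_group p ?XO ?P" for p
    by (rule relative_homology_group_cong) auto
  have inclusion_zero: "hom_induced p (top_of_set ?OP) {} ?XP {} id c = \<one>\<^bsub>reduced_homology_group p ?XP\<^esub>"
    if "c \<in> carrier (reduced_homology_group p (top_of_set ?OP))" for p c
  proof -
    have "homotopic_with (\<lambda>_. True) (top_of_set ?OP) ?XP id (push_off v)"
      by (rule homotopic_push_off[OF V]) auto
    then have eq: "hom_induced p (top_of_set ?OP) {} ?XP {} id = hom_induced p (top_of_set ?OP) {} ?XP {} (id \<circ> push_off v)"
      by (simp add: homology_homotopy_empty)
    have "push_off v x \<in> flagreal R C" if "x \<in> ?OP" for x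
      using push_off_in_link[OF V, of x R v] that flagreal_mono[OF C(1) Cfin] by blast
    then have 1: "continuous_map (top_of_set ?OP) (top_of_set (flagreal R C)) (push_off v)"
      by (auto intro!: continuous_on_push_off)
    have 2: "continuous_map (top_of_set (flagreal R C)) ?XP id"
      using CP by auto
    show ?thesis
      unfolding eq by (rule trivial_hom_induced_reduced_through[OF 1 2 Cac that])
  qed
  have boundary_zero: "hom_boundary p ?X ?P c = \<one>\<^bsub>reduced_homology_group (p - 1) ?XP\<^esub>"
    if c: "c \<in> carrier (relative_homology_group p ?X ?P)" for p c
  proof -
    obtain c' where c': "c' \<in> carrier (relative_homology_group p ?XO ?OP)"
      and ceq: "c = hom_induced p ?XO ?OP ?X ?P id c'"
      using excision[of p] c by (auto simp: iso_def bij_betw_def)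
    have sub: "subtopology ?XO ?OP = top_of_set ?OP"
      by (rule subtopology_top_of_set_eq) auto
    have "hom_boundary p ?X ?P c
        = hom_induced (p - 1) (subtopology ?XO ?OP) {} (subtopology ?X ?P) {} id (hom_boundary p ?XO ?OP c')"
      unfolding ceq using naturality_hom_induced[of ?XO ?X id ?OP ?P p] by (auto simp: fun_eq_iff)
    moreover have "hom_boundary p ?XO ?OP c' \<in> carrier (reduced_homology_group (p - 1) (subtopology ?XO ?OP))"
      using hom_in_carrier[OF hom_boundary_reduced_hom c'] .
    ultimately show ?thesis
      using inclusion_zero unfolding sub subP by simp
  qed
  have inj: "inj_on (hom_induced d ?XP {} ?X {} id) (carrier (reduced_homology_group d ?XP))"
  proof -
    have ex: "exact_seq ([reduced_homology_group d ?X, reduced_homology_group d ?XP,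
                 relative_homology_group (d + 1) ?X ?P],
                [hom_induced d ?XP {} ?X {} id, hom_boundary (d + 1) ?X ?P])"
      using homology_exactness_reduced_2[of "d + 1" ?X ?P] by (simp add: subP)
    then have "kernel (reduced_homology_group d ?XP) (reduced_homology_group d ?X) (hom_induced d ?XP {} ?X {} id)
       = hom_boundary (d + 1) ?X ?P ` carrier (relative_homology_group (d + 1) ?X ?P)"
      by simp
    also have "\<dots> \<subseteq> {\<one>\<^bsub>reduced_homology_group d ?XP\<^esub>}"
      using boundary_zero[of _ "d + 1"] by auto
    finally have ker: "kernel (reduced_homology_group d ?XP) (reduced_homology_group d ?X) (hom_induced d ?XP {} ?X {} id)
       \<subseteq> {\<one>\<^bsub>reduced_homology_group d ?XP\<^esub>}" .
    interpret group_hom "reduced_homology_group d ?XP" "reduced_homology_group d ?X" "hom_induced d ?XP {} ?X {} id"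
      by (simp add: group_hom_def group_hom_axioms_def hom_induced_reduced_hom)
    show ?thesis
      using ker by (intro trivial_ker_imp_inj) (auto simp: kernel_def)
  qed
  have surj: "hom_induced d ?X {} ?X ?P id ` carrier (reduced_homology_group d ?X)
      = carrier (relative_homology_group d ?X ?P)"
  proof -
    have "flagreal R V \<inter> ?P \<noteq> {}"
      using Cne by auto
    then have "hom_induced d ?X {} ?X ?P id ` carrier (reduced_homology_group d ?X)
       = kernel (relative_homology_group d ?X ?P) (reduced_homology_group (d - 1) (subtopology ?X ?P)) (hom_boundary d ?X ?P)"
      using homology_exactness_reduced_1[of ?X ?P d] by simp
    then show ?thesis
      using boundary_zero[of _ d] by (auto simp: kernel_def subP)
  qed
  have ex: "exact_seq([relative_homology_group d ?X ?P, reduced_homology_group d ?X, reduced_homology_group d ?XP],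
              [hom_induced d ?X {} ?X ?P id, hom_induced d ?XP {} ?X {} id])"
    using homology_exactness_reduced_3[of d ?X ?P] unfolding subP .
  have "\<not> trivial_group (relative_homology_group d ?X ?P) \<longleftrightarrow> flag_nonzero (d - 1) R (link R V v)"
    using open_star_homology_nonzero_iff[where d = d and R = R, OF V v R] excision[of d] relOP[of d]
      isomorphic_group_triviality[OF is_isoI[OF excision[of d]]] by simp
  moreover have "\<not> trivial_group (reduced_homology_group d ?XP) \<longleftrightarrow> flag_nonzero d R (V - {v})"
  proof -
    have "?XP homotopy_equivalent_space top_of_set (flagreal R (V - {v}))"
      by (rule deletion_homotopy_equivalent[OF V])
    moreover from this have "flagreal R (V - {v}) \<noteq> {}"
      using Cne homotopy_equivalent_space_topspace_empty by fastforce
    ultimately show ?thesis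
      using isomorphic_group_triviality[OF homotopy_equivalent_space_imp_isomorphic_reduced_homology_groups]
      by (simp add: reduced_homology_nonzero_def)
  qed
  moreover have "flagreal R V \<noteq> {}"
    using Cne by auto
  ultimately show ?thesis
    using trivial_group_middle[OF ex inj surj] by (auto simp: reduced_homology_nonzero_def)
qed

section \<open>Families of splits\<close>

text \<open>No two vertices outside \<open>C\<close> are adjacent. So the link of each lies in
  \<open>C\<close> and does not change while the others are added, and they can be attached to
  \<open>C\<close> one after the other, like a wedge of suspended links.\<close>

lemma flag_nonzero_wedge:
  assumes V: "finite V" and R: "\<And>u. u \<in> V \<Longrightarrow> R u u" and C: "C \<subseteq> V"
    and acyclic: "\<And>d. \<not> flag_nonzero d R C"
    and indep: "\<And>b b'. b \<in> V - C \<Longrightarrow> b' \<in> V - C \<Longrightarrow> b \<noteq> b' \<Longrightarrow> \<not> (R b b' \<and> R b' b)"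
  shows "flag_nonzero d R V \<longleftrightarrow> (\<exists>b\<in>V - C. flag_nonzero (d - 1) R (link R V b))"
proof -
  have "flag_nonzero d R (C \<union> D) \<longleftrightarrow> (\<exists>b\<in>D. flag_nonzero (d - 1) R (link R V b))"
    if "D \<subseteq> V - C" for D
    using finite_subset[OF that finite_Diff[OF V]] that
  proof (induction D rule: finite_induct)
    case empty
    then show ?case using acyclic by simp
  next
    case (insert b D)
    have "link R (C \<union> insert b D) b = link R V b"
      using insert.prems insert.hyps C indep unfolding link_def by blast
    moreover have "link R V b \<subseteq> C"
      using insert.prems indep unfolding link_def by blast
    moreover have "C \<union> insert b D - {b} = C \<union> D"
      using insert by auto
    moreover have "finite (C \<union> insert b D)"
      using V C insert.hyps(1) finite_subset by auto
    moreover have "R u u" if "u \<in> C \<union> insert b D" for u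
      using that R C insert.prems by blast
    ultimately have "flag_nonzero d R (C \<union> insert b D) \<longleftrightarrow>
        flag_nonzero d R (C \<union> D) \<or> flag_nonzero (d - 1) R (link R V b)"
      using flag_nonzero_vertex_deletion[where V = "C \<union> insert b D" and v = b and C = C and R = R and d = d]
        acyclic by auto
    then show ?case using insert by auto
  qed
  from this[OF order_refl] show ?thesis
    using C by (simp add: Un_absorb1)
qed

definition laminar_pair :: "'a set \<Rightarrow> 'a set \<Rightarrow> bool" where
  "laminar_pair S T \<longleftrightarrow> S \<subseteq> T \<or> T \<subseteq> S \<or> S \<inter> T = {}"

lemma laminar_pair_refl [simp]: "laminar_pair S S"
  by (simp add: laminar_pair_def)

lemma laminar_pair_sym: "laminar_pair S T \<longleftrightarrow> laminar_pair T S"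
  by (auto simp: laminar_pair_def)

text \<open>The sets are removed in order of increasing size. For a smallest \<open>S\<close> the
  link is a cone with apex \<open>S - x\<close>: a neighbour in \<open>W\<close> misses
  \<open>x\<close> and so cannot contain \<open>S\<close>, and a neighbour in \<open>D\<close> meets
  \<open>S\<close> in \<open>x\<close> and is not inside \<open>S\<close> by minimality, so it
  contains \<open>S\<close>.\<close>

lemma flag_nonzero_remove_dominated:
  assumes "finite D" "finite W" "\<And>S. S \<in> D \<Longrightarrow> x \<subseteq> S \<and> finite S \<and> S - x \<in> W" "x \<noteq> {}"
    and W: "\<And>T. T \<in> W \<Longrightarrow> T \<inter> x = {}"
  shows "flag_nonzero d laminar_pair (W \<union> D) \<longleftrightarrow> flag_nonzero d laminar_pair W"
  using assms(1,3)
proof (induction "card D" arbitrary: D)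
  case 0
  then show ?case by simp
next
  case (Suc c)
  then have "D \<noteq> {}" by auto
  obtain S where S: "S \<in> D" "\<And>T. T \<in> D \<Longrightarrow> card S \<le> card T"
    using ex_min_if_finite[of "card ` D"] Suc.prems(1) \<open>D \<noteq> {}\<close>
    by (metis (no_types, lifting) arg_min_if_finite(1) arg_min_least)
  have xS: "x \<subseteq> S" "finite S" "S - x \<in> W"
    using Suc.prems(2)[OF S(1)] by auto
  have notW: "S \<notin> W" using W[of S] xS(1) \<open>x \<noteq> {}\<close> by auto
  let ?K = "W \<union> D"
  have K: "finite ?K" using Suc.prems(1) assms(2) by simp
  have apex: "S - x \<in> link laminar_pair ?K S"
    using xS notW by (auto simp: link_def laminar_pair_def)
  have cone: "laminar_pair (S - x) T" if T: "T \<in> link laminar_pair ?K S" for T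
  proof (cases "T \<in> W")
    case True
    have "laminar_pair T S" "T \<inter> x = {}" using T W[OF True] by (auto simp: link_def)
    moreover have "\<not> S \<subseteq> T" using \<open>T \<inter> x = {}\<close> xS(1) \<open>x \<noteq> {}\<close> by blast
    ultimately show ?thesis by (auto simp: laminar_pair_def)
  next
    case False
    then have "T \<in> D" "T \<noteq> S" "laminar_pair T S" using T by (auto simp: link_def)
    then have "\<not> T \<subseteq> S"
      using S(2)[OF \<open>T \<in> D\<close>] xS(2) card_subset_eq[of S T] card_mono[of S T] by (metis le_antisym)
    moreover have "S \<inter> T \<noteq> {}" using Suc.prems(2)[OF \<open>T \<in> D\<close>] xS(1) \<open>x \<noteq> {}\<close> by blast
    ultimately show ?thesis using \<open>laminar_pair T S\<close> by (auto simp: laminar_pair_def)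
  qed
  have acyc: "\<not> flag_nonzero d laminar_pair (link laminar_pair ?K S)" for d
    using cone laminar_pair_sym apex K
    by (intro flag_nonzero_cone[of _ "S - x"]) (auto simp: link_def)
  \<comment> \<open>The link, being a cone, is itself taken as the acyclic subcomplex.\<close>
  have "flag_nonzero d laminar_pair ?K \<longleftrightarrow> flag_nonzero d laminar_pair (?K - {S}) \<or> flag_nonzero (d - 1) laminar_pair (link laminar_pair ?K S)"
    using K S(1) acyc
    by (intro flag_nonzero_vertex_deletion[where C = "link laminar_pair ?K S"]) (auto simp: link_def)
  also have "?K - {S} = W \<union> (D - {S})"
    using notW by auto
  also have "flag_nonzero d laminar_pair (W \<union> (D - {S})) \<longleftrightarrow> flag_nonzero d laminar_pair W"
    using Suc.prems Suc.hyps(2) S(1) by (intro Suc.hyps(1)) auto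
  finally show ?case using acyc by simp
qed

section \<open>Block systems, their splits and merging\<close>

definition heavy :: "nat \<Rightarrow> nat set \<Rightarrow> bool" where
  "heavy m S \<longleftrightarrow> 1 \<in> S \<or> m \<le> card S"

lemma heavy_mono: "heavy m S \<Longrightarrow> S \<subseteq> T \<Longrightarrow> finite T \<Longrightarrow> heavy m T"
  unfolding heavy_def by (meson card_mono order_trans subsetD)

text \<open>The blocks take over the role of the marks after merging, and
  \<open>S \<notin> P\<close> replaces the exclusion of singletons. The threshold \<open>m\<close>
  stands for \<open>l + 1\<close>, the least number of weights \<open>1/l\<close> with sum greater
  than 1.\<close>

definition block_splits :: "nat \<Rightarrow> nat set set \<Rightarrow> nat set set" where
  "block_splits m P = {S. S \<subset> \<Union>P \<and> S \<noteq> {} \<and> S \<notin> P \<and> (\<forall>p\<in>P. p \<subseteq> S \<or> p \<inter> S = {}) \<and> heavy m S}"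

text \<open>Light blocks are single marks, so cardinality counts them. Merging preserves this shape
  because only heavy sets are ever merged into a block.\<close>

definition block_system :: "nat \<Rightarrow> nat set set \<Rightarrow> bool" where
  "block_system m P \<longleftrightarrow> finite P \<and> disjoint P \<and> (\<forall>p\<in>P. finite p \<and> p \<noteq> {} \<and> (heavy m p \<or> card p = 1))"

lemma finite_block_splits:
  assumes "block_system m P"
  shows "finite (block_splits m P)" "S \<in> block_splits m P \<Longrightarrow> finite S"
proof -
  have "finite (\<Union>P)" using assms by (auto simp: block_system_def)
  moreover have "block_splits m P \<subseteq> Pow (\<Union>P)" by (auto simp: block_splits_def)
  ultimately show "finite (block_splits m P)" "S \<in> block_splits m P \<Longrightarrow> finite S"
    by (auto intro: finite_subset)
qed

definition merge_blocks :: "nat set set \<Rightarrow> nat set \<Rightarrow> nat set set" where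
  "merge_blocks P b = insert b {p \<in> P. p \<inter> b = {}}"

lemma block_system_disjointD:
  assumes "block_system m P" "p \<in> P" "q \<in> P" "p \<inter> q \<noteq> {}"
  shows "p = q"
  using assms unfolding block_system_def disjoint_def by blast

lemma block_system_merge:
  assumes "block_system m P" "b \<in> block_splits m P"
  shows "block_system m (merge_blocks P b)"
proof -
  have "disjoint (merge_blocks P b)"
    using assms(1) unfolding merge_blocks_def block_system_def disjoint_def by blast
  moreover have "finite b" "b \<noteq> {}" "heavy m b"
    using finite_block_splits[OF assms(1)] assms(2) by (auto simp: block_splits_def)
  ultimately show ?thesis
    using assms(1) by (auto simp: block_system_def merge_blocks_def)
qed

lemma Union_merge_blocks:
  assumes "b \<in> block_splits m P"
  shows "\<Union>(merge_blocks P b) = \<Union>P"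
proof (rule subset_antisym; rule subsetI)
  fix i assume "i \<in> \<Union>(merge_blocks P b)"
  then show "i \<in> \<Union>P"
    using assms by (auto simp: merge_blocks_def block_splits_def)
next
  fix i assume "i \<in> \<Union>P"
  then obtain p where "p \<in> P" "i \<in> p" by blast
  moreover have "p \<subseteq> b \<or> p \<inter> b = {}"
    using assms \<open>p \<in> P\<close> by (simp add: block_splits_def)
  ultimately show "i \<in> \<Union>(merge_blocks P b)"
    unfolding merge_blocks_def by blast
qed

text \<open>As no split lies properly inside \<open>b\<close>, a neighbour of \<open>b\<close>
  either contains it or is disjoint from it, that is, it treats \<open>b\<close> as one
  block.\<close>

lemma link_block_splits:
  assumes P: "block_system m P" and b: "b \<in> block_splits m P"
    and min: "\<And>S. S \<in> block_splits m P \<Longrightarrow> \<not> S \<subset> b"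
  shows "link laminar_pair (block_splits m P) b = block_splits m (merge_blocks P b)"
proof -
  have ne: "p \<noteq> {}" if "p \<in> P" for p using P that by (auto simp: block_system_def)
  have bsat: "p \<subseteq> b \<or> p \<inter> b = {}" if "p \<in> P" for p using b that by (auto simp: block_splits_def)
  have bne: "b \<noteq> {}" "b \<notin> P" using b by (auto simp: block_splits_def)
  show ?thesis
  proof (rule subset_antisym; rule subsetI)
    fix S assume S: "S \<in> link laminar_pair (block_splits m P) b"
    then have "b \<subseteq> S \<or> b \<inter> S = {}" "S \<noteq> b"
      using min[of S] by (auto simp: link_def laminar_pair_def)
    then show "S \<in> block_splits m (merge_blocks P b)"
      using S Union_merge_blocks[OF b] by (auto simp: link_def block_splits_def merge_blocks_def)
  next
    fix S assume S: "S \<in> block_splits m (merge_blocks P b)"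
    then have bS: "b \<subseteq> S \<or> b \<inter> S = {}" "S \<noteq> b" by (auto simp: block_splits_def merge_blocks_def)
    have "p \<subseteq> S \<or> p \<inter> S = {}" if "p \<in> P" for p
      using bsat[OF that] bS S that by (auto simp: block_splits_def merge_blocks_def)
    \<comment> \<open>A block of \<open>P\<close> disjoint from \<open>b\<close> is still a block
      after merging and thus excluded; one inside \<open>b\<close> would have to contain
      \<open>b\<close>.\<close>
    moreover have "S \<notin> P"
    proof
      assume "S \<in> P"
      then have "S \<subseteq> b" using S bsat by (auto simp: block_splits_def merge_blocks_def)
      then show False using bS ne[OF \<open>S \<in> P\<close>] by auto
    qed
    ultimately show "S \<in> link laminar_pair (block_splits m P) b"
      using S bS Union_merge_blocks[OF b] by (auto simp: link_def block_splits_def laminar_pair_def)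
  qed
qed

lemma flag_nonzero_empty: "flag_nonzero d R {} \<longleftrightarrow> d = -1"
proof -
  have "flagreal R {} = {}"
    by (auto simp: flagreal_def)
  then show ?thesis
    by (simp add: reduced_homology_nonzero_def)
qed

text \<open>Base of the induction: with two blocks the complex is empty, which accounts for degree
  -1.\<close>

lemma block_splits_pair:
  assumes P: "block_system m P" and "card P = 2"
  shows "block_splits m P = {}"
proof -
  obtain p q where P: "P = {p, q}"
    using \<open>card P = 2\<close> by (meson card_2_iff)
  show ?thesis
    unfolding block_splits_def P by auto
qed

text \<open>The splits left over after removing the cone and the dominated sets all contain
  \<open>x\<close> and are minimal among all splits. So no two of them are nested or disjoint, as
  \<open>flag_nonzero_wedge\<close> requires, and the same minimality turns their links into merged
  block systems.\<close>

lemma flag_nonzero_block_recursion: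
  assumes P: "block_system m P" and x: "x \<in> P" and top: "\<Union>P - x \<in> block_splits m P"
    and min: "\<And>b S. b \<in> block_splits m P \<Longrightarrow> x \<subseteq> b \<Longrightarrow> b - x \<notin> block_splits m P \<Longrightarrow>
                S \<in> block_splits m P \<Longrightarrow> \<not> S \<subset> b"
  shows "flag_nonzero d laminar_pair (block_splits m P) \<longleftrightarrow>
    (\<exists>b. b \<in> block_splits m P \<and> x \<subseteq> b \<and> b - x \<notin> block_splits m P \<and>
         flag_nonzero (d - 1) laminar_pair (block_splits m (merge_blocks P b)))"
proof -
  let ?V = "block_splits m P"
  define W where "W = {S \<in> ?V. S \<inter> x = {}}"
  define D where "D = {S \<in> ?V. x \<subseteq> S \<and> S - x \<in> ?V}"
  have fin: "finite ?V" "\<And>S. S \<in> ?V \<Longrightarrow> finite S"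
    using finite_block_splits[OF P] by auto
  have xne: "x \<noteq> {}" using P x by (auto simp: block_system_def)
  have sat: "x \<subseteq> S \<or> S \<inter> x = {}" if "S \<in> ?V" for S
    using that x by (auto simp: block_splits_def)
  have bad: "b \<in> ?V - (W \<union> D) \<longleftrightarrow> b \<in> ?V \<and> x \<subseteq> b \<and> b - x \<notin> ?V" for b
    using sat[of b] xne unfolding W_def D_def by blast
  have "\<not> flag_nonzero d laminar_pair W" for d
  proof (rule flag_nonzero_cone[of _ "\<Union>P - x"])
    show "finite W" using fin by (simp add: W_def)
    show "\<Union>P - x \<in> W" using top by (auto simp: W_def)
    show "laminar_pair (\<Union>P - x) S \<and> laminar_pair S (\<Union>P - x)" if "S \<in> W" for S
      using that unfolding W_def block_splits_def laminar_pair_def by blast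
  qed
  moreover have "flag_nonzero d laminar_pair (W \<union> D) \<longleftrightarrow> flag_nonzero d laminar_pair W" for d
  proof (rule flag_nonzero_remove_dominated[where x = x])
    show "finite D" "finite W" using fin by (auto simp: D_def W_def)
    show "x \<subseteq> S \<and> finite S \<and> S - x \<in> W" if "S \<in> D" for S
      using that fin unfolding D_def W_def by blast
    show "T \<inter> x = {}" if "T \<in> W" for T
      using that by (simp add: W_def)
  qed (rule xne)
  ultimately have acyc: "\<not> flag_nonzero d laminar_pair (W \<union> D)" for d
    by simp
  have "flag_nonzero d laminar_pair ?V \<longleftrightarrow>
      (\<exists>b\<in>?V - (W \<union> D). flag_nonzero (d - 1) laminar_pair (link laminar_pair ?V b))"
  proof (rule flag_nonzero_wedge[OF fin(1) _ _ acyc])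
    show "W \<union> D \<subseteq> ?V" by (auto simp: W_def D_def)
    fix b b' assume b: "b \<in> ?V - (W \<union> D)" "b' \<in> ?V - (W \<union> D)" "b \<noteq> b'"
    then have "\<not> b \<subset> b'" "\<not> b' \<subset> b"
      using min[of b b'] min[of b' b] unfolding bad by blast+
    moreover have "b \<inter> b' \<noteq> {}"
      using b xne unfolding bad by blast
    ultimately show "\<not> (laminar_pair b b' \<and> laminar_pair b' b)"
      using b(3) unfolding laminar_pair_def by blast
  qed simp
  moreover have "link laminar_pair ?V b = block_splits m (merge_blocks P b)" if "b \<in> ?V - (W \<union> D)" for b
    using that link_block_splits[OF P, of b] min unfolding bad by blast
  ultimately show ?thesis
    unfolding bex_simps Bex_def bad by (metis (no_types, lifting) bad)
qed

section \<open>Undominated splits and the effect of merging on block counts\<close>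

definition heavy_blocks :: "nat \<Rightarrow> nat set set \<Rightarrow> nat set set" where
  "heavy_blocks m P = {p \<in> P. heavy m p}"

definition light_blocks :: "nat \<Rightarrow> nat set set \<Rightarrow> nat set set" where
  "light_blocks m P = {p \<in> P. \<not> heavy m p}"

lemma card_heavy_light:
  assumes "finite P"
  shows "card P = card (heavy_blocks m P) + card (light_blocks m P)"
proof -
  have "P = heavy_blocks m P \<union> light_blocks m P" "heavy_blocks m P \<inter> light_blocks m P = {}"
    by (auto simp: heavy_blocks_def light_blocks_def)
  then show ?thesis
    using assms card_Un_disjoint[of "heavy_blocks m P" "light_blocks m P"]
    by (metis finite_Un)
qed

lemma card_saturated_light:
  assumes P: "block_system m P" and S: "S \<subseteq> \<Union>P" "\<And>p. p \<in> P \<Longrightarrow> p \<subseteq> S \<or> p \<inter> S = {}"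
    and light: "\<And>p. p \<in> P \<Longrightarrow> p \<subseteq> S \<Longrightarrow> card p = 1"
  shows "card S = card {p \<in> P. p \<subseteq> S}"
proof -
  have "S = \<Union>{p \<in> P. p \<subseteq> S}"
    using S by fast
  moreover have "card (\<Union>{p \<in> P. p \<subseteq> S}) = sum card {p \<in> P. p \<subseteq> S}"
    using P by (intro card_Union_disjoint) (auto simp: block_system_def pairwise_def disjnt_def disjoint_def)
  moreover have "\<dots> = sum (\<lambda>_. 1) {p \<in> P. p \<subseteq> S}"
    using light by (intro sum.cong) auto
  ultimately show ?thesis by simp
qed

text \<open>The set \<open>b - x\<close> is always a proper nonempty union of blocks, so it fails to
  be a split only by being a single block or by not being heavy. In the second case removing one
  mark destroys heaviness, so \<open>b\<close> has exactly \<open>m\<close> elements.\<close>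

lemma bad_splits_cases:
  assumes P: "block_system m P" and x: "x \<in> P" "\<not> heavy m x \<or> light_blocks m P = {}"
    and b: "b \<in> block_splits m P" "x \<subseteq> b" "b - x \<notin> block_splits m P"
  shows "(\<exists>p\<in>heavy_blocks m P - {x}. b = x \<union> p) \<or>
         (\<not> heavy m x \<and> card b = m \<and> (\<forall>p\<in>P. p \<subseteq> b \<longrightarrow> \<not> heavy m p))"
proof (cases "heavy m (b - x)")
  case True
  have "p \<subseteq> b - x \<or> p \<inter> (b - x) = {}" if "p \<in> P" for p
  proof -
    have "p \<subseteq> b \<or> p \<inter> b = {}" using b(1) that by (simp add: block_splits_def)
    moreover have "p = x \<or> p \<inter> x = {}" using block_system_disjointD[OF P that x(1)] by blast
    ultimately show ?thesis by blast
  qed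
  moreover have "b - x \<subset> \<Union>P" using b(1) by (auto simp: block_splits_def)
  moreover have "b - x \<noteq> {}" using b x by (auto simp: block_splits_def)
  ultimately have "b - x \<in> P"
    using b(3) True by (auto simp: block_splits_def)
  then have "b - x \<in> heavy_blocks m P - {x}"
    using True \<open>b - x \<noteq> {}\<close> by (auto simp: heavy_blocks_def)
  moreover have "b = x \<union> (b - x)" using b(2) by blast
  ultimately show ?thesis by blast
next
  case False
  have finb: "finite b" using finite_block_splits[OF P] b(1) by blast
  have hb: "heavy m b" using b(1) by (simp add: block_splits_def)
  have nh: "\<not> heavy m p" if "p \<in> P" "p \<subseteq> b" "p \<noteq> x" for p
  proof
    assume "heavy m p"
    moreover have "p \<subseteq> b - x" using block_system_disjointD[OF P that(1) x(1)] that by blast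
    ultimately show False using heavy_mono[of m p "b - x"] finb False by simp
  qed
  \<comment> \<open>A further block inside \<open>b\<close> is light by \<open>nh\<close>; hence
    light blocks exist, and the assumption on \<open>x\<close> makes \<open>x\<close> light as
    well.\<close>
  have "\<exists>p\<in>P. p \<subseteq> b \<and> p \<noteq> x"
  proof -
    have "b \<noteq> x" "b \<subseteq> \<Union>P" using b(1) x(1) by (auto simp: block_splits_def)
    then obtain i where "i \<in> b" "i \<notin> x" using b(2) by blast
    then obtain p where "p \<in> P" "i \<in> p" using \<open>b \<subseteq> \<Union>P\<close> by blast
    then show ?thesis using b(1) \<open>i \<in> b\<close> \<open>i \<notin> x\<close> by (auto simp: block_splits_def)
  qed
  then have xl: "\<not> heavy m x"
    using x(2) nh by (auto simp: light_blocks_def)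
  then have "card x = 1" "1 \<notin> x"
    using P x(1) by (auto simp: block_system_def heavy_def)
  have "card (b - x) < m" "1 \<notin> b - x" using False by (auto simp: heavy_def)
  moreover have "card (b - x) = card b - 1"
    using \<open>card x = 1\<close> b(2) finb by (simp add: card_Diff_subset finite_subset)
  moreover have "m \<le> card b" using hb \<open>1 \<notin> b - x\<close> \<open>1 \<notin> x\<close> by (auto simp: heavy_def)
  moreover have "card b > 0" using b(1) finb by (auto simp: block_splits_def card_gt_0_iff)
  ultimately have "card b = m" by linarith
  then show ?thesis using nh xl by blast
qed

text \<open>A union of two blocks contains no other union of blocks than the two themselves and the
  empty set. A proper subset of \<open>m\<close> light marks has fewer than \<open>m\<close>
  elements and misses mark 1, so it is not heavy.\<close>

lemma bad_splits_minimal: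
  assumes P: "block_system m P" and x: "x \<in> P" "\<not> heavy m x \<or> light_blocks m P = {}"
    and b: "b \<in> block_splits m P" "x \<subseteq> b" "b - x \<notin> block_splits m P"
    and S: "S \<in> block_splits m P"
  shows "\<not> S \<subset> b"
proof
  assume Sb: "S \<subset> b"
  consider p where "p \<in> P" "b = x \<union> p" | "card b = m" "\<forall>p\<in>P. p \<subseteq> b \<longrightarrow> \<not> heavy m p"
    using bad_splits_cases[OF P x b] by (auto simp: heavy_blocks_def)
  then show False
  proof cases
    case 1
    have "x \<subseteq> S \<or> x \<inter> S = {}" "p \<subseteq> S \<or> p \<inter> S = {}"
      using S x(1) 1(1) by (auto simp: block_splits_def)
    then have "S = x \<or> S = p \<or> S = {} \<or> S = b"
      using Sb 1(2) by blast
    then show False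
      using S Sb x(1) 1(1) by (auto simp: block_splits_def)
  next
    case 2
    have finb: "finite b" using finite_block_splits[OF P] b(1) by blast
    have "card S < m" using psubset_card_mono[OF finb Sb] 2(1) by simp
    moreover have "1 \<notin> b"
    proof
      assume "1 \<in> b"
      moreover have "b \<subseteq> \<Union>P" using b(1) by (auto simp: block_splits_def)
      ultimately obtain p where p: "p \<in> P" "1 \<in> p" by blast
      moreover have "p \<subseteq> b \<or> p \<inter> b = {}" using b(1) p(1) by (simp add: block_splits_def)
      ultimately have "p \<subseteq> b" using \<open>1 \<in> b\<close> by blast
      with p show False using 2(2) by (auto simp: heavy_def)
    qed
    ultimately have "\<not> heavy m S" using Sb by (auto simp: heavy_def)
    then show False using S by (auto simp: block_splits_def)
  qed
qed

text \<open>Writing the count with \<open>- {x}\<close> covers both cases at once: absorbing a light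
  \<open>x\<close> keeps the number of heavy blocks, absorbing a heavy \<open>x\<close> lowers it by
  one.\<close>

lemma merge_heavy_block:
  assumes P: "block_system m P" and x: "x \<in> P" and p: "p \<in> heavy_blocks m P" "p \<noteq> x"
  defines "P' \<equiv> merge_blocks P (x \<union> p)"
  shows "card (heavy_blocks m P') = card (heavy_blocks m P - {x})"
    and "light_blocks m P' = light_blocks m P - {x}"
proof -
  have pP: "p \<in> P" "heavy m p" using p by (auto simp: heavy_blocks_def)
  have ne: "q \<noteq> {}" "finite q" if "q \<in> P" for q using P that by (auto simp: block_system_def)
  have P': "P' = insert (x \<union> p) (P - {x, p})"
    using block_system_disjointD[OF P] x pP(1) ne unfolding P'_def merge_blocks_def by blast
  have hb: "heavy m (x \<union> p)"
    using heavy_mono[OF pP(2)] ne x pP(1) by auto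
  have new: "x \<union> p \<notin> P"
    using block_system_disjointD[OF P _ x, of "x \<union> p"] block_system_disjointD[OF P _ pP(1), of "x \<union> p"]
      ne(1)[OF x] ne(1)[OF pP(1)] p(2) by blast
  have "heavy_blocks m P' = insert (x \<union> p) (heavy_blocks m P - {x} - {p})"
    using hb unfolding P' heavy_blocks_def by blast
  moreover have "finite (heavy_blocks m P)" using P by (auto simp: block_system_def heavy_blocks_def)
  moreover have "x \<union> p \<notin> heavy_blocks m P" using new by (simp add: heavy_blocks_def)
  moreover have "p \<in> heavy_blocks m P - {x}" using p by simp
  ultimately show "card (heavy_blocks m P') = card (heavy_blocks m P - {x})"
    using card.remove[of "heavy_blocks m P - {x}" p] by simp
  show "light_blocks m P' = light_blocks m P - {x}"
    using hb pP(2) unfolding P' light_blocks_def by auto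
qed

lemma merge_light_blocks:
  assumes P: "block_system m P" and b: "b \<in> block_splits m P"
    and light: "card b = m" "\<forall>p\<in>P. p \<subseteq> b \<longrightarrow> \<not> heavy m p"
  defines "P' \<equiv> merge_blocks P b"
  shows "card (heavy_blocks m P') = card (heavy_blocks m P) + 1"
    and "card (light_blocks m P') + m = card (light_blocks m P)"
proof -
  have ne: "q \<noteq> {}" if "q \<in> P" for q using P that by (auto simp: block_system_def)
  have sat: "q \<subseteq> b \<or> q \<inter> b = {}" if "q \<in> P" for q using b that by (auto simp: block_splits_def)
  have bP: "b \<notin> P" "heavy m b" "b \<subseteq> \<Union>P" using b by (auto simp: block_splits_def)
  have fin: "finite P" using P by (simp add: block_system_def)
  let ?L = "{p \<in> P. p \<subseteq> b}"
  have disj: "q \<inter> b = {} \<longleftrightarrow> \<not> q \<subseteq> b" if "q \<in> P" for q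
    using ne[OF that] sat[OF that] by blast
  have "heavy_blocks m P' = insert b (heavy_blocks m P)"
    using bP light(2) disj unfolding P'_def merge_blocks_def heavy_blocks_def by blast
  moreover have "b \<notin> heavy_blocks m P" "finite (heavy_blocks m P)"
    using bP fin by (auto simp: heavy_blocks_def)
  ultimately show "card (heavy_blocks m P') = card (heavy_blocks m P) + 1"
    by simp
  have "light_blocks m P' = light_blocks m P - ?L"
    using bP disj unfolding P'_def merge_blocks_def light_blocks_def by blast
  moreover have "?L \<subseteq> light_blocks m P"
    using light(2) by (auto simp: light_blocks_def)
  moreover have "card ?L = m"
  proof -
    have "card b = card ?L"
      using light(2) P sat by (intro card_saturated_light[OF P bP(3)]) (auto simp: block_system_def)
    then show ?thesis using light(1) by simp
  qed
  moreover have "finite (light_blocks m P)" using fin by (auto simp: light_blocks_def)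
  ultimately show "card (light_blocks m P') + m = card (light_blocks m P)"
    using card_mono[of "light_blocks m P" ?L] by (simp add: card_Diff_subset finite_subset)
qed

text \<open>A third block keeps the union proper, and taking \<open>x\<close> away again leaves the
  block \<open>p\<close>, which is excluded from the splits.\<close>

lemma heavy_pair_bad:
  assumes P: "block_system m P" and x: "x \<in> P" and p: "p \<in> heavy_blocks m P" "p \<noteq> x" and "card P \<ge> 3"
  shows "x \<union> p \<in> block_splits m P" "x \<subseteq> x \<union> p" "x \<union> p - x \<notin> block_splits m P"
proof -
  have pP: "p \<in> P" "heavy m p" using p by (auto simp: heavy_blocks_def)
  have ne: "q \<noteq> {}" "finite q" if "q \<in> P" for q using P that by (auto simp: block_system_def)
  have px: "p \<inter> x = {}"
    using block_system_disjointD[OF P pP(1) x] p(2) by blast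
  have "x \<union> p - x = p" using px by blast
  then show "x \<union> p - x \<notin> block_splits m P" using pP(1) by (simp add: block_splits_def)
  have "\<not> P \<subseteq> {x, p}"
    using card_mono[of "{x, p}" P] card_insert_le_m1[of 2 "{p}" x] \<open>card P \<ge> 3\<close> by auto
  then obtain q where q: "q \<in> P" "q \<noteq> x" "q \<noteq> p" by blast
  then have "q \<inter> (x \<union> p) = {}"
    using block_system_disjointD[OF P q(1) x] block_system_disjointD[OF P q(1) pP(1)] by blast
  then have "x \<union> p \<subset> \<Union>P" using q(1) ne[OF q(1)] x pP(1) by blast
  moreover have "r \<subseteq> x \<union> p \<or> r \<inter> (x \<union> p) = {}" if "r \<in> P" for r
    using block_system_disjointD[OF P that x] block_system_disjointD[OF P that pP(1)] by blast
  moreover have "x \<union> p \<notin> P"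
    using block_system_disjointD[OF P _ x, of "x \<union> p"] block_system_disjointD[OF P _ pP(1), of "x \<union> p"]
      ne(1)[OF x] ne(1)[OF pP(1)] p(2) by blast
  moreover have "heavy m (x \<union> p)"
    using heavy_mono[OF pP(2)] ne x pP(1) by auto
  ultimately show "x \<union> p \<in> block_splits m P"
    using ne[OF x] by (auto simp: block_splits_def)
qed simp

text \<open>Join \<open>x\<close> with any \<open>m - 1\<close> further light blocks. The union is
  proper because some heavy block lies outside it, and it is no block because a block that is part
  of it has one element while \<open>m \<ge> 2\<close>.\<close>

lemma light_union_bad:
  assumes P: "block_system m P" and m: "m \<ge> 2" and x: "x \<in> light_blocks m P"
    and h: "heavy_blocks m P \<noteq> {}" and k: "m \<le> card (light_blocks m P)"
  obtains b where "b \<in> block_splits m P" "x \<subseteq> b" "b - x \<notin> block_splits m P"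
    "card b = m" "\<forall>p\<in>P. p \<subseteq> b \<longrightarrow> \<not> heavy m p"
proof -
  have fin: "finite (light_blocks m P)" using P by (auto simp: block_system_def light_blocks_def)
  have "m - 1 \<le> card (light_blocks m P - {x})"
    using k x fin by simp
  then obtain L where L: "L \<subseteq> light_blocks m P - {x}" "card L = m - 1" "finite L"
    by (meson obtain_subset_with_card_n)
  define b where "b = \<Union>(insert x L)"
  have LP: "insert x L \<subseteq> P" using L x by (auto simp: light_blocks_def)
  have light: "p \<in> P" "\<not> heavy m p" "card p = 1" "finite p" "p \<noteq> {}" if "p \<in> insert x L" for p
  proof -
    have "p \<in> light_blocks m P" using that L x by blast
    then have "p \<in> P" "\<not> heavy m p" by (auto simp: light_blocks_def)
    then show "p \<in> P" "\<not> heavy m p" "card p = 1" "finite p" "p \<noteq> {}"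
      using P by (auto simp: block_system_def)
  qed
  have sub: "p \<in> insert x L \<longleftrightarrow> p \<subseteq> b" if "p \<in> P" for p
  proof
    assume "p \<subseteq> b"
    moreover have "p \<noteq> {}" using P that by (auto simp: block_system_def)
    ultimately obtain q where "q \<in> insert x L" "p \<inter> q \<noteq> {}" unfolding b_def by blast
    then show "p \<in> insert x L" using block_system_disjointD[OF P that light(1)] by metis
  qed (auto simp: b_def)
  have sat: "p \<subseteq> b \<or> p \<inter> b = {}" if "p \<in> P" for p
  proof (rule disjCI)
    assume "p \<inter> b \<noteq> {}"
    then obtain q where "q \<in> insert x L" "p \<inter> q \<noteq> {}" unfolding b_def by blast
    then show "p \<subseteq> b" using block_system_disjointD[OF P that light(1)] sub[OF that] by metis
  qed
  have bP: "b \<subseteq> \<Union>P" using LP by (auto simp: b_def)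
  have sb: "{p \<in> P. p \<subseteq> b} = insert x L" using sub LP by blast
  have "card b = card {p \<in> P. p \<subseteq> b}"
  proof (rule card_saturated_light[OF P bP sat])
    show "card p = 1" if "p \<in> P" "p \<subseteq> b" for p
      using light(3)[of p] sub[OF that(1)] that(2) by simp
  qed
  moreover have "x \<notin> L" using L(1) by blast
  ultimately have cb: "card b = m" using L(2,3) m unfolding sb by simp
  have "1 \<notin> b" using light(2) unfolding b_def heavy_def by blast
  have finb: "finite b" using L(3) light(4) unfolding b_def by (intro finite_Union) auto
  have "\<not> heavy m (b - x)"
  proof -
    have "x \<subseteq> b" by (auto simp: b_def)
    moreover have "x \<noteq> {}" using light(5) by blast
    ultimately have "b - x \<subset> b" by blast
    then have "card (b - x) < card b" by (rule psubset_card_mono[OF finb])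
    then show ?thesis using cb \<open>1 \<notin> b\<close> by (auto simp: heavy_def)
  qed
  moreover have "b \<noteq> \<Union>P"
  proof
    assume "b = \<Union>P"
    moreover obtain p where "p \<in> P" "heavy m p" using h by (auto simp: heavy_blocks_def)
    ultimately show False using sub[of p] light(2)[of p] by blast
  qed
  moreover have "b \<notin> P"
  proof
    assume "b \<in> P"
    then have "card b = 1" using sub[of b] light(3)[of b] by blast
    then show False using cb m by simp
  qed
  moreover have "b \<noteq> {}" using cb m by auto
  moreover have "heavy m b" using cb by (simp add: heavy_def)
  ultimately have "b \<in> block_splits m P" "b - x \<notin> block_splits m P"
    using sat bP unfolding block_splits_def by blast+
  moreover have "\<not> heavy m p" if "p \<in> P" "p \<subseteq> b" for p
    using light(2)[of p] sub[OF that(1)] that(2) by simp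
  moreover have "x \<subseteq> b" by (auto simp: b_def)
  ultimately show thesis
    using that[of b] cb by blast
qed

text \<open>Supplies the cone apex of the recursion: the heavy block \<open>p\<close> makes the
  complement of \<open>x\<close> heavy, and a third block prevents it from being a single
  block.\<close>

lemma complement_in_block_splits:
  assumes P: "block_system m P" and "card P \<ge> 3" and x: "x \<in> P"
    and p: "p \<in> heavy_blocks m P" "p \<noteq> x"
  shows "\<Union>P - x \<in> block_splits m P"
proof -
  have pP: "p \<in> P" "heavy m p" using p by (auto simp: heavy_blocks_def)
  have ne: "q \<noteq> {}" "finite q" if "q \<in> P" for q using P that by (auto simp: block_system_def)
  have disj: "q \<inter> x = {}" if "q \<in> P" "q \<noteq> x" for q
    using block_system_disjointD[OF P that(1) x] that(2) by blast
  have sub: "q \<subseteq> \<Union>P - x" if "q \<in> P" "q \<noteq> x" for q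
    using disj[OF that] that(1) by blast
  have "finite (\<Union>P)" using P by (auto simp: block_system_def)
  then have "heavy m (\<Union>P - x)"
    using heavy_mono[OF pP(2) sub[OF pP(1) p(2)]] by simp
  moreover have "\<Union>P - x \<noteq> {}" using sub[OF pP(1) p(2)] ne(1)[OF pP(1)] by blast
  moreover have "\<Union>P - x \<subset> \<Union>P" using ne(1)[OF x] x by blast
  moreover have "q \<subseteq> \<Union>P - x \<or> q \<inter> (\<Union>P - x) = {}" if "q \<in> P" for q
    using sub[OF that] by blast
  moreover have "\<Union>P - x \<notin> P"
  proof
    assume new: "\<Union>P - x \<in> P"
    have "\<not> P \<subseteq> {x, \<Union>P - x}"
      using card_mono[of "{x, \<Union>P - x}" P] card_insert_le_m1[of 2 "{\<Union>P - x}" x] \<open>card P \<ge> 3\<close> by auto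
    then obtain q where q: "q \<in> P" "q \<noteq> x" "q \<noteq> \<Union>P - x" by blast
    then show False
      using block_system_disjointD[OF P q(1) new] sub[OF q(1,2)] ne(1)[OF q(1)] by blast
  qed
  ultimately show ?thesis
    by (simp add: block_splits_def)
qed

section \<open>The degrees of nonvanishing homology of a block system\<close>

lemma degree_recursion:
  fixes h k m :: nat and d :: int
  assumes "k \<ge> 1" "m \<ge> 2"
  shows "(\<exists>t::nat. t * m \<le> k \<and> d = int h + int k - 3 - int t * (int m - 2)) \<longleftrightarrow>
    (\<exists>t::nat. t * m \<le> k - 1 \<and> d - 1 = int h + int (k - 1) - 3 - int t * (int m - 2)) \<or>
    (m \<le> k \<and> (\<exists>t::nat. t * m \<le> k - m \<and> d - 1 = int (h + 1) + int (k - m) - 3 - int t * (int m - 2)))"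
    (is "?L \<longleftrightarrow> ?R1 \<or> ?R2")
proof
  assume ?L
  then obtain t where t: "t * m \<le> k" "d = int h + int k - 3 - int t * (int m - 2)" by blast
  \<comment> \<open>For \<open>t = 0\<close> a light block is absorbed by a heavy one; a positive
    \<open>t\<close> is charged to a merge of \<open>m\<close> light blocks, after which
    \<open>t - 1\<close> such merges remain.\<close>
  show "?R1 \<or> ?R2"
  proof (cases t)
    case 0
    then have ?R1 using t assms by (intro exI[of _ 0]) auto
    then show ?thesis ..
  next
    case (Suc s)
    then have "s * m \<le> k - m" "m \<le> k" using t(1) by auto
    moreover have "d - 1 = int (h + 1) + int (k - m) - 3 - int s * (int m - 2)"
      using t(2) Suc \<open>m \<le> k\<close> by (simp add: of_nat_diff algebra_simps)
    ultimately have ?R2 by blast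
    then show ?thesis ..
  qed
next
  assume "?R1 \<or> ?R2"
  then show ?L
  proof
    assume ?R1
    then obtain t where "t * m \<le> k - 1" "d - 1 = int h + int (k - 1) - 3 - int t * (int m - 2)" by blast
    then show ?L using assms by (intro exI[of _ t]) (auto simp: of_nat_diff)
  next
    assume ?R2
    then obtain t where "m \<le> k" "t * m \<le> k - m"
      "d - 1 = int (h + 1) + int (k - m) - 3 - int t * (int m - 2)" by blast
    then show ?L by (intro exI[of _ "Suc t"]) (auto simp: of_nat_diff algebra_simps)
  qed
qed

text \<open>Strong induction on the number of blocks. Every merge joins at least two blocks and
  produces a heavy one, so the number drops and the presence of a heavy block is preserved.\<close>

theorem flag_nonzero_block_splits:
  assumes m: "m \<ge> 2" and "block_system m P" "card P \<ge> 2" "heavy_blocks m P \<noteq> {}"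
  shows "flag_nonzero d laminar_pair (block_splits m P) \<longleftrightarrow>
    (\<exists>t::nat. t * m \<le> card (light_blocks m P) \<and>
       d = int (card (heavy_blocks m P)) + int (card (light_blocks m P)) - 3 - int t * (int m - 2))"
  using assms(2-)
proof (induction "card P" arbitrary: P d rule: less_induct)
  case less
  note P = less.prems(1)
  let ?H = "heavy_blocks m P" and ?L = "light_blocks m P" and ?V = "block_splits m P"
  let ?nz = "\<lambda>d b. flag_nonzero d laminar_pair (block_splits m (merge_blocks P b))"
  have fin: "finite P" "finite ?H" "finite ?L"
    using P by (auto simp: block_system_def heavy_blocks_def light_blocks_def)
  have HL: "card P = card ?H + card ?L" by (rule card_heavy_light[OF fin(1)])
  have H1: "card ?H \<ge> 1" using less.prems(3) fin(2) by (simp add: Suc_le_eq card_gt_0_iff)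
  show ?case
  proof (cases "card P = 2")
    case True
    \<comment> \<open>One of the two blocks is heavy, so at most one is light, and
      \<open>m \<ge> 2\<close> leaves only \<open>t = 0\<close>, that is, degree -1.\<close>
    then have "t * m \<le> card ?L \<longleftrightarrow> t = 0" for t
      using H1 HL m by (cases t) auto
    moreover have "int (card ?H) + int (card ?L) = 2"
      using True HL by simp
    ultimately show ?thesis
      using True by (simp add: block_splits_pair[OF P] flag_nonzero_empty)
  next
    case False
    then have P3: "card P \<ge> 3" using less.prems(2) by simp
    have IH: "?nz d b \<longleftrightarrow> (\<exists>t::nat. t * m \<le> card (light_blocks m (merge_blocks P b)) \<and>
       d = int (card (heavy_blocks m (merge_blocks P b))) + int (card (light_blocks m (merge_blocks P b)))
           - 3 - int t * (int m - 2))"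
      if b: "b \<in> ?V" "card (heavy_blocks m (merge_blocks P b)) \<ge> 1"
        "card (heavy_blocks m (merge_blocks P b)) + card (light_blocks m (merge_blocks P b)) \<ge> 2"
        "card (heavy_blocks m (merge_blocks P b)) + card (light_blocks m (merge_blocks P b)) < card P"
      for b d
    proof -
      have bs: "block_system m (merge_blocks P b)" by (rule block_system_merge[OF P b(1)])
      then have "finite (merge_blocks P b)" by (simp add: block_system_def)
      from card_heavy_light[OF this] show ?thesis
        using b by (intro less.hyps bs) (auto simp flip: card_heavy_light)
    qed
    show ?thesis
    proof (cases "?L = {}")
      \<comment> \<open>With heavy blocks only, every undominated split is a pair and all pairs lead
        to the same degree, so a single degree survives.\<close>
      case True
      then have H3: "card ?H \<ge> 3" using P3 HL by simp
      then obtain x where x: "x \<in> ?H" using less.prems(3) by blast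
      have xP: "x \<in> P" using x by (simp add: heavy_blocks_def)
      have "card (?H - {x}) = card ?H - 1" using x fin by simp
      then have "?H - {x} \<noteq> {}" using H3 by (metis card.empty diff_is_0_eq not_numeral_le_zero numeral_le_one_iff order_trans semiring_norm(70))
      then obtain p where p: "p \<in> ?H" "p \<noteq> x" by blast
      have cases: "(b \<in> ?V \<and> x \<subseteq> b \<and> b - x \<notin> ?V) \<longleftrightarrow> (\<exists>p\<in>?H - {x}. b = x \<union> p)" for b
      proof
        assume "b \<in> ?V \<and> x \<subseteq> b \<and> b - x \<notin> ?V"
        then show "\<exists>p\<in>?H - {x}. b = x \<union> p"
          using bad_splits_cases[OF P xP, of b] True x by (auto simp: heavy_blocks_def)
      next
        assume "\<exists>p\<in>?H - {x}. b = x \<union> p"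
        then show "b \<in> ?V \<and> x \<subseteq> b \<and> b - x \<notin> ?V"
          using heavy_pair_bad[OF P xP _ _ P3] by blast
      qed
      have "flag_nonzero d laminar_pair ?V \<longleftrightarrow> (\<exists>b. b \<in> ?V \<and> x \<subseteq> b \<and> b - x \<notin> ?V \<and> ?nz (d - 1) b)"
        by (rule flag_nonzero_block_recursion[OF P xP complement_in_block_splits[OF P P3 xP p]])
           (rule bad_splits_minimal[OF P xP], use True in auto)
      also have "\<dots> \<longleftrightarrow> (\<exists>b. (b \<in> ?V \<and> x \<subseteq> b \<and> b - x \<notin> ?V) \<and> ?nz (d - 1) b)"
        by (simp only: conj_assoc)
      also have "\<dots> \<longleftrightarrow> (\<exists>q\<in>?H - {x}. ?nz (d - 1) (x \<union> q))"
        unfolding cases by (simp only: Bex_def) metis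
      also have "\<dots> \<longleftrightarrow> d - 1 = int (card ?H) - 1 - 3"
      proof -
        have "?nz (d - 1) (x \<union> q) \<longleftrightarrow> d - 1 = int (card ?H) - 1 - 3" if q: "q \<in> ?H - {x}" for q
        proof -
          have "q \<in> ?H" "q \<noteq> x" using q by auto
          note mh = merge_heavy_block[OF P xP this] heavy_pair_bad(1)[OF P xP this P3]
          have "card (?H - {x}) = card ?H - 1" using x fin by simp
          then show ?thesis
            using IH[OF mh(3)] mh(1,2) H3 True HL m by (simp add: of_nat_diff)
        qed
        then show ?thesis using p by blast
      qed
      finally have nz: "flag_nonzero d laminar_pair ?V \<longleftrightarrow> d = int (card ?H) - 3"
        by linarith
      have "t * m \<le> card ?L \<longleftrightarrow> t = 0" for t
        using True m by simp
      then show ?thesis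
        unfolding nz using True by simp
    next
      case False
      then obtain x where x: "x \<in> ?L" by blast
      have xP: "x \<in> P" "\<not> heavy m x" using x by (auto simp: light_blocks_def)
      have xH: "?H - {x} = ?H" using xP by (auto simp: heavy_blocks_def)
      obtain p where p: "p \<in> ?H" "p \<noteq> x" using less.prems(3) xH by blast
      have L1: "card ?L \<ge> 1" using x fin by (simp add: Suc_le_eq card_gt_0_iff) blast
      let ?light = "\<lambda>b. b \<in> ?V \<and> x \<subseteq> b \<and> b - x \<notin> ?V \<and> card b = m \<and> (\<forall>p\<in>P. p \<subseteq> b \<longrightarrow> \<not> heavy m p)"
      have cases: "(b \<in> ?V \<and> x \<subseteq> b \<and> b - x \<notin> ?V) \<longleftrightarrow> (\<exists>p\<in>?H. b = x \<union> p) \<or> ?light b" for b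
      proof
        assume bad: "b \<in> ?V \<and> x \<subseteq> b \<and> b - x \<notin> ?V"
        then have b: "b \<in> ?V" "x \<subseteq> b" "b - x \<notin> ?V" by simp_all
        show "(\<exists>p\<in>?H. b = x \<union> p) \<or> ?light b"
          using bad_splits_cases[OF P xP(1) disjI1[OF xP(2)] b] bad unfolding xH by (elim disjE) simp_all
      next
        have "x \<union> p \<in> ?V \<and> x \<subseteq> x \<union> p \<and> x \<union> p - x \<notin> ?V" if "p \<in> ?H" for p
        proof -
          have "p \<noteq> x" using that xH by blast
          from heavy_pair_bad[OF P xP(1) that this P3] show ?thesis by simp
        qed
        moreover assume "(\<exists>p\<in>?H. b = x \<union> p) \<or> ?light b"
        ultimately show "b \<in> ?V \<and> x \<subseteq> b \<and> b - x \<notin> ?V"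
          by (elim disjE bexE) simp_all
      qed
      have 1: "?nz (d - 1) (x \<union> q) \<longleftrightarrow>
          (\<exists>t::nat. t * m \<le> card ?L - 1 \<and> d - 1 = int (card ?H) + int (card ?L - 1) - 3 - int t * (int m - 2))"
        if q: "q \<in> ?H" for q
      proof -
        have qx: "q \<noteq> x" using q xH by blast
        note mh = merge_heavy_block[OF P xP(1) q qx] heavy_pair_bad(1)[OF P xP(1) q qx P3]
        have "card (?L - {x}) = card ?L - 1" using x fin by simp
        then show ?thesis
          using IH[OF mh(3), of "d - 1"] mh(1,2) xH H1 L1 HL P3 by simp
      qed
      have 2: "?nz (d - 1) b \<longleftrightarrow>
          (\<exists>t::nat. t * m \<le> card ?L - m \<and> d - 1 = int (card ?H + 1) + int (card ?L - m) - 3 - int t * (int m - 2))"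
        and 3: "m \<le> card ?L" if b: "?light b" for b
      proof -
        have bV: "b \<in> ?V" "card b = m" "\<forall>p\<in>P. p \<subseteq> b \<longrightarrow> \<not> heavy m p" using b by auto
        note ml = merge_light_blocks[OF P bV]
        show "m \<le> card ?L" using ml(2) by simp
        have "card (light_blocks m (merge_blocks P b)) = card ?L - m" using ml(2) by simp
        then show "?nz (d - 1) b \<longleftrightarrow>
          (\<exists>t::nat. t * m \<le> card ?L - m \<and> d - 1 = int (card ?H + 1) + int (card ?L - m) - 3 - int t * (int m - 2))"
          using IH[OF bV(1), of "d - 1"] ml H1 HL m by simp
      qed
      have split: "(\<exists>b. ((\<exists>q\<in>?H. b = x \<union> q) \<or> A b) \<and> B b) \<longleftrightarrow>
          (\<exists>q\<in>?H. B (x \<union> q)) \<or> (\<exists>b. A b \<and> B b)" for A B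
        by blast
      \<comment> \<open>Together with \<open>3\<close>: a merge of light blocks exists exactly when
        there are at least \<open>m\<close> of them.\<close>
      have 4: "\<exists>b. ?light b" if "m \<le> card ?L"
        using light_union_bad[OF P m x less.prems(3) that] by metis
      have "flag_nonzero d laminar_pair ?V \<longleftrightarrow> (\<exists>b. b \<in> ?V \<and> x \<subseteq> b \<and> b - x \<notin> ?V \<and> ?nz (d - 1) b)"
        by (rule flag_nonzero_block_recursion[OF P xP(1) complement_in_block_splits[OF P P3 xP(1) p]])
           (rule bad_splits_minimal[OF P xP(1)], use xP in auto)
      also have "\<dots> \<longleftrightarrow> (\<exists>b. (b \<in> ?V \<and> x \<subseteq> b \<and> b - x \<notin> ?V) \<and> ?nz (d - 1) b)"
        by (simp only: conj_assoc)
      also have "\<dots> \<longleftrightarrow> (\<exists>q\<in>?H. ?nz (d - 1) (x \<union> q)) \<or> (\<exists>b. ?light b \<and> ?nz (d - 1) b)"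
        unfolding cases by (rule split)
      also have "(\<exists>q\<in>?H. ?nz (d - 1) (x \<union> q)) \<longleftrightarrow>
          (\<exists>t::nat. t * m \<le> card ?L - 1 \<and> d - 1 = int (card ?H) + int (card ?L - 1) - 3 - int t * (int m - 2))"
        using 1 p(1) by blast
      also have "(\<exists>b. ?light b \<and> ?nz (d - 1) b) \<longleftrightarrow> m \<le> card ?L \<and>
          (\<exists>t::nat. t * m \<le> card ?L - m \<and> d - 1 = int (card ?H + 1) + int (card ?L - m) - 3 - int t * (int m - 2))"
        using 2 3 4 by blast
      finally show ?thesis
        using degree_recursion[OF L1 m, of d "card ?H"] by simp
    qed
  qed
qed

section \<open>Edges of a finite tree\<close>

text \<open>The connectivity used in \<open>finite_tree\<close>, named so that it can be applied to
  a reduced edge set.\<close>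

definition joined :: "'a set set \<Rightarrow> 'a \<Rightarrow> 'a \<Rightarrow> bool" where
  "joined E u v \<longleftrightarrow> (u, v) \<in> {(a, b). {a, b} \<in> E}\<^sup>*"

lemma joined_refl [simp]: "joined E u u"
  by (simp add: joined_def)

lemma joined_trans: "joined E u v \<Longrightarrow> joined E v w \<Longrightarrow> joined E u w"
  unfolding joined_def by (rule rtrancl_trans)

lemma joined_edge: "{u, v} \<in> E \<Longrightarrow> joined E u v"
  by (auto simp: joined_def)

lemma joined_induct [consumes 1, case_names refl step]:
  assumes "joined E u v" "P u"
    and "\<And>y z. joined E u y \<Longrightarrow> {y, z} \<in> E \<Longrightarrow> P y \<Longrightarrow> P z"
  shows "P v"
  using assms(1) unfolding joined_def
  by (induction rule: rtrancl_induct) (use assms(2,3) in \<open>auto simp: joined_def\<close>)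

lemma joined_sym: "joined E u v \<Longrightarrow> joined E v u"
proof (induction rule: joined_induct)
  case (step y z)
  then have "joined E z y" by (intro joined_edge) (simp add: insert_commute)
  then show ?case using step.IH by (rule joined_trans)
qed simp

lemma joined_mono: "joined E u v \<Longrightarrow> E \<subseteq> E' \<Longrightarrow> joined E' u v"
  by (induction rule: joined_induct) (simp, meson joined_edge joined_trans subsetD)

text \<open>When the walk returns to a vertex already on the path, the path is cut back to that
  vertex.\<close>

lemma joined_distinct_path:
  assumes "joined E u v"
  shows "\<exists>p. p \<noteq> [] \<and> hd p = u \<and> last p = v \<and> distinct p \<and> successively (\<lambda>x y. {x, y} \<in> E) p"
  using assms
proof (induction rule: joined_induct)
  case refl
  then show ?case by (intro exI[of _ "[u]"]) simp
next
  case (step y z)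
  then obtain p where p: "p \<noteq> []" "hd p = u" "last p = y" "distinct p"
      "successively (\<lambda>x y. {x, y} \<in> E) p" by blast
  show ?case
  proof (cases "z \<in> set p")
    case True
    then obtain xs ys where ps: "p = (xs @ [z]) @ ys" by (metis append.assoc append_Cons append_Nil split_list)
    have "successively (\<lambda>x y. {x, y} \<in> E) (xs @ [z])" "distinct (xs @ [z])"
      using p(4,5) unfolding ps by (simp_all add: successively_append_iff)
    moreover have "hd (xs @ [z]) = u" using p(2) unfolding ps by (cases xs) simp_all
    ultimately show ?thesis
      by (intro exI[of _ "xs @ [z]"]) simp
  next
    case False
    then show ?thesis
      using p step.hyps(2) by (intro exI[of _ "p @ [z]"]) (simp add: successively_append_iff)
  qed
qed

lemma joined_cong: "joined E a b \<Longrightarrow> joined E a c \<longleftrightarrow> joined E b c"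
  by (meson joined_sym joined_trans)

lemma finite_tree_edgeE:
  assumes "finite_tree V E" "e \<in> E"
  obtains a b where "e = {a, b}" "a \<in> V" "b \<in> V" "a \<noteq> b"
proof -
  have "E \<subseteq> {{u, v} |u v. u \<in> V \<and> v \<in> V \<and> u \<noteq> v}"
    using assms(1) by (simp add: finite_tree_def)
  from subsetD[OF this assms(2)] show thesis
    by (auto intro: that)
qed

text \<open>A simple path between the ends that avoids the edge closes up to a cycle. It has at
  least three vertices, since the ends differ and a path with two vertices would be the removed
  edge.\<close>

lemma finite_tree_bridge:
  assumes T: "finite_tree V E" and e: "{a, b} \<in> E"
  shows "\<not> joined (E - {{a, b}}) a b"
proof
  assume "joined (E - {{a, b}}) a b"
  from joined_distinct_path[OF this] obtain p where p: "p \<noteq> []" "hd p = a" "last p = b" "distinct p"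
      "successively (\<lambda>x y. {x, y} \<in> E - {{a, b}}) p"
    by (elim exE conjE)
  have "a \<noteq> b"
    using finite_tree_edgeE[OF T e] by (metis doubleton_eq_iff)
  have nth: "{p ! i, p ! Suc i} \<in> E - {{a, b}}" if "Suc i < length p" for i
    using p(5) that by (simp add: successively_conv_nth)
  have first: "p ! 0 = a" and last: "p ! (length p - 1) = b"
    using p(1-3) by (simp_all add: hd_conv_nth last_conv_nth)
  have "length p \<noteq> 1" "length p \<noteq> 2"
    using first last \<open>a \<noteq> b\<close> nth[of 0] by auto
  moreover have "length p \<noteq> 0" using p(1) by simp
  ultimately have "length p \<ge> 3" by linarith
  moreover have "{p ! i, p ! (Suc i mod length p)} \<in> E" if "i < length p" for i
  proof (cases "Suc i = length p")
    case True
    then have "{p ! i, p ! (Suc i mod length p)} = {b, a}"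
      using first last by (metis diff_Suc_1 mod_self)
    then show ?thesis using e by (simp add: insert_commute)
  next
    case False
    then show ?thesis using nth[of i] that by simp
  qed
  ultimately have "has_cycle E"
    using p(4) unfolding has_cycle_def by (intro exI[of _ p]) simp
  then show False using T by (simp add: finite_tree_def)
qed

text \<open>A walk that cannot avoid the edge must cross it, so its ends attach to opposite ends of
  the edge. This holds in every graph.\<close>

lemma joined_through_removed_edge:
  assumes "joined E u v" "\<not> joined (E - {{a, b}}) u v"
  shows "joined (E - {{a, b}}) u a \<and> joined (E - {{a, b}}) b v \<or>
         joined (E - {{a, b}}) u b \<and> joined (E - {{a, b}}) a v"
  using assms
proof (induction rule: joined_induct)
  case refl
  then show ?case by simp
next
  case (step y z)
  let ?E = "E - {{a, b}}"
  show ?case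
  proof (cases "{y, z} = {a, b}")
    case True
    then consider "y = a" "z = b" | "y = b" "z = a" by (auto simp: doubleton_eq_iff)
    then show ?thesis
      using step.IH step.prems by cases auto
  next
    case False
    then have yz: "joined ?E y z" using step.hyps(2) by (intro joined_edge) auto
    then have "\<not> joined ?E u y" using step.prems joined_trans by metis
    then show ?thesis using step.IH joined_trans[OF _ yz] by blast
  qed
qed

section \<open>The two sides of an edge in a rooted tree\<close>

locale rooted_tree =
  fixes V :: "'a set" and E :: "'a set set" and r :: 'a
  assumes tree: "finite_tree V E" and root: "r \<in> V"
begin

lemma finite_V: "finite V" and finite_E: "finite E"
proof -
  show V: "finite V" using tree by (simp add: finite_tree_def)
  have "E \<subseteq> Pow V" by (auto elim!: finite_tree_edgeE[OF tree])
  then show "finite E" using V by (simp add: finite_subset)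
qed

lemmas edgeE = finite_tree_edgeE[OF tree]

lemma all_joined: "u \<in> V \<Longrightarrow> v \<in> V \<Longrightarrow> joined E u v"
  using tree by (simp add: finite_tree_def joined_def)

lemma bridge: "{a, b} \<in> E \<Longrightarrow> \<not> joined (E - {{a, b}}) a b"
  by (rule finite_tree_bridge[OF tree])

text \<open>Special to forests: avoiding each edge separately allows avoiding all at once. If
  \<open>e\<close> separated \<open>u\<close> from \<open>v\<close> in what remains, the two would
  attach to opposite ends of \<open>e\<close>, and the connection avoiding \<open>e\<close> would
  contradict that \<open>e\<close> is a bridge.\<close>

lemma joined_avoiding:
  assumes "finite X" "joined E u v" "\<And>e. e \<in> X \<Longrightarrow> joined (E - {e}) u v"
  shows "joined (E - X) u v"
  using assms(1,3)
proof (induction X rule: finite_induct)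
  case empty
  then show ?case using assms(2) by simp
next
  case (insert e X)
  then have IH: "joined (E - X) u v" by blast
  show ?case
  proof (cases "e \<in> E")
    case False
    then show ?thesis using IH by (metis Diff_insert0 Diff_insert Diff_insert2)
  next
    case True
    then obtain a b where e: "e = {a, b}" by (rule edgeE)
    have sub: "E - X - {{a, b}} \<subseteq> E - {{a, b}}" by blast
    show ?thesis
    proof (rule ccontr)
      assume "\<not> joined (E - insert e X) u v"
      then have "\<not> joined (E - X - {{a, b}}) u v"
        unfolding e by (metis Diff_insert)
      from joined_through_removed_edge[OF IH this]
      have "joined (E - {{a, b}}) u a \<and> joined (E - {{a, b}}) b v \<or>
         joined (E - {{a, b}}) u b \<and> joined (E - {{a, b}}) a v"
        using joined_mono[OF _ sub] by blast
      moreover have "joined (E - {{a, b}}) u v" using insert.prems e by blast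
      ultimately have "joined (E - {{a, b}}) a b"
        by (meson joined_sym joined_trans)
      then show False using bridge True e by blast
    qed
  qed
qed

definition below :: "'a set \<Rightarrow> 'a set" where
  "below e = {v \<in> V. \<not> joined (E - {e}) v r}"

lemma root_not_below: "r \<notin> below e"
  by (simp add: below_def)

lemma below_subset: "below e \<subseteq> V"
  by (auto simp: below_def)

lemma below_edge_iff:
  assumes "{a, b} \<in> E" "{a, b} \<noteq> e"
  shows "a \<in> below e \<longleftrightarrow> b \<in> below e"
proof -
  have "joined (E - {e}) a b" using assms by (intro joined_edge) auto
  moreover have "a \<in> V" "b \<in> V"
    using assms(1) by (auto elim!: edgeE simp: doubleton_eq_iff)
  ultimately show ?thesis
    using joined_cong[of "E - {e}" a b r] by (simp add: below_def)
qed

lemma below_ends: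
  assumes "{a, b} \<in> E"
  shows "a \<in> below {a, b} \<longleftrightarrow> b \<notin> below {a, b}"
proof -
  let ?E = "E - {{a, b}}"
  have V: "a \<in> V" "b \<in> V"
    using assms(1) by (auto elim!: edgeE simp: doubleton_eq_iff)
  have "joined ?E a r \<or> joined ?E b r"
    using joined_through_removed_edge[OF all_joined[OF V(1) root], of a b] by blast
  moreover have "\<not> (joined ?E a r \<and> joined ?E b r)"
    using bridge[OF assms] joined_sym joined_trans by metis
  ultimately show ?thesis
    unfolding below_def using V by blast
qed

lemma joined_below:
  assumes "e \<in> E" "u \<in> below e" "v \<in> below e"
  shows "joined (E - {e}) u v"
proof -
  obtain a b where e: "e = {a, b}" using assms(1) by (rule edgeE)
  let ?E = "E - {{a, b}}"
  have *: "joined ?E w a \<and> joined ?E b r \<or> joined ?E w b \<and> joined ?E a r" if "w \<in> below e" for w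
    using that joined_through_removed_edge[OF all_joined[OF _ root], of w a b]
    unfolding below_def e by blast
  have "\<not> joined ?E a b" using bridge assms(1) e by blast
  then show ?thesis
    using *[OF assms(2)] *[OF assms(3)] unfolding e
    by (meson joined_sym joined_trans)
qed

text \<open>A walk avoiding \<open>e\<close> never changes its side of \<open>e\<close>, whereas
  \<open>f\<close> lies entirely on the other side.\<close>

lemma joined_same_side:
  assumes e: "e \<in> E" and f: "f \<in> E" "f \<noteq> e" and uv: "joined (E - {e}) u v" "u \<in> V"
    and f_side: "\<And>w. w \<in> f \<Longrightarrow> w \<in> below e \<longleftrightarrow> u \<notin> below e"
  shows "joined (E - {f}) u v \<and> (v \<in> below e \<longleftrightarrow> u \<in> below e)"
  using uv(1)
proof (induction rule: joined_induct)
  case refl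
  then show ?case by simp
next
  case (step y z)
  then have yz: "{y, z} \<in> E" "{y, z} \<noteq> e" by auto
  then have "y \<in> below e \<longleftrightarrow> z \<in> below e" by (rule below_edge_iff)
  moreover have "{y, z} \<noteq> f" using f_side[of y] step.IH by blast
  then have "joined (E - {f}) y z" using yz(1) by (intro joined_edge) auto
  ultimately show ?case using step.IH joined_trans by metis
qed

text \<open>If \<open>f\<close> lies below \<open>e\<close>, everything not below \<open>e\<close>
  reaches the root without \<open>f\<close>. Otherwise the part below \<open>e\<close> is connected
  without \<open>f\<close> and therefore stays on one side of \<open>f\<close>.\<close>

lemma below_laminar_strong:
  assumes e: "e \<in> E" and f: "f \<in> E" "f \<noteq> e"
  shows "if f \<subseteq> below e then below f \<subseteq> below e
         else f \<inter> below e = {} \<and> (below e \<subseteq> below f \<or> below e \<inter> below f = {})"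
proof -
  obtain a b where ab: "f = {a, b}" using f(1) by (rule edgeE)
  have "a \<in> below e \<longleftrightarrow> b \<in> below e" using below_edge_iff f ab by metis
  then consider "f \<subseteq> below e" | "f \<inter> below e = {}" "\<not> f \<subseteq> below e" using ab by auto
  then show ?thesis
  proof cases
    case 1
    have "w \<notin> below f" if "w \<notin> below e" for w
    proof (cases "w \<in> V")
      case True
      then have "joined (E - {e}) w r" using that by (simp add: below_def)
      then have "joined (E - {f}) w r"
        using joined_same_side[OF e f _ True] 1 that by blast
      then show ?thesis by (simp add: below_def)
    qed (simp add: below_def)
    then show ?thesis using 1 by auto
  next
    case 2
    have "v \<in> below f" if "u \<in> below e" "v \<in> below e" "u \<in> below f" for u v
    proof -
      have "u \<in> V" "v \<in> V" using that below_subset by blast+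
      have "joined (E - {f}) u v"
        using joined_same_side[OF e f joined_below[OF e that(1,2)] \<open>u \<in> V\<close>] 2 that by blast
      then show ?thesis
        using that(3) \<open>v \<in> V\<close> joined_cong[of "E - {f}" u v r] by (simp add: below_def)
    qed
    then show ?thesis using 2 by auto
  qed
qed

lemma below_laminar:
  assumes "e \<in> E" "f \<in> E"
  shows "below f \<subseteq> below e \<or> below e \<subseteq> below f \<or> below e \<inter> below f = {}"
  using below_laminar_strong[OF assms] by (cases "f = e") (auto split: if_splits)

definition child :: "'a set \<Rightarrow> 'a" where
  "child e = (THE c. c \<in> e \<and> c \<in> below e)"

lemma edge_child_parent:
  assumes "e \<in> E"
  obtains p where "e = {child e, p}" "child e \<in> below e" "p \<in> V" "p \<notin> below e"
proof -
  obtain a b where e: "e = {a, b}" "a \<in> V" "b \<in> V" using assms by (metis edgeE)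
  then have ab: "a \<in> below e \<longleftrightarrow> b \<notin> below e" using below_ends assms by metis
  show thesis
  proof (cases "a \<in> below e")
    case True
    then have "child e = a" unfolding child_def using ab e(1) by (intro the_equality) auto
    then show thesis using that[of b] True ab e by auto
  next
    case False
    then have "child e = b" unfolding child_def using ab e(1) by (intro the_equality) auto
    moreover have "e = {b, a}" using e(1) by (simp add: insert_commute)
    ultimately show thesis using that[of a] False ab e(1,2) by metis
  qed
qed

text \<open>For two edges with a common child, the parent end of each would lie below the other edge
  but not below its own, and the two lower parts would overlap without being nested.\<close>

lemma child_inj: "inj_on child E"
proof (rule inj_onI)
  fix e f assume e: "e \<in> E" and f: "f \<in> E" and eq: "child e = child f"
  obtain p where p: "e = {child e, p}" "child e \<in> below e" "p \<notin> below e" using e by (rule edge_child_parent)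
  obtain q where q: "f = {child e, q}" "child e \<in> below f" "q \<notin> below f" using f eq by (metis edge_child_parent)
  show "e = f"
  proof (rule ccontr)
    assume "e \<noteq> f"
    then have "q \<in> below e" using below_edge_iff[of "child e" q e] q(1) f p(2) by auto
    moreover have "p \<in> below f" using below_edge_iff[of "child e" p f] p(1) e q(2) \<open>e \<noteq> f\<close> by auto
    ultimately show False using below_laminar[OF e f] p q by blast
  qed
qed

text \<open>The map \<open>child\<close> injects the inner edges into \<open>X - {t}\<close>, where
  \<open>t\<close> is a topmost vertex of the region.\<close>

lemma card_inner_edges:
  assumes X: "X \<subseteq> V" and t: "t \<in> X" and top: "\<And>e. e \<in> E \<Longrightarrow> e \<subseteq> X \<Longrightarrow> child e \<noteq> t"
  shows "card {e \<in> E. e \<subseteq> X} < card X"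
proof -
  have fin: "finite X" using X finite_V finite_subset by blast
  have "child ` {e \<in> E. e \<subseteq> X} \<subseteq> X - {t}"
  proof
    fix c assume "c \<in> child ` {e \<in> E. e \<subseteq> X}"
    then obtain e where e: "c = child e" "e \<in> E" "e \<subseteq> X" by blast
    then have "child e \<in> e" by (metis edge_child_parent insertI1)
    then show "c \<in> X - {t}" using e top by auto
  qed
  then have "card {e \<in> E. e \<subseteq> X} \<le> card (X - {t})"
    using fin by (intro card_inj_on_le[where f = child] inj_on_subset[OF child_inj]) auto
  also have "\<dots> < card X" using t fin by (rule card_Diff1_less[rotated])
  finally show ?thesis .
qed

text \<open>Handshake count: an inner edge contributes two, and an edge leaving the region
  contributes one and belongs to \<open>C\<close>.\<close>

lemma sum_degrees_le:
  assumes X: "X \<subseteq> V" and c: "finite C" "\<And>e. e \<in> E \<Longrightarrow> e \<inter> X \<noteq> {} \<Longrightarrow> \<not> e \<subseteq> X \<Longrightarrow> e \<in> C"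
  shows "(\<Sum>v\<in>X. card {e \<in> E. v \<in> e}) \<le> 2 * card {e \<in> E. e \<subseteq> X} + card C"
proof -
  have fin: "finite X" using X finite_V finite_subset by blast
  have "(\<Sum>v\<in>X. card {e \<in> E. v \<in> e}) = (\<Sum>v\<in>X. \<Sum>e\<in>E. if v \<in> e then 1 else 0)"
    using finite_E by (intro sum.cong) (simp_all add: sum.If_cases Int_def)
  also have "\<dots> = (\<Sum>e\<in>E. \<Sum>v\<in>X. if v \<in> e then 1 else 0)"
    by (rule sum.swap)
  also have "\<dots> = (\<Sum>e\<in>E. card (X \<inter> e))"
    using fin by (intro sum.cong) (simp_all add: sum.If_cases)
  also have "\<dots> \<le> (\<Sum>e\<in>E. (if e \<subseteq> X then 2 else 0) + (if e \<in> C then 1 else 0))"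
  proof (rule sum_mono)
    fix e assume e: "e \<in> E"
    then obtain a b where ab: "e = {a, b}" "a \<noteq> b" by (metis edgeE)
    show "card (X \<inter> e) \<le> (if e \<subseteq> X then 2 else 0) + (if e \<in> C then 1 else 0)"
    proof (cases "e \<subseteq> X")
      case True
      then have "X \<inter> e = e" by blast
      then show ?thesis using True ab by simp
    next
      case False
      then have "X \<inter> e \<subset> e" by blast
      then have "card (X \<inter> e) < 2" using psubset_card_mono[of e "X \<inter> e"] ab by simp
      moreover have "X \<inter> e = {} \<or> e \<in> C" using c(2)[OF e] False by blast
      ultimately show ?thesis using False by auto
    qed
  qed
  also have "\<dots> = 2 * card {e \<in> E. e \<subseteq> X} + card (E \<inter> C)"
    using finite_E by (simp add: sum.distrib sum.If_cases Int_def)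
  also have "\<dots> \<le> 2 * card {e \<in> E. e \<subseteq> X} + card C"
    using c(1) by (simp add: card_mono)
  finally show ?thesis .
qed

end

section \<open>Splits of stable trees\<close>

definition tree_below :: "marked_tree \<Rightarrow> nat set \<Rightarrow> nat set" where
  "tree_below T e = rooted_tree.below (tverts T) (tedges T) (tmark T 2) e"

definition split_of :: "nat \<Rightarrow> marked_tree \<Rightarrow> nat set \<Rightarrow> nat set" where
  "split_of n T e = {i \<in> {1..n}. tmark T i \<in> tree_below T e}"

text \<open>The block system before any merge. Mark 2 is left out because it marks the root.\<close>

definition singleton_blocks :: "nat \<Rightarrow> nat set set" where
  "singleton_blocks n = (\<lambda>i. {i}) ` ({1..n} - {2})"

lemma stable_treeD:
  assumes "stable_tree n w T"
  shows "finite_tree (tverts T) (tedges T)" and "i \<in> {1..n} \<Longrightarrow> tmark T i \<in> tverts T"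
    and "v \<in> tverts T \<Longrightarrow>
      real (card {e \<in> tedges T. v \<in> e}) + (\<Sum>i | i \<in> {1..n} \<and> tmark T i = v. w i) > 2"
  using assms by (auto simp: stable_tree_def)

lemma stable_rooted_tree:
  assumes "stable_tree n w T" "n \<ge> 2"
  shows "rooted_tree (tverts T) (tedges T) (tmark T 2)"
  using stable_treeD(1)[OF assms(1)] stable_treeD(2)[OF assms(1), of 2] assms(2)
  by unfold_locales auto

lemma below_eq:
  assumes "rooted_tree V E r"
  shows "rooted_tree.below V E r e = {v \<in> V. \<not> joined (E - {e}) v r}"
  by (rule rooted_tree.below_def[OF assms])

text \<open>Sum the stability condition over the region: 2|X| is less than the sum of degrees plus
  the weight, and the degrees add up to at most 2(|X| - 1) + |C|.\<close>

lemma stable_region_weight: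
  assumes T: "stable_tree n w T" "n \<ge> 2"
    and X: "X \<subseteq> tverts T" "t \<in> X"
    and top: "\<And>e. e \<in> tedges T \<Longrightarrow> e \<subseteq> X \<Longrightarrow>
      rooted_tree.child (tverts T) (tedges T) (tmark T 2) e \<noteq> t"
    and C: "finite C" "\<And>e. e \<in> tedges T \<Longrightarrow> e \<inter> X \<noteq> {} \<Longrightarrow> \<not> e \<subseteq> X \<Longrightarrow> e \<in> C"
  shows "(\<Sum>i | i \<in> {1..n} \<and> tmark T i \<in> X. w i) > 2 - real (card C)"
proof -
  interpret rooted_tree "tverts T" "tedges T" "tmark T 2"
    by (rule stable_rooted_tree[OF T])
  have fin: "finite X" using X(1) finite_V finite_subset by blast
  let ?deg = "\<lambda>v. card {e \<in> tedges T. v \<in> e}" and ?wt = "\<lambda>v. \<Sum>i | i \<in> {1..n} \<and> tmark T i = v. w i"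
  have "(\<Sum>v\<in>X. 2) < (\<Sum>v\<in>X. real (?deg v) + ?wt v)"
    using fin X stable_treeD(3)[OF T(1)] by (intro sum_strict_mono) auto
  also have "\<dots> = real (\<Sum>v\<in>X. ?deg v) + (\<Sum>v\<in>X. ?wt v)"
    by (simp add: sum.distrib)
  also have "(\<Sum>v\<in>X. ?wt v) = (\<Sum>i | i \<in> {1..n} \<and> tmark T i \<in> X. w i)"
  proof -
    have "(\<Sum>v\<in>X. ?wt v) = (\<Sum>v\<in>X. \<Sum>i | i \<in> {i \<in> {1..n}. tmark T i \<in> X} \<and> tmark T i = v. w i)"
      by (intro sum.cong) auto
    also have "\<dots> = (\<Sum>i\<in>{i \<in> {1..n}. tmark T i \<in> X}. w i)"
      using fin by (intro sum.group) auto
    finally show ?thesis by simp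
  qed
  finally have "2 * real (card X) < real (\<Sum>v\<in>X. ?deg v) + (\<Sum>i | i \<in> {1..n} \<and> tmark T i \<in> X. w i)"
    by simp
  moreover have "(\<Sum>v\<in>X. ?deg v) \<le> 2 * card {e \<in> tedges T. e \<subseteq> X} + card C"
    by (rule sum_degrees_le[OF X(1) C])
  moreover have "card {e \<in> tedges T. e \<subseteq> X} < card X"
    by (rule card_inner_edges[OF X top])
  ultimately show ?thesis by linarith
qed

section \<open>The splits of a stable tree are admissible and determine its edges\<close>

locale tree_weights =
  fixes n l :: nat and w :: "nat \<Rightarrow> real"
  assumes n: "n \<ge> 3" and l: "l \<ge> 1" and w: "w 1 = 1" "w 2 = 1" "\<And>i. i \<in> {3..n} \<Longrightarrow> w i = 1 / real l"
begin

lemma weight_pos: "i \<in> {1..n} \<Longrightarrow> w i > 0"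
proof -
  assume "i \<in> {1..n}"
  then consider "i = 1" | "i = 2" | "i \<in> {3..n}" by fastforce
  then show "w i > 0" using w l by cases auto
qed

context
  fixes T assumes T: "stable_tree n w T"
begin

interpretation rooted_tree "tverts T" "tedges T" "tmark T 2"
  using stable_rooted_tree[OF T] n by simp

text \<open>The region below \<open>e\<close> is left only through \<open>e\<close>, so its weight
  exceeds 2 - 1.\<close>

lemma marks_in_below:
  assumes e: "e \<in> tedges T"
  shows "(\<Sum>i | i \<in> {1..n} \<and> tmark T i \<in> below e. w i) > 1"
proof -
  obtain p where p: "e = {child e, p}" "child e \<in> below e" "p \<notin> below e" using e by (rule edge_child_parent)
  have "(\<Sum>i | i \<in> {1..n} \<and> tmark T i \<in> below e. w i) > 2 - real (card {e})"
  proof (rule stable_region_weight[OF T _ below_subset p(2)])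
    fix f assume f: "f \<in> tedges T"
    show "child f \<noteq> child e" if "f \<subseteq> below e"
      using inj_onD[OF child_inj _ f e] p that by auto
    obtain a b where ab: "f = {a, b}" using f by (rule edgeE)
    show "f \<in> {e}" if "f \<inter> below e \<noteq> {}" "\<not> f \<subseteq> below e"
      using below_edge_iff[of a b e] f that ab by auto
  qed (use n in auto)
  then show ?thesis by simp
qed

lemma marks_outside_below:
  assumes e: "e \<in> tedges T"
  shows "(\<Sum>i | i \<in> {1..n} \<and> tmark T i \<in> tverts T - below e. w i) > 1"
proof -
  have "(\<Sum>i | i \<in> {1..n} \<and> tmark T i \<in> tverts T - below e. w i) > 2 - real (card {e})"
  proof (rule stable_region_weight[OF T, where t = "tmark T 2"])
    show "tmark T 2 \<in> tverts T - below e" using root root_not_below by blast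
    fix f assume f: "f \<in> tedges T"
    show "child f \<noteq> tmark T 2"
      using edge_child_parent[OF f] root_not_below by metis
    obtain a b where ab: "f = {a, b}" "a \<in> tverts T" "b \<in> tverts T" using f by (rule edgeE)
    show "f \<in> {e}" if "f \<inter> (tverts T - below e) \<noteq> {}" "\<not> f \<subseteq> tverts T - below e"
      using below_edge_iff[of a b e] f that ab by auto
  qed (use n in auto)
  then show ?thesis by simp
qed

text \<open>The region between two nested edges is left only through these two, so its weight
  exceeds 2 - 2 and it carries a mark. This is why distinct edges have distinct splits.\<close>

lemma marks_between_below:
  assumes e: "e \<in> tedges T" and f: "f \<in> tedges T" "f \<noteq> e" and sub: "below f \<subseteq> below e"
  shows "\<exists>i\<in>{1..n}. tmark T i \<in> below e - below f"
proof -
  obtain p where p: "e = {child e, p}" "child e \<in> below e" "p \<notin> below e" using e by (rule edge_child_parent)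
  have top: "child e \<in> below e - below f"
    using below_edge_iff[of "child e" p f] p e f(2) sub by auto
  have "(\<Sum>i | i \<in> {1..n} \<and> tmark T i \<in> below e - below f. w i) > 2 - real (card {e, f})"
  proof (rule stable_region_weight[OF T _ _ top])
    show "below e - below f \<subseteq> tverts T" using below_subset by blast
    fix g assume g: "g \<in> tedges T"
    show "child g \<noteq> child e" if "g \<subseteq> below e - below f"
      using inj_onD[OF child_inj _ g e] p that by auto
    obtain a b where ab: "g = {a, b}" using g by (rule edgeE)
    show "g \<in> {e, f}" if "g \<inter> (below e - below f) \<noteq> {}" "\<not> g \<subseteq> below e - below f"
      using below_edge_iff[of a b e] below_edge_iff[of a b f] g that ab by auto
  qed (use n in auto)
  then have "(\<Sum>i | i \<in> {1..n} \<and> tmark T i \<in> below e - below f. w i) > 0"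
    using f(2) by simp
  then have "{i. i \<in> {1..n} \<and> tmark T i \<in> below e - below f} \<noteq> {}"
    by (metis (no_types, lifting) less_irrefl sum.empty)
  then show ?thesis by blast
qed

lemma split_of_eq: "split_of n T e = {i \<in> {1..n}. tmark T i \<in> below e}"
  by (simp add: split_of_def tree_below_def)

text \<open>Weight greater than 1 below the edge forces mark 1 with company or more than
  \<open>l\<close> light marks. Weight greater than 1 outside forces a mark other than 2 there, so
  the split is proper.\<close>

lemma split_of_in_block_splits:
  assumes e: "e \<in> tedges T"
  shows "split_of n T e \<in> block_splits (l + 1) (singleton_blocks n)"
proof -
  let ?S = "split_of n T e"
  have S2: "2 \<notin> ?S" using root_not_below by (simp add: split_of_eq)
  have S: "?S \<subseteq> {1..n} - {2}" using S2 by (auto simp: split_of_eq)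
  have fin: "finite ?S" by (simp add: split_of_eq)
  have sum1: "sum w ?S > 1"
    using marks_in_below[OF e] by (simp add: split_of_eq)
  have light: "w i = 1 / real l" if "i \<in> ?S" "i \<noteq> 1" for i
  proof -
    have "i \<in> {3..n}" using S that by fastforce
    then show ?thesis by (rule w)
  qed
  have heavy: "heavy (l + 1) ?S"
  proof (cases "1 \<in> ?S")
    case False
    then have "sum w ?S = real (card ?S) / real l"
      using light by (simp add: sum.cong[of ?S ?S w "\<lambda>_. 1 / real l"]) (metis (no_types, lifting) light sum.cong sum_constant times_divide_eq_right mult.right_neutral)
    then have "real (card ?S) > real l" using sum1 l by (simp add: less_divide_eq)
    then show ?thesis by (simp add: heavy_def)
  qed (simp add: heavy_def)
  have "?S \<noteq> {i}" if "i \<in> {1..n}" for i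
  proof
    assume "?S = {i}"
    then have "w i > 1" using sum1 by simp
    moreover have "w i \<le> 1"
      using light[of i] w(1) l \<open>?S = {i}\<close> by (cases "i = 1") auto
    ultimately show False by simp
  qed
  then have notP: "?S \<notin> singleton_blocks n" unfolding singleton_blocks_def by blast
  have "?S \<noteq> {1..n} - {2}"
  proof
    assume S: "?S = {1..n} - {2}"
    have "{i. i \<in> {1..n} \<and> tmark T i \<in> tverts T - below e} \<subseteq> {2}"
    proof
      fix i assume i: "i \<in> {i. i \<in> {1..n} \<and> tmark T i \<in> tverts T - below e}"
      then have "i \<notin> ?S" by (simp add: split_of_eq)
      then show "i \<in> {2}" using i S by blast
    qed
    then have "(\<Sum>i | i \<in> {1..n} \<and> tmark T i \<in> tverts T - below e. w i) \<le> sum w {2}"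
      using w(2) by (intro sum_mono2) auto
    then show False using marks_outside_below[OF e] w(2) by simp
  qed
  moreover have "\<Union>(singleton_blocks n) = {1..n} - {2}" by (auto simp: singleton_blocks_def)
  moreover have "?S \<noteq> {}" using sum1 by auto
  ultimately show ?thesis
    using S heavy notP by (auto simp: block_splits_def singleton_blocks_def)
qed

lemma split_of_subset_iff:
  assumes e: "e \<in> tedges T" and f: "f \<in> tedges T"
  shows "split_of n T f \<subseteq> split_of n T e \<longleftrightarrow> below f \<subseteq> below e"
proof
  assume sub: "split_of n T f \<subseteq> split_of n T e"
  have "split_of n T f \<noteq> {}"
    using split_of_in_block_splits[OF f] by (simp add: block_splits_def)
  then have "below e \<inter> below f \<noteq> {}" using sub by (auto simp: split_of_eq)
  then consider "below f \<subseteq> below e" | "below e \<subseteq> below f" "f \<noteq> e"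
    using below_laminar[OF e f] by blast
  then show "below f \<subseteq> below e"
  proof cases
    case 2
    then have "\<exists>i\<in>{1..n}. tmark T i \<in> below f - below e"
      using marks_between_below[OF f e] by metis
    then show ?thesis using sub by (auto simp: split_of_eq)
  qed
qed (auto simp: split_of_eq)

lemma split_of_inj: "inj_on (split_of n T) (tedges T)"
proof (rule inj_onI)
  fix e f assume e: "e \<in> tedges T" and f: "f \<in> tedges T" and eq: "split_of n T e = split_of n T f"
  then have "below e = below f" using split_of_subset_iff by blast
  then show "e = f" using marks_between_below[OF e f] by blast
qed

lemma split_of_laminar:
  assumes e: "e \<in> tedges T" and f: "f \<in> tedges T"
  shows "laminar_pair (split_of n T e) (split_of n T f)"
  using below_laminar[OF e f] by (auto simp: laminar_pair_def split_of_eq)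

end

end

section \<open>Splits are preserved under contraction\<close>

context
  fixes n f T T' and w :: "nat \<Rightarrow> real"
  assumes n: "n \<ge> 2" and T: "stable_tree n w T" and T': "stable_tree n w T'"
    and contr: "contraction n f T T'"
begin

interpretation src: rooted_tree "tverts T" "tedges T" "tmark T 2"
  by (rule stable_rooted_tree[OF T n])

interpretation tgt: rooted_tree "tverts T'" "tedges T'" "tmark T' 2"
  by (rule stable_rooted_tree[OF T' n])

lemma contraction_target_edges:
  "tedges T' = {{f u, f v} |u v. {u, v} \<in> tedges T \<and> f u \<noteq> f v}"
  using contr by (simp add: contraction_def)

lemma contraction_mark: "i \<in> {1..n} \<Longrightarrow> tmark T' i = f (tmark T i)"
  using contr by (simp add: contraction_def)

text \<open>Fibres are connected through collapsed edges, and an edge whose ends have different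
  images is not collapsed.\<close>

lemma contraction_fibre_joined:
  assumes "u \<in> tverts T" "v \<in> tverts T" "f u = f v" "\<And>x y. e = {x, y} \<Longrightarrow> f x \<noteq> f y"
  shows "joined (tedges T - {e}) u v"
proof -
  have "joined {g \<in> tedges T. \<forall>x\<in>g. \<forall>y\<in>g. f x = f y} u v"
  proof -
    have "{(a, b). {a, b} \<in> tedges T \<and> f a = f b}
        = {(a, b). {a, b} \<in> {g \<in> tedges T. \<forall>x\<in>g. \<forall>y\<in>g. f x = f y}}"
      by auto
    moreover have "(u, v) \<in> {(a, b). {a, b} \<in> tedges T \<and> f a = f b}\<^sup>*"
      using contr assms(1-3) by (simp add: contraction_def)
    ultimately show ?thesis by (simp add: joined_def)
  qed
  moreover have "\<not> (\<forall>x\<in>e. \<forall>y\<in>e. f x = f y)" if "e \<in> tedges T"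
    using src.edgeE[OF that] assms(4) by (metis insertCI)
  ultimately show ?thesis
    by (elim joined_mono) blast
qed

lemma contraction_edge_ends:
  assumes "e \<in> tedges T" "f ` e \<in> tedges T'" "e = {x, y}"
  shows "f x \<noteq> f y"
proof
  assume "f x = f y"
  then have "f ` e = {f x}" using assms(3) by simp
  moreover obtain a b where "f ` e = {a, b}" "a \<noteq> b" using assms(2) by (rule tgt.edgeE)
  ultimately show False by (metis doubleton_eq_iff insert_absorb2)
qed

text \<open>A second edge with the same image, completed inside the two fibres, would connect the
  ends of \<open>e\<close> without using \<open>e\<close>.\<close>

lemma contraction_edge_unique:
  assumes e: "e \<in> tedges T" "f ` e \<in> tedges T'" and g: "g \<in> tedges T" "f ` g = f ` e"
  shows "g = e"
proof (rule ccontr)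
  assume "g \<noteq> e"
  obtain a b where ab: "e = {a, b}" "a \<in> tverts T" "b \<in> tverts T" using e(1) by (rule src.edgeE)
  obtain c d where cd: "g = {c, d}" "c \<in> tverts T" "d \<in> tverts T" using g(1) by (rule src.edgeE)
  have fne: "\<And>x y. e = {x, y} \<Longrightarrow> f x \<noteq> f y"
    using contraction_edge_ends[OF e] by blast
  have step: "joined (tedges T - {e}) a b"
    if "f p = f a" "f q = f b" "{p, q} = g" "p \<in> tverts T" "q \<in> tverts T" for p q
  proof -
    have "joined (tedges T - {e}) a p" "joined (tedges T - {e}) q b"
      using contraction_fibre_joined[OF ab(2) that(4) _ fne] contraction_fibre_joined[OF that(5) ab(3) _ fne] that
      by auto
    moreover have "joined (tedges T - {e}) p q"
      using that(3) g(1) \<open>g \<noteq> e\<close> by (intro joined_edge) simp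
    ultimately show ?thesis by (meson joined_trans)
  qed
  have "{f c, f d} = {f a, f b}" using g(2) ab cd by simp
  then have "joined (tedges T - {e}) a b"
    using step[of c d] step[of d c] cd by (auto simp: doubleton_eq_iff insert_commute)
  then show False using src.bridge[of a b] e(1) ab by simp
qed

lemma contraction_edge_surj:
  assumes "e' \<in> tedges T'"
  obtains e where "e \<in> tedges T" "f ` e = e'"
proof -
  obtain u v where "e' = {f u, f v}" "{u, v} \<in> tedges T"
    using assms unfolding contraction_target_edges by blast
  then show thesis using that[of "{u, v}"] by simp
qed

lemma contraction_edge_bij:
  "bij_betw (\<lambda>e. f ` e) {e \<in> tedges T. f ` e \<in> tedges T'} (tedges T')"
  unfolding bij_betw_def
proof
  show "inj_on (\<lambda>e. f ` e) {e \<in> tedges T. f ` e \<in> tedges T'}"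
    by (rule inj_onI) (use contraction_edge_unique in auto)
  show "(\<lambda>e. f ` e) ` {e \<in> tedges T. f ` e \<in> tedges T'} = tedges T'"
  proof (intro subset_antisym subsetI)
    fix e' assume e': "e' \<in> tedges T'"
    then obtain e where "e \<in> tedges T" "f ` e = e'" by (rule contraction_edge_surj)
    then show "e' \<in> (\<lambda>e. f ` e) ` {e \<in> tedges T. f ` e \<in> tedges T'}"
      using e' by blast
  qed blast
qed

lemma contraction_joined_iff:
  assumes e: "e \<in> tedges T" "f ` e \<in> tedges T'" and uv: "u \<in> tverts T" "v \<in> tverts T"
  shows "joined (tedges T - {e}) u v \<longleftrightarrow> joined (tedges T' - {f ` e}) (f u) (f v)"
proof
  assume "joined (tedges T - {e}) u v"
  then show "joined (tedges T' - {f ` e}) (f u) (f v)"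
  proof (induction rule: joined_induct)
    case (step y z)
    have "joined (tedges T' - {f ` e}) (f y) (f z)"
    proof (cases "f y = f z")
      case False
      then have "{f y, f z} \<in> tedges T'"
        using step.hyps(2) unfolding contraction_target_edges by blast
      moreover have "{f y, f z} \<noteq> f ` e"
        using contraction_edge_unique[OF e, of "{y, z}"] step.hyps(2) by auto
      ultimately show ?thesis by (intro joined_edge) simp
    qed simp
    then show ?case by (rule joined_trans[OF step.IH])
  qed simp
next
  have fne: "\<And>x y. e = {x, y} \<Longrightarrow> f x \<noteq> f y"
    using contraction_edge_ends[OF e] by blast
  assume "joined (tedges T' - {f ` e}) (f u) (f v)"
  \<comment> \<open>The induction follows a walk in the contracted tree, so the claim has to cover
    all vertices lying over its current end.\<close>
  then have "\<forall>v\<in>tverts T. f v = f v' \<longrightarrow> joined (tedges T - {e}) u v" if "f v' = f v" for v'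
    unfolding that
  proof (induction rule: joined_induct)
    case refl
    then show ?case using contraction_fibre_joined[OF uv(1) _ _ fne] by simp
  next
    case (step y z)
    then obtain a b where ab: "{y, z} = {f a, f b}" "{a, b} \<in> tedges T" "{y, z} \<noteq> f ` e"
      unfolding contraction_target_edges by blast
    have abV: "a \<in> tverts T" "b \<in> tverts T"
      using src.edgeE[OF ab(2)] by (metis doubleton_eq_iff)+
    have "\<exists>p q. {p, q} \<in> tedges T \<and> {p, q} \<noteq> e \<and> f p = y \<and> f q = z \<and> p \<in> tverts T \<and> q \<in> tverts T"
    proof -
      have "{a, b} \<noteq> e" using ab by auto
      then show ?thesis
        using ab(1,2) abV by (metis doubleton_eq_iff)
    qed
    then obtain p q where pq: "{p, q} \<in> tedges T" "{p, q} \<noteq> e" "f p = y" "f q = z" "p \<in> tverts T" "q \<in> tverts T"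
      by blast
    have "joined (tedges T - {e}) u p" using step.IH pq by blast
    moreover have "joined (tedges T - {e}) p q" using pq by (intro joined_edge) simp
    ultimately have uq: "joined (tedges T - {e}) u q" by (rule joined_trans)
    show ?case
    proof (intro ballI impI)
      fix x assume "x \<in> tverts T" "f x = z"
      then have "joined (tedges T - {e}) q x"
        using contraction_fibre_joined[OF pq(6) _ _ fne] pq(4) by simp
      then show "joined (tedges T - {e}) u x" by (rule joined_trans[OF uq])
    qed
  qed
  then show "joined (tedges T - {e}) u v" using uv(2) by blast
qed

lemma contraction_split_of:
  assumes e: "e \<in> tedges T" "f ` e \<in> tedges T'"
  shows "split_of n T' (f ` e) = split_of n T e"
proof -
  have "tmark T' i \<in> tgt.below (f ` e) \<longleftrightarrow> tmark T i \<in> src.below e" if "i \<in> {1..n}" for i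
  proof -
    have "tmark T i \<in> tverts T" "tmark T 2 \<in> tverts T" "tmark T' i \<in> tverts T'"
      using stable_treeD(2)[OF T] stable_treeD(2)[OF T'] that n by auto
    then show ?thesis
      using contraction_joined_iff[OF e, of "tmark T i" "tmark T 2"] contraction_mark[OF that] contraction_mark[of 2] n
      unfolding tgt.below_def src.below_def by simp
  qed
  then show ?thesis by (auto simp: split_of_def tree_below_def)
qed

end

text \<open>On a stable tree the sum has at most one term. Written as a sum, it is a total function
  of the split, zero where no edge has that split, and visibly continuous in the lengths.\<close>

definition split_lengths :: "nat \<Rightarrow> marked_tree \<times> (nat set \<Rightarrow> real) \<Rightarrow> nat set \<Rightarrow> real" where
  "split_lengths n p = (\<lambda>S. \<Sum>e | e \<in> tedges (fst p) \<and> split_of n (fst p) e = S. snd p e)"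

text \<open>Collapsed edges have length zero, and the others keep both length and split.\<close>

lemma split_lengths_face_glue:
  assumes n: "n \<ge> 2" and "face_glue n w p q"
  shows "split_lengths n p = split_lengths n q"
proof -
  obtain f T T' len where T: "stable_tree n w T" and T': "stable_tree n w T'" and c: "contraction n f T T'"
    and p: "p = (T, extend_lengths f T T' len)" and q: "q = (T', len)"
    using assms(2) unfolding face_glue_def by blast
  have fin: "finite (tedges T)"
    by (rule rooted_tree.finite_E[OF stable_rooted_tree[OF T n]])
  show ?thesis
  proof
    fix S
    let ?D = "{e \<in> tedges T. f ` e \<in> tedges T'}"
    have "split_lengths n p S = (\<Sum>e | e \<in> tedges T \<and> split_of n T e = S. if f ` e \<in> tedges T' then len (f ` e) else 0)"
      by (simp add: split_lengths_def p extend_lengths_def)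
    also have "\<dots> = (\<Sum>e | e \<in> ?D \<and> split_of n T e = S. len (f ` e))"
      using fin by (intro sum.mono_neutral_cong_right) auto
    also have "\<dots> = (\<Sum>e | e \<in> ?D \<and> split_of n T' (f ` e) = S. len (f ` e))"
      using contraction_split_of[OF n T T' c] by (intro sum.cong) auto
    also have "\<dots> = (\<Sum>e' | e' \<in> tedges T' \<and> split_of n T' e' = S. len e')"
    proof (rule sum.reindex_bij_betw)
      show "bij_betw ((`) f) {e \<in> ?D. split_of n T' (f ` e) = S} {e' \<in> tedges T'. split_of n T' e' = S}"
      proof (rule bij_betw_imageI)
        have bij: "bij_betw ((`) f) ?D (tedges T')" by (rule contraction_edge_bij[OF n T T' c])
        show "inj_on ((`) f) {e \<in> ?D. split_of n T' (f ` e) = S}"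
          by (rule inj_on_subset[OF bij_betw_imp_inj_on[OF bij]]) blast
        have "h ` {e \<in> D. Q (h e)} = {e' \<in> h ` D. Q e'}" for h :: "nat set \<Rightarrow> nat set" and D Q
          by blast
        from this[of "(`) f" ?D] show "(`) f ` {e \<in> ?D. split_of n T' (f ` e) = S} = {e' \<in> tedges T'. split_of n T' e' = S}"
          unfolding bij_betw_imp_surj_on[OF bij] .
      qed
    qed
    finally show "split_lengths n p S = split_lengths n q S"
      by (simp add: split_lengths_def q)
  qed
qed

section \<open>The tree of a laminar family\<close>

text \<open>A finite chain attains its intersection; \<open>A\<close> stands in for the empty
  chain.\<close>

lemma chain_Inter_mem:
  assumes "finite G" "\<And>X Y. X \<in> G \<Longrightarrow> Y \<in> G \<Longrightarrow> X \<subseteq> Y \<or> Y \<subseteq> X" "\<And>X. X \<in> G \<Longrightarrow> X \<subseteq> A"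
  shows "A \<inter> \<Inter>G \<in> insert A G"
  using assms
proof (induction G rule: finite_induct)
  case (insert X G)
  then have IH: "A \<inter> \<Inter>G \<in> insert A G" by blast
  have "A \<inter> \<Inter>(insert X G) = X \<inter> (A \<inter> \<Inter>G)" by blast
  moreover have "X \<subseteq> A \<inter> \<Inter>G \<or> A \<inter> \<Inter>G \<subseteq> X"
    using IH insert.prems by blast
  ultimately show ?case
    using IH insert.prems(2)[of X] by (metis Int_absorb1 Int_absorb2 insertCI insertE)
qed simp

definition mark_set :: "nat \<Rightarrow> nat set" where
  "mark_set n = {1..n} - {2}"

text \<open>The intersection with \<^term>\<open>mark_set n\<close> gives the root when no member of the family qualifies.\<close>

definition parent_split :: "nat \<Rightarrow> nat set set \<Rightarrow> nat set \<Rightarrow> nat set" where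
  "parent_split n F S = mark_set n \<inter> \<Inter>{R \<in> F. S \<subset> R}"

definition smallest_split :: "nat \<Rightarrow> nat set set \<Rightarrow> nat \<Rightarrow> nat set" where
  "smallest_split n F i = mark_set n \<inter> \<Inter>{R \<in> F. i \<in> R}"

definition split_edge :: "nat \<Rightarrow> nat set set \<Rightarrow> nat set \<Rightarrow> nat set" where
  "split_edge n F S = {set_encode S, set_encode (parent_split n F S)}"

text \<open>The Hasse diagram of the family with the full set added as root. Vertices must be
  natural numbers, whence \<open>set_encode\<close>. Mark 2 lies in no member of a family over
  \<open>mark_set n\<close> and so ends up at the root.\<close>

definition split_tree :: "nat \<Rightarrow> nat set set \<Rightarrow> marked_tree" where
  "split_tree n F =
     \<lparr>tverts = set_encode ` insert (mark_set n) F, tedges = split_edge n F ` F,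
      tmark = (\<lambda>i. set_encode (smallest_split n F i))\<rparr>"

lemma split_tree_simps [simp]:
  "tverts (split_tree n F) = set_encode ` insert (mark_set n) F"
  "tedges (split_tree n F) = split_edge n F ` F"
  "tmark (split_tree n F) i = set_encode (smallest_split n F i)"
  by (simp_all add: split_tree_def)

lemma Union_singleton_blocks [simp]: "\<Union>(singleton_blocks n) = mark_set n"
  by (auto simp: singleton_blocks_def mark_set_def)

lemma block_splits_singletons_iff:
  "S \<in> block_splits m (singleton_blocks n) \<longleftrightarrow>
     S \<subset> mark_set n \<and> S \<noteq> {} \<and> (\<forall>i. S \<noteq> {i}) \<and> heavy m S"
  unfolding block_splits_def Union_singleton_blocks
  by (auto simp: singleton_blocks_def mark_set_def)

section \<open>The tree axioms and the splits of the tree of a laminar family\<close>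

locale split_family =
  fixes n m :: nat and F :: "nat set set"
  assumes splits: "F \<subseteq> block_splits m (singleton_blocks n)"
    and laminar: "\<And>R S. R \<in> F \<Longrightarrow> S \<in> F \<Longrightarrow> laminar_pair R S"
begin

abbreviation "A \<equiv> mark_set n"

lemma finite_A: "finite A" by (simp add: mark_set_def)

lemma split_memD:
  assumes "S \<in> F"
  shows "S \<subset> A" "S \<noteq> {}" "heavy m S" "S \<noteq> {i}"
  using assms splits block_splits_singletons_iff by blast+

lemma finite_F: "finite F"
  by (rule finite_subset[of _ "Pow A"]) (use split_memD(1) finite_A in auto)

lemma finite_vertex: "S \<in> insert A F \<Longrightarrow> finite S"
  using split_memD(1)[of S] finite_A finite_subset[of S A] by auto

lemma vertex_subset: "S \<in> insert A F \<Longrightarrow> S \<subseteq> A"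
  using split_memD(1)[of S] by auto

lemma encode_inj: "R \<in> insert A F \<Longrightarrow> S \<in> insert A F \<Longrightarrow> set_encode R = set_encode S \<longleftrightarrow> R = S"
  using set_encode_eq finite_vertex by blast

text \<open>Sets containing a common nonempty set are not disjoint, so by laminarity they form a
  chain and their intersection is one of them.\<close>

lemma parent_split_mem:
  assumes "S \<in> F"
  shows "parent_split n F S \<in> insert A F" "S \<subset> parent_split n F S"
    and "\<And>R. R \<in> insert A F \<Longrightarrow> S \<subset> R \<Longrightarrow> parent_split n F S \<subseteq> R"
proof -
  have "A \<inter> \<Inter>{R \<in> F. S \<subset> R} \<in> insert A {R \<in> F. S \<subset> R}"
  proof (rule chain_Inter_mem)
    show "X \<subseteq> Y \<or> Y \<subseteq> X" if "X \<in> {R \<in> F. S \<subset> R}" "Y \<in> {R \<in> F. S \<subset> R}" for X Y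
      using laminar[of X Y] that split_memD(2)[OF assms] unfolding laminar_pair_def by blast
    show "X \<subseteq> A" if "X \<in> {R \<in> F. S \<subset> R}" for X
      using split_memD(1) that by blast
  qed (use finite_F in simp)
  then show "parent_split n F S \<in> insert A F" "S \<subset> parent_split n F S"
    unfolding parent_split_def using split_memD(1)[OF assms] by auto
  show "parent_split n F S \<subseteq> R" if "R \<in> insert A F" "S \<subset> R" for R
    using that unfolding parent_split_def by blast
qed

lemma smallest_split_mem: "smallest_split n F i \<in> insert A F"
proof -
  have "A \<inter> \<Inter>{R \<in> F. i \<in> R} \<in> insert A {R \<in> F. i \<in> R}"
  proof (rule chain_Inter_mem)
    show "X \<subseteq> Y \<or> Y \<subseteq> X" if "X \<in> {R \<in> F. i \<in> R}" "Y \<in> {R \<in> F. i \<in> R}" for X Y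
      using laminar[of X Y] that unfolding laminar_pair_def by blast
    show "X \<subseteq> A" if "X \<in> {R \<in> F. i \<in> R}" for X
      using split_memD(1) that by blast
  qed (use finite_F in simp)
  then show ?thesis unfolding smallest_split_def by blast
qed

lemma smallest_split_subset_iff:
  assumes "R \<in> F"
  shows "smallest_split n F i \<subseteq> R \<longleftrightarrow> i \<in> R"
proof
  assume sub: "smallest_split n F i \<subseteq> R"
  show "i \<in> R"
  proof (cases "i \<in> A")
    case True
    then have "i \<in> smallest_split n F i" by (auto simp: smallest_split_def)
    then show ?thesis using sub by blast
  next
    case False
    then have "i \<notin> R" if "R \<in> F" for R using split_memD(1)[OF that] by blast
    then have "smallest_split n F i = A" unfolding smallest_split_def by blast
    then show ?thesis using sub split_memD(1)[OF assms] by blast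
  qed
qed (use assms in \<open>auto simp: smallest_split_def\<close>)

text \<open>Take a maximal member that contains \<open>R\<close> and lies properly inside
  \<open>X\<close>; maximality leaves only \<open>X\<close> as its parent.\<close>

lemma child_split_between:
  assumes R: "R \<in> F" and X: "X \<in> insert A F" "R \<subset> X"
  obtains S where "S \<in> F" "parent_split n F S = X" "R \<subseteq> S"
proof -
  let ?G = "{S \<in> F. R \<subseteq> S \<and> S \<subset> X}"
  have "finite ?G" "R \<in> ?G" using finite_F R X by auto
  from finite_has_maximal2[OF this]
  obtain S where S: "S \<in> ?G" "\<And>Q. Q \<in> ?G \<Longrightarrow> S \<subseteq> Q \<Longrightarrow> S = Q"
    by meson
  then have SF: "S \<in> F" by blast
  have "parent_split n F S \<subseteq> X"
    using parent_split_mem(3)[OF SF X(1)] S(1) by blast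
  moreover have "\<not> parent_split n F S \<subset> X"
  proof
    assume *: "parent_split n F S \<subset> X"
    then have "parent_split n F S \<in> F"
      using parent_split_mem(1)[OF SF] vertex_subset[OF X(1)] by auto
    then have "parent_split n F S \<in> ?G" using * S(1) parent_split_mem(2)[OF SF] by blast
    then show False using S(2) parent_split_mem(2)[OF SF] by blast
  qed
  ultimately show thesis using that[of S] S(1) by blast
qed

lemma split_edge_cases:
  assumes "{a, b} \<in> split_edge n F ` F"
  obtains S where "S \<in> F" "a = set_encode S" "b = set_encode (parent_split n F S)"
  | S where "S \<in> F" "b = set_encode S" "a = set_encode (parent_split n F S)"
  using assms by (auto simp: split_edge_def doubleton_eq_iff)

lemma inj_split_edge: "inj_on (split_edge n F) F"
proof (rule inj_onI)
  fix S S' assume S: "S \<in> F" "S' \<in> F" "split_edge n F S = split_edge n F S'"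
  note p = parent_split_mem(1,2)[OF S(1)] parent_split_mem(1,2)[OF S(2)]
  have "set_encode S = set_encode S' \<or>
      set_encode S = set_encode (parent_split n F S') \<and> set_encode (parent_split n F S) = set_encode S'"
    using S(3) by (auto simp: split_edge_def doubleton_eq_iff)
  then have "S = S' \<or> S = parent_split n F S' \<and> parent_split n F S = S'"
    using encode_inj p S(1,2) by simp
  then show "S = S'" using p(2,4) by blast
qed

text \<open>Climb from parent to parent. Only edges of sets containing \<open>S\<close> are used, so
  the climb survives the deletion of any other edge.\<close>

lemma joined_to_top:
  assumes E: "\<And>R. R \<in> F \<Longrightarrow> S \<subseteq> R \<Longrightarrow> split_edge n F R \<in> E" and "S \<in> insert A F"
  shows "joined E (set_encode S) (set_encode A)"
  using assms
proof (induction "card A - card S" arbitrary: S rule: less_induct)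
  case less
  show ?case
  proof (cases "S = A")
    case False
    then have S: "S \<in> F" using less.prems(2) by blast
    let ?P = "parent_split n F S"
    note p = parent_split_mem[OF S]
    have "card S < card ?P"
      using psubset_card_mono[OF finite_vertex[OF p(1)] p(2)] .
    moreover have "card ?P \<le> card A"
      using card_mono[OF finite_A vertex_subset[OF p(1)]] .
    ultimately have "joined E (set_encode ?P) (set_encode A)"
      using less.prems(1) p(1,2) by (intro less.hyps) auto
    moreover have "joined E (set_encode S) (set_encode ?P)"
      using less.prems(1)[OF S] by (intro joined_edge) (simp add: split_edge_def)
    ultimately show ?thesis by (meson joined_trans)
  qed simp
qed

text \<open>A smallest set on a cycle would have two different neighbours that are not smaller,
  hence two parents.\<close>

lemma split_tree_no_cycle: "\<not> has_cycle (split_edge n F ` F)"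
proof
  assume "has_cycle (split_edge n F ` F)"
  then obtain p where p: "length p \<ge> 3" "distinct p"
    "\<And>i. i < length p \<Longrightarrow> {p ! i, p ! (Suc i mod length p)} \<in> split_edge n F ` F"
    unfolding has_cycle_def by blast
  define sz where "sz = (\<lambda>x. card (set_decode x))"
  have sz: "sz (set_encode S) = card S" if "S \<in> insert A F" for S
    using finite_vertex[OF that] by (simp add: sz_def)
  have up: "\<exists>S\<in>F. a = set_encode S \<and> b = set_encode (parent_split n F S)"
    if "{a, b} \<in> split_edge n F ` F" "sz a \<le> sz b" for a b
    using that(1)
  proof (cases rule: split_edge_cases)
    case (2 S)
    have "card S < card (parent_split n F S)"
      using parent_split_mem[OF 2(1)] finite_vertex by (intro psubset_card_mono) auto
    then show ?thesis using that(2) sz parent_split_mem(1)[OF 2(1)] 2 by auto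
  qed blast
  define L where "L = length p"
  have "0 \<in> {..<L}" "finite {..<L}" using p(1) by (auto simp: L_def)
  then have "{..<L} \<noteq> {}" "finite {..<L}" by blast+
  then obtain i where i: "i < L" "\<And>j. j < L \<Longrightarrow> sz (p ! i) \<le> sz (p ! j)"
    using ex_min_if_finite[of "(\<lambda>j. sz (p ! j)) ` {..<L}"]
    by (metis (no_types, lifting) arg_min_if_finite(1) arg_min_least lessThan_iff)
  define j where "j = Suc i mod L"
  \<comment> \<open>The cyclic predecessor of \<open>i\<close>, by cases because subtraction
    truncates at 0.\<close>
  define k where "k = (if i = 0 then L - 1 else i - 1)"
  have L: "L \<ge> 3" using p(1) by (simp add: L_def)
  have j: "j < L"
    unfolding j_def by (rule mod_less_divisor) (use L in simp)
  have ij: "{p ! i, p ! j} \<in> split_edge n F ` F"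
    using p(3)[of i] i(1) by (simp add: j_def L_def)
  have "Suc k mod L = i" "k < L" using i(1) L by (auto simp: k_def)
  then have k: "{p ! i, p ! k} \<in> split_edge n F ` F"
    using p(3)[of k] by (simp add: L_def insert_commute)
  have "j \<noteq> k"
  proof (cases "Suc i = L")
    case True
    then show ?thesis using L by (auto simp: j_def k_def)
  next
    case False
    then have "j = Suc i" using i(1) by (simp add: j_def)
    then show ?thesis using L by (auto simp: k_def)
  qed
  then have "p ! j \<noteq> p ! k"
    using p(2) j \<open>k < L\<close> by (simp add: nth_eq_iff_index_eq L_def)
  moreover obtain S where "S \<in> F" "p ! i = set_encode S" "p ! j = set_encode (parent_split n F S)"
    using up[OF ij i(2)[OF j]] by blast
  moreover obtain S' where "S' \<in> F" "p ! i = set_encode S'" "p ! k = set_encode (parent_split n F S')"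
    using up[OF k i(2)[OF \<open>k < L\<close>]] by blast
  ultimately show False using encode_inj[of S S'] by auto
qed

lemma split_tree_finite_tree: "finite_tree (tverts (split_tree n F)) (tedges (split_tree n F))"
proof -
  have "joined (split_edge n F ` F) (set_encode S) (set_encode A)" if "S \<in> insert A F" for S
    by (rule joined_to_top[OF _ that]) simp
  then have "joined (split_edge n F ` F) (set_encode S) (set_encode R)"
    if "S \<in> insert A F" "R \<in> insert A F" for S R
    using that by (meson joined_sym joined_trans)
  then have "\<forall>u\<in>tverts (split_tree n F). \<forall>v\<in>tverts (split_tree n F).
      (u, v) \<in> {(a, b). {a, b} \<in> tedges (split_tree n F)}\<^sup>*"
    unfolding split_tree_simps joined_def by blast
  moreover have "split_edge n F S \<in> {{u, v} |u v. u \<in> set_encode ` insert A F \<and> v \<in> set_encode ` insert A F \<and> u \<noteq> v}"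
    if "S \<in> F" for S
  proof -
    have "set_encode S \<noteq> set_encode (parent_split n F S)"
      using encode_inj[of S "parent_split n F S"] parent_split_mem[OF that] that by auto
    then show ?thesis
      using parent_split_mem(1)[OF that] that unfolding split_edge_def by blast
  qed
  then have "tedges (split_tree n F) \<subseteq> {{u, v} |u v. u \<in> tverts (split_tree n F) \<and> v \<in> tverts (split_tree n F) \<and> u \<noteq> v}"
    by (simp only: split_tree_simps image_subset_iff) blast
  ultimately show ?thesis
    using finite_F split_tree_no_cycle unfolding finite_tree_def by simp
qed

text \<open>If \<open>X\<close> is not inside \<open>S\<close>, the climb from \<open>X\<close>
  never uses the edge of \<open>S\<close>. If it is, a walk without that edge stays among the
  subsets of \<open>S\<close>, since that edge is the only way out.\<close>

lemma split_tree_below: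
  assumes S: "S \<in> F" and T: "rooted_tree (tverts (split_tree n F)) (tedges (split_tree n F)) (set_encode A)"
    and X: "X \<in> insert A F"
  shows "set_encode X \<in> rooted_tree.below (tverts (split_tree n F)) (tedges (split_tree n F)) (set_encode A) (split_edge n F S)
     \<longleftrightarrow> X \<subseteq> S"
proof -
  let ?E = "split_edge n F ` F - {split_edge n F S}"
  have "joined ?E (set_encode X) (set_encode A)" if "\<not> X \<subseteq> S"
  proof (rule joined_to_top[OF _ X])
    show "split_edge n F R \<in> ?E" if "R \<in> F" "X \<subseteq> R" for R
      using that \<open>\<not> X \<subseteq> S\<close> inj_onD[OF inj_split_edge _ that(1) S] by auto
  qed
  moreover have "\<not> joined ?E (set_encode X) (set_encode A)" if "X \<subseteq> S"
  proof
    assume "joined ?E (set_encode X) (set_encode A)"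
    then have "\<exists>R\<in>insert A F. set_encode A = set_encode R \<and> R \<subseteq> S"
    proof (induction rule: joined_induct)
      case refl
      then show ?case using X that by blast
    next
      case (step y z)
      then obtain R where R: "R \<in> insert A F" "y = set_encode R" "R \<subseteq> S" by blast
      have "{y, z} \<in> split_edge n F ` F" "{y, z} \<noteq> split_edge n F S" using step.hyps(2) by auto
      from this(1) show ?case
      proof (cases rule: split_edge_cases)
        case (1 Q)
        then have "set_encode R = set_encode Q" using R(2) by simp
        then have "R = Q" using encode_inj[OF R(1)] 1(1) by simp
        moreover have "Q \<noteq> S"
          using \<open>{y, z} \<noteq> split_edge n F S\<close> 1(2,3) unfolding split_edge_def by blast
        ultimately have "Q \<subset> S" using R(3) by blast
        then have "parent_split n F Q \<subseteq> S"
          using parent_split_mem(3)[OF 1(1)] S by simp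
        then show ?thesis using 1(3) parent_split_mem(1)[OF 1(1)] by (intro bexI conjI)
      next
        case (2 Q)
        then have "set_encode R = set_encode (parent_split n F Q)" using R(2) by simp
        then have "R = parent_split n F Q"
          using encode_inj[OF R(1) parent_split_mem(1)[OF 2(1)]] by simp
        then have "Q \<subseteq> S" using R(3) parent_split_mem(2)[OF 2(1)] by blast
        then show ?thesis using 2(1,2) by blast
      qed
    qed
    then show False using encode_inj[of A] split_memD(1)[OF S] by auto
  qed
  ultimately show ?thesis
    using X unfolding below_eq[OF T] unfolding split_tree_simps by blast
qed

end

section \<open>Stability of the tree of a laminar family\<close>

context tree_weights
begin

abbreviation "admissible \<equiv> block_splits (l + 1) (singleton_blocks n)"

lemma weight_nonneg: "X \<subseteq> {1..n} \<Longrightarrow> i \<in> X \<Longrightarrow> 0 \<le> w i"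
  using weight_pos[of i] by fastforce

lemma weight_mono: "X \<subseteq> Y \<Longrightarrow> Y \<subseteq> {1..n} \<Longrightarrow> sum w X \<le> sum w Y"
  using weight_nonneg[of Y] finite_subset[of Y "{1..n}"] by (intro sum_mono2) auto

lemma weight_with_1:
  assumes "1 \<in> X" "i \<in> X" "i \<noteq> 1" "X \<subseteq> {1..n}"
  shows "sum w X > 1"
proof -
  have "1 < sum w {1, i}" using weight_pos[of i] assms w(1) by auto
  also have "\<dots> \<le> sum w X" using assms by (intro weight_mono) auto
  finally show ?thesis .
qed

text \<open>Converse to the estimate for splits of stable trees: the combinatorial condition returns
  a weight greater than 1.\<close>

lemma weight_of_admissible:
  assumes "S \<in> admissible"
  shows "sum w S > 1"
proof -
  have S: "S \<subset> mark_set n" "S \<noteq> {}" "\<And>i. S \<noteq> {i}" "heavy (l + 1) S"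
    using assms block_splits_singletons_iff by blast+
  have sub: "S \<subseteq> {1..n}" using S(1) by (auto simp: mark_set_def)
  show ?thesis
  proof (cases "1 \<in> S")
    case True
    then obtain i where "i \<in> S" "i \<noteq> 1" using S(3)[of 1] by blast
    then show ?thesis using weight_with_1[OF True] sub by blast
  next
    case False
    have "w i = 1 / real l" if "i \<in> S" for i
    proof -
      have "i \<in> {1..n}" "i \<noteq> 1" "i \<noteq> 2" using that S(1) False by (auto simp: mark_set_def)
      then have "i \<in> {3..n}" by auto
      then show ?thesis by (rule w)
    qed
    then have "sum w S = (\<Sum>i\<in>S. 1 / real l)" by (rule sum.cong[OF refl])
    then have "sum w S = real (card S) / real l" by simp
    moreover have "real (card S) > real l" using S(4) False by (simp add: heavy_def)
    ultimately show ?thesis using l by (simp add: less_divide_eq)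
  qed
qed

end

locale weighted_splits = tree_weights n l w + split_family n "l + 1" F for n l w F
begin

lemma weight_of_vertex:
  assumes "X \<in> insert A F"
  shows "sum w X > 1"
proof (cases "X = A")
  case True
  show ?thesis
    unfolding True by (rule weight_with_1[of A 3]) (use n in \<open>auto simp: mark_set_def\<close>)
next
  case False
  then show ?thesis using assms splits weight_of_admissible by blast
qed

lemma smallest_split_self:
  assumes X: "X \<in> insert A F" and i: "i \<in> X"
    and C: "\<And>S. S \<in> F \<Longrightarrow> parent_split n F S = X \<Longrightarrow> i \<notin> S"
  shows "smallest_split n F i = X"
proof (rule ccontr)
  let ?R = "smallest_split n F i"
  assume "?R \<noteq> X"
  moreover have "?R \<subseteq> X"
    using X i smallest_split_subset_iff[of X i] vertex_subset[OF smallest_split_mem] by blast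
  ultimately have sub: "?R \<subset> X" by blast
  then have "?R \<in> F" using smallest_split_mem[of i] vertex_subset[OF X] by blast
  then obtain S where S: "S \<in> F" "parent_split n F S = X" "?R \<subseteq> S"
    using child_split_between[OF _ X sub] by blast
  then show False using C smallest_split_subset_iff[OF S(1)] by blast
qed

lemma smallest_split_root: "smallest_split n F 2 = A"
proof -
  have "2 \<notin> R" if "R \<in> F" for R
    using split_memD(1)[OF that] by (auto simp: mark_set_def)
  then show ?thesis unfolding smallest_split_def by blast
qed

text \<open>\<open>C\<close> consists of the children. Without children all marks of
  \<open>X\<close> sit at the vertex and weigh more than 1; with one child some mark of
  \<open>X\<close> is left over; two children suffice by their number. The last unit for stability
  comes from the edge to the parent or, at the root, from mark 2.\<close>

lemma split_tree_vertex_weight: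
  assumes X: "X \<in> insert A F"
  defines "C \<equiv> {S \<in> F. parent_split n F S = X}"
  shows "real (card C) + (\<Sum>i | i \<in> A \<and> smallest_split n F i = X. w i) > 1"
proof -
  let ?M = "{i. i \<in> A \<and> smallest_split n F i = X}"
  have M: "?M \<subseteq> {1..n}" by (auto simp: mark_set_def)
  have finC: "finite C" using finite_F by (simp add: C_def)
  have inM: "i \<in> ?M" if "i \<in> X" "\<And>S. S \<in> C \<Longrightarrow> i \<notin> S" for i
    using smallest_split_self[OF X that(1)] that vertex_subset[OF X] by (auto simp: C_def)
  consider "C = {}" | S where "C = {S}" | "card C \<ge> 2"
    using finC card_gt_0_iff[of C] card_1_singletonE[of C]
    by (metis One_nat_def Suc_leI le_antisym not_less_eq_eq numeral_2_eq_2)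
  then show ?thesis
  proof cases
    case 1
    then have "X \<subseteq> ?M" using inM by blast
    then have "sum w X \<le> sum w ?M" using M by (rule weight_mono)
    then show ?thesis using weight_of_vertex[OF X] by linarith
  next
    case (2 S)
    then have "S \<in> F" "parent_split n F S = X" by (auto simp: C_def)
    then obtain i where "i \<in> X" "i \<notin> S" using parent_split_mem(2) by blast
    then have i: "i \<in> ?M" using inM 2 by blast
    then have "sum w {i} \<le> sum w ?M" using M by (intro weight_mono) auto
    moreover have "w i > 0" using i M weight_pos by blast
    ultimately show ?thesis using 2 by simp
  next
    case 3
    have "sum w {} \<le> sum w ?M" using M by (intro weight_mono) auto
    then show ?thesis using 3 by simp
  qed
qed

lemma split_tree_stable: "stable_tree n w (split_tree n F)"
  unfolding stable_tree_def
proof (intro conjI ballI)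
  show "finite_tree (tverts (split_tree n F)) (tedges (split_tree n F))"
    by (rule split_tree_finite_tree)
  show "tmark (split_tree n F) ` {1..n} \<subseteq> tverts (split_tree n F)"
    unfolding split_tree_simps using smallest_split_mem by blast
  fix v assume "v \<in> tverts (split_tree n F)"
  then obtain X where X: "X \<in> insert A F" and v: "v = set_encode X" by auto
  let ?deg = "card {e \<in> tedges (split_tree n F). v \<in> e}"
  let ?wt = "\<Sum>i | i \<in> {1..n} \<and> tmark (split_tree n F) i = v. w i"
  let ?C = "{S \<in> F. parent_split n F S = X}"
  \<comment> \<open>The child edges together with the edge to the parent, which only the root
    lacks.\<close>
  let ?D = "if X \<in> F then insert X ?C else ?C"
  let ?M = "{i. i \<in> A \<and> smallest_split n F i = X}"
  have finC: "finite ?C" using finite_F by simp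
  have "X \<notin> ?C" using parent_split_mem(2)[of X] by auto
  then have cardD: "card ?D = card ?C + (if X \<in> F then 1 else 0)" using finC by simp
  have "split_edge n F ` ?D \<subseteq> {e \<in> tedges (split_tree n F). v \<in> e}"
    by (auto simp: v split_edge_def)
  moreover have "inj_on (split_edge n F) ?D"
    by (rule inj_on_subset[OF inj_split_edge]) auto
  moreover have "finite {e \<in> tedges (split_tree n F). v \<in> e}"
    using finite_F by simp
  ultimately have deg: "card ?D \<le> ?deg"
    by (intro card_inj_on_le)
  have eq: "tmark (split_tree n F) i = v \<longleftrightarrow> smallest_split n F i = X" for i
    using encode_inj[OF smallest_split_mem X] by (simp add: v)
  have wt: "?wt \<ge> sum w ?M + (if X \<in> F then 0 else 1)"
  proof (cases "X \<in> F")
    case True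
    have "sum w ?M \<le> ?wt"
      unfolding eq by (rule weight_mono) (auto simp: mark_set_def)
    then show ?thesis using True by simp
  next
    case False
    then have XA: "X = A" using X by simp
    \<comment> \<open>At the root, mark 2 of weight 1 replaces the missing parent edge.\<close>
    have "2 \<notin> ?M" by (simp add: mark_set_def)
    then have "sum w (insert 2 ?M) = sum w ?M + 1"
      using w(2) finite_A by simp
    moreover have "sum w (insert 2 ?M) \<le> ?wt"
      unfolding eq
    proof (rule weight_mono)
      show "insert 2 ?M \<subseteq> {i. i \<in> {1..n} \<and> smallest_split n F i = X}"
        using n smallest_split_root unfolding XA mark_set_def by auto
    qed auto
    ultimately show ?thesis using False by simp
  qed
  have "real (card ?C) + sum w ?M > 1" by (rule split_tree_vertex_weight[OF X])
  then show "real ?deg + ?wt > 2"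
    using deg wt cardD by (auto split: if_splits)
qed

lemma split_of_split_edge:
  assumes S: "S \<in> F"
  shows "split_of n (split_tree n F) (split_edge n F S) = S"
proof -
  have T: "rooted_tree (tverts (split_tree n F)) (tedges (split_tree n F)) (set_encode A)"
    using stable_rooted_tree[OF split_tree_stable] n by (simp add: smallest_split_root)
  have "i \<in> split_of n (split_tree n F) (split_edge n F S) \<longleftrightarrow> i \<in> {1..n} \<and> i \<in> S" for i
    using split_tree_below[OF S T smallest_split_mem[of i]] smallest_split_subset_iff[OF S, of i]
    by (simp add: split_of_def tree_below_def smallest_split_root)
  moreover have "S \<subseteq> {1..n}" using split_memD(1)[OF S] by (auto simp: mark_set_def)
  ultimately show ?thesis by blast
qed

end

text \<open>The representative whose tree has exactly the splits of nonzero length, so that no edge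
  has length zero.\<close>

definition canonical_point :: "nat \<Rightarrow> (nat set \<Rightarrow> real) \<Rightarrow> marked_tree \<times> (nat set \<Rightarrow> real)" where
  "canonical_point n x = (let T = split_tree n {S. x S \<noteq> 0} in (T, \<lambda>e\<in>tedges T. x (split_of n T e)))"

lemma topspace_length_simplex:
  "len \<in> topspace (length_simplex T) \<longleftrightarrow>
     len \<in> extensional (tedges T) \<and> (\<forall>e\<in>tedges T. 0 \<le> len e) \<and> (\<Sum>e\<in>tedges T. len e) = 1"
  by (auto simp: length_simplex_def PiE_UNIV_domain PiE_def)

context tree_weights
begin

abbreviation "split_complex \<equiv> flagreal laminar_pair admissible"

lemma finite_admissible: "finite admissible"
  by (rule finite_block_splits(1)) (auto simp: block_system_def singleton_blocks_def disjoint_def)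

lemma weighted_splits_support:
  assumes "x \<in> split_complex"
  shows "weighted_splits n l w {S. x S \<noteq> 0}"
  by unfold_locales (use flagrealD(2,3)[OF assms] in auto)

lemma canonical_point_properties:
  assumes x: "x \<in> split_complex"
  shows "stable_tree n w (fst (canonical_point n x))"
    and "snd (canonical_point n x) \<in> topspace (length_simplex (fst (canonical_point n x)))"
    and "split_lengths n (canonical_point n x) = x"
proof -
  define F where "F = {S. x S \<noteq> 0}"
  interpret weighted_splits n l w F
    unfolding F_def by (rule weighted_splits_support[OF x])
  let ?T = "split_tree n F"
  have c: "canonical_point n x = (?T, \<lambda>e\<in>tedges ?T. x (split_of n ?T e))"
    by (simp add: canonical_point_def F_def Let_def)
  show "stable_tree n w (fst (canonical_point n x))"
    using split_tree_stable by (simp add: c)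
  have "(\<Sum>e\<in>split_edge n F ` F. x (split_of n ?T e)) = (\<Sum>S\<in>F. x S)"
    by (simp add: sum.reindex[OF inj_split_edge] split_of_split_edge)
  also have "\<dots> = (\<Sum>S\<in>admissible. x S)"
    using finite_admissible splits by (intro sum.mono_neutral_left) (auto simp: F_def)
  finally have "(\<Sum>e\<in>split_edge n F ` F. x (split_of n ?T e)) = 1"
    using flagrealD(4)[OF x] by simp
  then show "snd (canonical_point n x) \<in> topspace (length_simplex (fst (canonical_point n x)))"
    using flagrealD(1)[OF x] by (simp add: c topspace_length_simplex)
  show "split_lengths n (canonical_point n x) = x"
  proof
    fix S
    have "split_lengths n (canonical_point n x) S
        = (\<Sum>e | e \<in> split_edge n F ` F \<and> split_of n ?T e = S. x S)"
      unfolding split_lengths_def c by (intro sum.cong) auto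
    also have "{e. e \<in> split_edge n F ` F \<and> split_of n ?T e = S} = (if S \<in> F then {split_edge n F S} else {})"
      using split_of_split_edge by auto
    finally show "split_lengths n (canonical_point n x) S = x S"
      by (simp add: F_def)
  qed
qed

end

section \<open>Contraction to the tree of the positive splits\<close>

context tree_weights
begin

context
  fixes T len
  assumes T: "stable_tree n w T" and len: "len \<in> topspace (length_simplex T)"
begin

interpretation rooted_tree "tverts T" "tedges T" "tmark T 2"
  using stable_rooted_tree[OF T] n by simp

lemma len_props:
  "e \<notin> tedges T \<Longrightarrow> len e = undefined" "e \<in> tedges T \<Longrightarrow> 0 \<le> len e" "(\<Sum>e\<in>tedges T. len e) = 1"
  using len by (auto simp: topspace_length_simplex extensional_def)

lemma split_lengths_eq:
  "split_lengths n (T, len) S = (if S \<in> split_of n T ` tedges T then len (inv_into (tedges T) (split_of n T) S) else 0)"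
proof (cases "S \<in> split_of n T ` tedges T")
  case True
  then obtain e where e: "e \<in> tedges T" "S = split_of n T e" by blast
  then have "{g. g \<in> tedges T \<and> split_of n T g = S} = {e}"
    using inj_onD[OF split_of_inj[OF T]] by blast
  then show ?thesis
    using True e inv_into_f_f[OF split_of_inj[OF T] e(1)] by (simp add: split_lengths_def)
next
  case False
  then have none: "{g. g \<in> tedges T \<and> split_of n T g = S} = {}" by blast
  show ?thesis using False unfolding split_lengths_def fst_conv none by simp
qed

lemma split_lengths_split_of: "e \<in> tedges T \<Longrightarrow> split_lengths n (T, len) (split_of n T e) = len e"
  using inv_into_f_f[OF split_of_inj[OF T]] by (simp add: split_lengths_eq)

lemma split_lengths_support:
  assumes "split_lengths n (T, len) S \<noteq> 0"
  obtains e where "e \<in> tedges T" "S = split_of n T e"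
  using assms that by (auto simp: split_lengths_eq split: if_splits)

lemma split_lengths_in_split_complex: "split_lengths n (T, len) \<in> split_complex"
proof -
  let ?x = "split_lengths n (T, len)"
  have "(\<Sum>S\<in>admissible. ?x S) = (\<Sum>S\<in>split_of n T ` tedges T. ?x S)"
    using finite_admissible split_of_in_block_splits[OF T] split_lengths_support
    by (intro sum.mono_neutral_right) auto
  also have "\<dots> = (\<Sum>e\<in>tedges T. len e)"
    using sum.reindex[OF split_of_inj[OF T], of ?x] split_lengths_split_of by simp
  finally have "(\<Sum>S\<in>admissible. ?x S) = 1" using len_props(3) by simp
  moreover have "0 \<le> ?x S" for S
  proof (cases "?x S = 0")
    case False
    then show ?thesis using split_lengths_support len_props(2) split_lengths_split_of by metis
  qed simp
  moreover have "S \<in> admissible" if "?x S \<noteq> 0" for S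
    using split_lengths_support[OF that] split_of_in_block_splits[OF T] by metis
  moreover have "laminar_pair R S" if "?x R \<noteq> 0" "?x S \<noteq> 0" for R S
    using split_lengths_support[OF that(1)] split_lengths_support[OF that(2)] split_of_laminar[OF T] by metis
  ultimately show ?thesis unfolding flagreal_def by blast
qed

section \<open>Clusters: collapsing the edges of length zero\<close>

definition "long_splits = {S. split_lengths n (T, len) S \<noteq> 0}"

interpretation weighted_splits n l w long_splits
  unfolding long_splits_def by (rule weighted_splits_support[OF split_lengths_in_split_complex])

definition "long_above v = {e \<in> tedges T. split_of n T e \<in> long_splits \<and> v \<in> below e}"

text \<open>The vertex of the canonical tree to which \<open>v\<close> is contracted: the smallest
  positive-length split whose edge lies above \<open>v\<close>, or the root if there is
  none.\<close>

definition "cluster v = A \<inter> \<Inter>(split_of n T ` long_above v)"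

lemma long_splitE:
  assumes "S \<in> long_splits"
  obtains e where "e \<in> tedges T" "S = split_of n T e"
  using assms split_lengths_support by (auto simp: long_splits_def)

lemma cluster_mem: "cluster v \<in> insert A (split_of n T ` long_above v)"
  unfolding cluster_def
proof (rule chain_Inter_mem)
  show "finite (split_of n T ` long_above v)"
    using finite_E by (simp add: long_above_def)
  fix X Y assume X: "X \<in> split_of n T ` long_above v"
  then obtain e where e: "X = split_of n T e" "e \<in> tedges T" "v \<in> below e" "X \<in> long_splits"
    by (auto simp: long_above_def)
  then show "X \<subseteq> A" using split_memD(1) by blast
  assume "Y \<in> split_of n T ` long_above v"
  then obtain g where g: "Y = split_of n T g" "g \<in> tedges T" "v \<in> below g" by (auto simp: long_above_def)
  have "below e \<subseteq> below g \<or> below g \<subseteq> below e"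
    using below_laminar[OF e(2) g(2)] e(3) g(3) by blast
  then show "X \<subseteq> Y \<or> Y \<subseteq> X"
    using split_of_subset_iff[OF T] e g by blast
qed

lemma cluster_vertex: "cluster v \<in> insert A long_splits"
proof -
  have "split_of n T ` long_above v \<subseteq> long_splits"
    by (simp add: long_above_def image_subset_iff)
  then show ?thesis using cluster_mem[of v] by blast
qed

text \<open>Clusters thus record on which side of every long edge a vertex lies.\<close>

lemma cluster_subset_iff:
  assumes e: "e \<in> tedges T" "split_of n T e \<in> long_splits" and v: "v \<in> tverts T"
  shows "cluster v \<subseteq> split_of n T e \<longleftrightarrow> v \<in> below e"
proof
  assume sub: "cluster v \<subseteq> split_of n T e"
  then have "cluster v \<noteq> A" using split_memD(1)[OF e(2)] by blast
  then obtain g where g: "g \<in> tedges T" "v \<in> below g" "cluster v = split_of n T g"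
    using cluster_mem[of v] unfolding long_above_def by blast
  then have "below g \<subseteq> below e" using sub split_of_subset_iff[OF T e(1) g(1)] by simp
  then show "v \<in> below e" using g(2) by blast
next
  assume "v \<in> below e"
  then have "e \<in> long_above v" using e by (simp add: long_above_def)
  then show "cluster v \<subseteq> split_of n T e" by (auto simp: cluster_def)
qed

lemma below_superset:
  assumes e: "e \<in> tedges T" and g: "g \<in> tedges T" and c: "child e \<in> below g"
  shows "below e \<subseteq> below g"
proof (cases "g = e")
  case False
  obtain p where p: "e = {child e, p}" "child e \<in> below e" "p \<notin> below e"
    using e by (rule edge_child_parent)
  then have "p \<in> below g" using below_edge_iff[of "child e" p g] e False c by auto
  then show ?thesis using below_laminar[OF e g] p c by blast
qed simp

lemma cluster_child:
  assumes e: "e \<in> tedges T" "split_of n T e \<in> long_splits"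
  shows "cluster (child e) = split_of n T e"
proof
  have c: "child e \<in> below e" using e(1) by (metis edge_child_parent)
  then show "cluster (child e) \<subseteq> split_of n T e"
    using cluster_subset_iff[OF e] below_subset by blast
  have "split_of n T e \<subseteq> split_of n T g" if "g \<in> long_above (child e)" for g
    using that below_superset[OF e(1)] split_of_subset_iff[OF T _ e(1)] by (auto simp: long_above_def)
  then show "split_of n T e \<subseteq> cluster (child e)"
    using split_memD(1)[OF e(2)] unfolding cluster_def by blast
qed

text \<open>The long edges above the upper end of \<open>e\<close> are exactly those whose split
  properly contains that of \<open>e\<close>, so both sides are the same intersection.\<close>

lemma cluster_parent:
  assumes e: "e \<in> tedges T" "split_of n T e \<in> long_splits" and p: "e = {child e, p}" "p \<notin> below e"
  shows "cluster p = parent_split n long_splits (split_of n T e)"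
proof -
  have "split_of n T ` long_above p = {R \<in> long_splits. split_of n T e \<subset> R}"
  proof (intro subset_antisym subsetI)
    fix R assume "R \<in> split_of n T ` long_above p"
    then obtain g where g: "R = split_of n T g" "g \<in> tedges T" "R \<in> long_splits" "p \<in> below g"
      by (auto simp: long_above_def)
    then have ge: "g \<noteq> e" using p(2) by blast
    then have "child e \<in> below g" using below_edge_iff[of "child e" p g] p(1) e(1) g(4) by auto
    then have "split_of n T e \<subseteq> R"
      using below_superset[OF e(1) g(2)] split_of_subset_iff[OF T g(2) e(1)] g(1) by simp
    moreover have "split_of n T e \<noteq> R" using inj_onD[OF split_of_inj[OF T] _ e(1) g(2)] g(1) ge by blast
    ultimately show "R \<in> {R \<in> long_splits. split_of n T e \<subset> R}" using g(3) by blast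
  next
    fix R assume R: "R \<in> {R \<in> long_splits. split_of n T e \<subset> R}"
    then obtain g where g: "g \<in> tedges T" "R = split_of n T g" using long_splitE by blast
    then have "below e \<subseteq> below g" "g \<noteq> e" using R split_of_subset_iff[OF T g(1) e(1)] by blast+
    then have "child e \<in> below g" using e(1) by (metis edge_child_parent subsetD)
    then have "p \<in> below g" using below_edge_iff[of "child e" p g] p(1) e(1) \<open>g \<noteq> e\<close> by auto
    then show "R \<in> split_of n T ` long_above p" using R g by (auto simp: long_above_def)
  qed
  then show ?thesis by (simp add: cluster_def parent_split_def)
qed

lemma cluster_short_edge:
  assumes "{a, b} \<in> tedges T" "split_of n T {a, b} \<notin> long_splits"
  shows "cluster a = cluster b"
proof -
  have "a \<in> below g \<longleftrightarrow> b \<in> below g" if "split_of n T g \<in> long_splits" for g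
    using that assms by (intro below_edge_iff) auto
  then have "long_above a = long_above b" unfolding long_above_def by blast
  then show ?thesis by (simp add: cluster_def)
qed

lemma cluster_edge_image:
  assumes e: "e \<in> tedges T" "split_of n T e \<in> long_splits"
  shows "(\<lambda>v. set_encode (cluster v)) ` e = split_edge n long_splits (split_of n T e)"
proof -
  obtain p where p: "e = {child e, p}" "p \<notin> below e" using e(1) by (metis edge_child_parent)
  have "(\<lambda>v. set_encode (cluster v)) ` e = {set_encode (cluster (child e)), set_encode (cluster p)}"
    by (subst p(1)) simp
  then show ?thesis
    by (simp add: split_edge_def cluster_child[OF e] cluster_parent[OF e p])
qed

text \<open>Equal clusters mean the same side of every long edge, so each long edge can be avoided
  separately; \<open>joined_avoiding\<close> then avoids them all together.\<close>

lemma cluster_fibre_joined: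
  assumes u: "u \<in> tverts T" "v \<in> tverts T" and eq: "cluster u = cluster v"
  shows "joined {e \<in> tedges T. split_of n T e \<notin> long_splits} u v"
proof -
  let ?X = "{e \<in> tedges T. split_of n T e \<in> long_splits}"
  have "joined (tedges T - {e}) u v" if "e \<in> ?X" for e
  proof -
    have e: "e \<in> tedges T" "split_of n T e \<in> long_splits" using that by auto
    have uv: "u \<in> below e \<longleftrightarrow> v \<in> below e"
      using cluster_subset_iff[OF e u(1)] cluster_subset_iff[OF e u(2)] unfolding eq by blast
    show ?thesis
    proof (cases "u \<in> below e")
      case True
      then show ?thesis using joined_below[OF e(1)] uv by blast
    next
      case False
      then have "joined (tedges T - {e}) u (tmark T 2)" "joined (tedges T - {e}) v (tmark T 2)"
        using uv u by (auto simp: below_def)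
      then show ?thesis by (meson joined_sym joined_trans)
    qed
  qed
  moreover have "finite ?X" using finite_E by simp
  ultimately have "joined (tedges T - ?X) u v"
    using joined_avoiding[OF _ all_joined[OF u]] by blast
  moreover have "tedges T - ?X = {e \<in> tedges T. split_of n T e \<notin> long_splits}" by blast
  ultimately show ?thesis by simp
qed

lemma contraction_to_split_tree:
  "contraction n (\<lambda>v. set_encode (cluster v)) T (split_tree n long_splits)"
proof -
  let ?f = "\<lambda>v. set_encode (cluster v)"
  have mark: "cluster (tmark T i) = smallest_split n long_splits i" if "i \<in> {1..n}" for i
  proof -
    have "split_of n T ` long_above (tmark T i) = {R \<in> long_splits. i \<in> R}"
    proof (intro subset_antisym subsetI)
      fix R assume "R \<in> split_of n T ` long_above (tmark T i)"
      then show "R \<in> {R \<in> long_splits. i \<in> R}"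
        using that by (auto simp: long_above_def split_of_eq[OF T])
    next
      fix R assume R: "R \<in> {R \<in> long_splits. i \<in> R}"
      then obtain g where "g \<in> tedges T" "R = split_of n T g" using long_splitE by blast
      then show "R \<in> split_of n T ` long_above (tmark T i)"
        using R by (auto simp: long_above_def split_of_eq[OF T])
    qed
    then show ?thesis by (simp add: cluster_def smallest_split_def)
  qed
  have vertices: "?f ` tverts T = set_encode ` insert A long_splits"
  proof -
    have "cluster (tmark T 2) = A"
      using mark[of 2] smallest_split_root n by simp
    moreover have "S \<in> cluster ` tverts T" if S: "S \<in> long_splits" for S
    proof -
      obtain e where e: "e \<in> tedges T" "S = split_of n T e" using S by (rule long_splitE)
      then have "child e \<in> tverts T" by (metis below_subset edge_child_parent subsetD)
      then show ?thesis using cluster_child[of e] e S by (metis imageI)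
    qed
    ultimately have "cluster ` tverts T = insert A long_splits"
      using cluster_vertex root by blast
    then show ?thesis by (metis image_image)
  qed
  have edges: "split_edge n long_splits ` long_splits = {{?f u, ?f v} |u v. {u, v} \<in> tedges T \<and> ?f u \<noteq> ?f v}"
  proof (intro subset_antisym subsetI)
    fix e' assume "e' \<in> split_edge n long_splits ` long_splits"
    then obtain S where S: "S \<in> long_splits" "e' = split_edge n long_splits S" by blast
    obtain e where e: "e \<in> tedges T" "S = split_of n T e" using S(1) by (rule long_splitE)
    obtain p where p: "e = {child e, p}" using e(1) by (metis edge_child_parent)
    have "e' = ?f ` e" using cluster_edge_image[OF e(1)] S e by simp
    then have e': "e' = {?f (child e), ?f p}" by (subst (asm) p) simp
    moreover have "set_encode S \<noteq> set_encode (parent_split n long_splits S)"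
      using encode_inj[of S] parent_split_mem(1,2)[OF S(1)] S(1) by auto
    then have "?f (child e) \<noteq> ?f p"
      using e' S(2) by (auto simp: split_edge_def doubleton_eq_iff)
    moreover have "{child e, p} \<in> tedges T" using e(1) p by metis
    ultimately show "e' \<in> {{?f u, ?f v} |u v. {u, v} \<in> tedges T \<and> ?f u \<noteq> ?f v}"
      by blast
  next
    fix e' assume "e' \<in> {{?f u, ?f v} |u v. {u, v} \<in> tedges T \<and> ?f u \<noteq> ?f v}"
    then obtain u v where uv: "e' = {?f u, ?f v}" "{u, v} \<in> tedges T" "?f u \<noteq> ?f v" by blast
    then have long: "split_of n T {u, v} \<in> long_splits" using cluster_short_edge by metis
    then have "e' = split_edge n long_splits (split_of n T {u, v})"
      using cluster_edge_image[OF uv(2)] uv(1) by simp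
    then show "e' \<in> split_edge n long_splits ` long_splits" using long by blast
  qed
  have fibres: "(u, v) \<in> {(a, b). {a, b} \<in> tedges T \<and> ?f a = ?f b}\<^sup>*"
    if "u \<in> tverts T" "v \<in> tverts T" "?f u = ?f v" for u v
  proof -
    have "cluster u = cluster v" using that(3) encode_inj[OF cluster_vertex cluster_vertex] by simp
    from cluster_fibre_joined[OF that(1,2) this]
    have "(u, v) \<in> {(a, b). {a, b} \<in> {e \<in> tedges T. split_of n T e \<notin> long_splits}}\<^sup>*"
      by (simp add: joined_def)
    moreover have "{(a, b). {a, b} \<in> {e \<in> tedges T. split_of n T e \<notin> long_splits}}
        \<subseteq> {(a, b). {a, b} \<in> tedges T \<and> ?f a = ?f b}"
      using cluster_short_edge by fastforce
    ultimately show ?thesis by (meson rtrancl_mono subsetD)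
  qed
  show ?thesis
    unfolding contraction_def split_tree_simps using vertices edges fibres mark by simp
qed

text \<open>Each point reaches its canonical representative by a single gluing, so points with equal
  split lengths are glued.\<close>

lemma face_glue_canonical_point: "face_glue n w (T, len) (canonical_point n (split_lengths n (T, len)))"
proof -
  let ?x = "split_lengths n (T, len)" and ?f = "\<lambda>v. set_encode (cluster v)"
  note c = canonical_point_properties[OF split_lengths_in_split_complex]
  have fst: "fst (canonical_point n ?x) = split_tree n long_splits"
    by (simp add: canonical_point_def long_splits_def Let_def)
  have snd: "snd (canonical_point n ?x) = (\<lambda>e\<in>tedges (split_tree n long_splits). ?x (split_of n (split_tree n long_splits) e))"
    by (simp add: canonical_point_def long_splits_def Let_def)
  have "extend_lengths ?f T (split_tree n long_splits) (snd (canonical_point n ?x)) = len"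
  proof
    fix e
    show "extend_lengths ?f T (split_tree n long_splits) (snd (canonical_point n ?x)) e = len e"
    proof (cases "e \<in> tedges T")
      case e: True
      show ?thesis
      proof (cases "split_of n T e \<in> long_splits")
        case True
        then have "?f ` e = split_edge n long_splits (split_of n T e)"
          using e by (rule cluster_edge_image[rotated])
        then show ?thesis
          using e True split_of_split_edge[OF True] split_lengths_split_of[OF e]
          by (simp add: extend_lengths_def snd)
      next
        case False
        have "?f ` e \<notin> tedges (split_tree n long_splits)"
        proof
          assume "?f ` e \<in> tedges (split_tree n long_splits)"
          then obtain S where S: "S \<in> long_splits" "?f ` e = split_edge n long_splits S" by auto
          obtain a b where ab: "e = {a, b}" using e by (rule edgeE)
          have "cluster a = cluster b" using cluster_short_edge e False ab by simp
          then have "split_edge n long_splits S = {?f a}" using S(2) ab by simp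
          then have "set_encode S = set_encode (parent_split n long_splits S)"
            unfolding split_edge_def by (metis doubleton_eq_iff insert_absorb2)
          then show False using encode_inj[of S] parent_split_mem(1,2)[OF S(1)] S(1) by auto
        qed
        moreover have "len e = 0"
          using False split_lengths_split_of[OF e] by (simp add: long_splits_def)
        ultimately show ?thesis using e by (simp add: extend_lengths_def)
      qed
    qed (simp add: extend_lengths_def len_props(1))
  qed
  then show ?thesis
    unfolding face_glue_def using T c(1,2) contraction_to_split_tree fst
    by (metis prod.collapse)
qed

end

end

section \<open>The homeomorphism with the complex of splits\<close>

lemma closedin_length_simplex:
  assumes "finite (tedges T)"
  shows "closedin (powertop_real (tedges T)) {len \<in> extensional (tedges T). (\<Sum>e\<in>tedges T. len e) = 1}"
proof -
  have "continuous_map (powertop_real (tedges T)) euclideanreal (\<lambda>len. \<Sum>e\<in>tedges T. len e)"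
    using assms by (intro continuous_map_sum continuous_map_product_projection) auto
  from closedin_continuous_map_preimage[OF this, of "{1}"] show ?thesis
    by (simp add: PiE_UNIV_domain PiE_def)
qed

text \<open>Lengths that are nonnegative with sum 1 are at most 1, so the simplex is a closed part
  of a cube.\<close>

lemma compact_space_length_simplex:
  assumes fin: "finite (tedges T)"
  shows "compact_space (length_simplex T)"
proof -
  let ?E = "tedges T"
  let ?K = "PiE ?E (\<lambda>_. {0..1::real}) \<inter> {len \<in> extensional ?E. (\<Sum>e\<in>?E. len e) = 1}"
  have "compactin (powertop_real ?E) ?K"
    using closedin_length_simplex[OF fin]
    by (intro compact_Int_closedin) (simp_all add: compactin_PiE)
  moreover have "topspace (powertop_real ?E) \<inter> {len. (\<forall>e\<in>?E. 0 \<le> len e) \<and> (\<Sum>e\<in>?E. len e) = 1} = ?K"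
    (is "?S = _")
  proof -
    have "len \<in> ?S \<longleftrightarrow> len \<in> ?K" for len
    proof -
      have S: "len \<in> ?S \<longleftrightarrow> len \<in> extensional ?E \<and> (\<forall>e\<in>?E. 0 \<le> len e) \<and> (\<Sum>e\<in>?E. len e) = 1"
        by (simp add: PiE_UNIV_domain PiE_iff)
      have K: "len \<in> ?K \<longleftrightarrow> len \<in> extensional ?E \<and> (\<forall>e\<in>?E. 0 \<le> len e \<and> len e \<le> 1) \<and> (\<Sum>e\<in>?E. len e) = 1"
        by (simp add: PiE_iff conj_ac)
      have "len e \<le> (\<Sum>e\<in>?E. len e)" if "\<forall>e\<in>?E. 0 \<le> len e" "e \<in> ?E" for e
        using member_le_sum[OF that(2), of len] fin that(1) by simp
      then show ?thesis unfolding S K by (intro iffI conjI ballI) (elim conjE, simp)+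
    qed
    then show ?thesis unfolding set_eq_iff by (rule allI)
  qed
  ultimately have "compactin (powertop_real ?E) (topspace (powertop_real ?E) \<inter>
      {len. (\<forall>e\<in>?E. 0 \<le> len e) \<and> (\<Sum>e\<in>?E. len e) = 1})"
    by (simp only:)
  from compact_space_subtopology[OF this] show ?thesis
    unfolding length_simplex_def subtopology_restrict .
qed

lemma reduced_homology_nonzero_homeomorphic:
  assumes "X homeomorphic_space Y"
  shows "reduced_homology_nonzero d X \<longleftrightarrow> reduced_homology_nonzero d Y"
proof -
  have "topspace X = {} \<longleftrightarrow> topspace Y = {}"
    by (rule homotopy_equivalent_space_topspace_empty[OF homeomorphic_imp_homotopy_equivalent_space[OF assms]])
  moreover have "trivial_group (reduced_homology_group d X) \<longleftrightarrow> trivial_group (reduced_homology_group d Y)"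
    using isomorphic_group_triviality[OF homeomorphic_space_imp_isomorphic_reduced_homology_groups[OF assms]] by simp
  ultimately show ?thesis by (simp add: reduced_homology_nonzero_def)
qed

section \<open>The gluing relation, the quotient and its homology\<close>

context tree_weights
begin

abbreviation "tree_space \<equiv> sum_topology length_simplex {T. stable_tree n w T}"

lemma tree_space_iff: "p \<in> topspace tree_space \<longleftrightarrow>
    stable_tree n w (fst p) \<and> snd p \<in> topspace (length_simplex (fst p))"
  by (cases p) auto

lemma continuous_map_split_lengths: "continuous_map tree_space (top_of_set split_complex) (split_lengths n)"
proof -
  have "continuous_map (length_simplex T) euclidean (\<lambda>len. split_lengths n (T, len))"
    if T: "stable_tree n w T" for T
  proof -
    have fin: "finite (tedges T)"
      by (rule rooted_tree.finite_E[OF stable_rooted_tree[OF T]]) (use n in simp)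
    have "continuous_map (length_simplex T) euclidean (\<lambda>len. split_lengths n (T, len) S)" for S
      unfolding split_lengths_def length_simplex_def fst_conv snd_conv
      using fin by (intro continuous_map_sum continuous_map_from_subtopology continuous_map_product_projection) auto
    then show ?thesis
      unfolding euclidean_product_topology[symmetric]
      by (intro continuous_map_coordinatewise_then_product) auto
  qed
  then have "continuous_map tree_space euclidean (split_lengths n)"
    unfolding continuous_map_def openin_sum_topology by fastforce
  moreover have "split_lengths n ` topspace tree_space \<subseteq> split_complex"
    using split_lengths_in_split_complex by (auto simp: tree_space_iff)
  ultimately show ?thesis
    by (simp add: continuous_map_in_subtopology image_subset_iff_funcset)
qed

lemma canonical_point_in_tree_space: "x \<in> split_complex \<Longrightarrow> canonical_point n x \<in> topspace tree_space"
  using canonical_point_properties(1,2) unfolding tree_space_iff by blast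

lemma split_lengths_equivclp:
  assumes "equivclp (face_glue n w) p q"
  shows "split_lengths n p = split_lengths n q"
  using assms
proof (induction rule: equivclp_induct)
  case (step y z)
  then show ?case
    using split_lengths_face_glue[of n w y z] split_lengths_face_glue[of n w z y] n by auto
qed simp

lemma glued_canonical_point:
  assumes "p \<in> topspace tree_space"
  shows "equivclp (face_glue n w) p (canonical_point n (split_lengths n p))"
  using face_glue_canonical_point[of "fst p" "snd p"] assms
  unfolding tree_space_iff by (simp add: r_into_equivclp)

definition glue_class :: "marked_tree \<times> (nat set \<Rightarrow> real) \<Rightarrow> (marked_tree \<times> (nat set \<Rightarrow> real)) set" where
  "glue_class p = {q. equivclp (face_glue n w) p q}"

lemma glue_class_eq_iff: "glue_class p = glue_class q \<longleftrightarrow> equivclp (face_glue n w) p q"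
proof
  assume "glue_class p = glue_class q"
  then have "q \<in> glue_class p" by (simp add: glue_class_def)
  then show "equivclp (face_glue n w) p q" by (simp add: glue_class_def)
next
  assume pq: "equivclp (face_glue n w) p q"
  show "glue_class p = glue_class q"
    unfolding glue_class_def
  proof (rule Collect_cong)
    show "equivclp (face_glue n w) p r \<longleftrightarrow> equivclp (face_glue n w) q r" for r
      using equivclp_trans[OF pq, of r] equivclp_trans[OF equivclp_sym[OF pq], of r] by blast
  qed
qed

text \<open>Split lengths are a complete invariant of gluing: points sharing them share the
  canonical representative.\<close>

lemma glue_class_eq_iff_split_lengths:
  assumes "p \<in> topspace tree_space" "q \<in> topspace tree_space"
  shows "glue_class p = glue_class q \<longleftrightarrow> split_lengths n p = split_lengths n q"
proof
  assume "split_lengths n p = split_lengths n q"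
  then have "equivclp (face_glue n w) q (canonical_point n (split_lengths n p))"
    using glued_canonical_point[OF assms(2)] by simp
  from equivclp_trans[OF glued_canonical_point[OF assms(1)] equivclp_sym[OF this]]
  show "glue_class p = glue_class q" by (simp only: glue_class_eq_iff)
qed (simp add: glue_class_eq_iff split_lengths_equivclp)

lemma Delta0_eq: "Delta0 n w = quotient_topology tree_space glue_class"
proof -
  have "glue_class = (\<lambda>p. {q. equivclp (face_glue n w) p q})"
    by (rule ext) (rule glue_class_def)
  then show ?thesis by (simp add: Delta0_def)
qed

text \<open>The disjoint union runs over all namings of vertices and is not finite. The canonical
  trees come from the finitely many families of admissible sets, and their simplices already meet
  every class.\<close>

lemma compact_space_Delta0: "compact_space (Delta0 n w)"
proof -
  let ?\<T> = "{T \<in> split_tree n ` Pow admissible. stable_tree n w T}"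
  let ?K = "\<Union>T\<in>?\<T>. Pair T ` topspace (length_simplex T)"
  have "compactin tree_space (Pair T ` topspace (length_simplex T))" if T: "T \<in> ?\<T>" for T
  proof (rule image_compactin)
    have "finite (tedges T)"
      using T n by (auto intro: rooted_tree.finite_E[OF stable_rooted_tree])
    then show "compactin (length_simplex T) (topspace (length_simplex T))"
      using compact_space_length_simplex by (simp add: compact_space_def)
    show "continuous_map (length_simplex T) tree_space (Pair T)"
      using T by (intro continuous_map_component_injection) simp
  qed
  moreover have "finite ?\<T>" using finite_admissible by simp
  ultimately have "compactin tree_space ?K"
    by (intro compactin_Union) auto
  then have "compactin (Delta0 n w) (glue_class ` ?K)"
    unfolding Delta0_eq
    by (rule image_compactin[OF _ quotient_imp_continuous_map[OF quotient_map_quotient_topology]])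
  moreover have "glue_class ` ?K = glue_class ` topspace tree_space"
  proof (intro subset_antisym subsetI)
    fix c assume "c \<in> glue_class ` topspace tree_space"
    then obtain p where p: "p \<in> topspace tree_space" "c = glue_class p" by blast
    let ?x = "split_lengths n p"
    have x: "?x \<in> split_complex"
      using continuous_map_split_lengths p(1) by (auto simp: continuous_map_def)
    have "{S. ?x S \<noteq> 0} \<in> Pow admissible" using flagrealD(2)[OF x] by blast
    then have "fst (canonical_point n ?x) \<in> split_tree n ` Pow admissible"
      by (simp add: canonical_point_def Let_def)
    then have "canonical_point n ?x \<in> ?K"
      using canonical_point_properties(1,2)[OF x] by (cases "canonical_point n ?x") auto
    moreover have "c = glue_class (canonical_point n ?x)"
      unfolding p(2) glue_class_eq_iff by (rule glued_canonical_point[OF p(1)])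
    ultimately show "c \<in> glue_class ` ?K" by blast
  qed auto
  ultimately show ?thesis
    unfolding compact_space_def by (simp add: Delta0_eq)
qed

text \<open>Split lengths descend to a continuous bijection from a compact space onto a Hausdorff
  space.\<close>

lemma Delta0_homeomorphic_split_complex: "Delta0 n w homeomorphic_space top_of_set split_complex"
proof -
  have "quotient_map tree_space (Delta0 n w) glue_class"
    unfolding Delta0_eq by (rule quotient_map_quotient_topology)
  then obtain g where g: "continuous_map (Delta0 n w) (top_of_set split_complex) g"
    "g ` topspace (Delta0 n w) = split_lengths n ` topspace tree_space"
    "\<And>p. p \<in> topspace tree_space \<Longrightarrow> g (glue_class p) = split_lengths n p"
    using quotient_map_lift_exists[OF _ continuous_map_split_lengths] glue_class_eq_iff_split_lengths
    by metis
  have "split_lengths n ` topspace tree_space = split_complex"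
  proof (intro subset_antisym subsetI)
    fix x assume x: "x \<in> split_complex"
    then show "x \<in> split_lengths n ` topspace tree_space"
      using canonical_point_in_tree_space canonical_point_properties(3) by (metis imageI)
  qed (use continuous_map_split_lengths in \<open>auto simp: continuous_map_def\<close>)
  moreover have "inj_on g (topspace (Delta0 n w))"
    unfolding Delta0_eq topspace_quotient_topology
    using g(3) glue_class_eq_iff_split_lengths by (auto simp: inj_on_def)
  moreover have "Hausdorff_space (euclidean :: (nat set \<Rightarrow> real) topology)"
    unfolding euclidean_product_topology[symmetric] by (simp add: Hausdorff_space_product_topology)
  ultimately have "homeomorphic_map (Delta0 n w) (top_of_set split_complex) g"
    using g(1,2) compact_space_Delta0
    by (intro continuous_imp_homeomorphic_map Hausdorff_space_subtopology) auto
  then show ?thesis by (rule homeomorphic_map_imp_homeomorphic_space)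
qed

lemma singleton_blocks_properties:
  "block_system (l + 1) (singleton_blocks n)" "card (singleton_blocks n) = n - 1"
  "heavy_blocks (l + 1) (singleton_blocks n) = {{1}}"
  "card (light_blocks (l + 1) (singleton_blocks n)) = n - 2"
proof -
  show P: "block_system (l + 1) (singleton_blocks n)"
    by (auto simp: block_system_def singleton_blocks_def disjoint_def)
  show c: "card (singleton_blocks n) = n - 1"
    using n by (simp add: singleton_blocks_def card_image)
  \<comment> \<open>As \<open>l \<ge> 1\<close>, the threshold \<open>l + 1\<close> is at least 2,
    so a singleton is heavy only if it is the block of mark 1.\<close>
  show h: "heavy_blocks (l + 1) (singleton_blocks n) = {{1}}"
    using n l by (auto simp: heavy_blocks_def singleton_blocks_def heavy_def)
  have "finite (singleton_blocks n)" by (simp add: singleton_blocks_def)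
  from card_heavy_light[OF this, of "l + 1"] show "card (light_blocks (l + 1) (singleton_blocks n)) = n - 2"
    using c h by simp
qed

lemma Delta0_nonzero_iff:
  "reduced_homology_nonzero d (Delta0 n w) \<longleftrightarrow>
     (\<exists>t::nat. t * (l + 1) \<le> n - 2 \<and> d = int n - 4 - int t * (int l - 1))"
proof -
  have "reduced_homology_nonzero d (Delta0 n w) \<longleftrightarrow> flag_nonzero d laminar_pair admissible"
    by (rule reduced_homology_nonzero_homeomorphic[OF Delta0_homeomorphic_split_complex])
  also have "\<dots> \<longleftrightarrow> (\<exists>t::nat. t * (l + 1) \<le> n - 2 \<and>
       d = int (card {{1::nat}}) + int (n - 2) - 3 - int t * (int (l + 1) - 2))"
    using flag_nonzero_block_splits[of "l + 1" "singleton_blocks n" d] singleton_blocks_properties n l by simp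
  also have "int (card {{1::nat}}) + int (n - 2) - 3 = int n - 4"
    using n by simp
  also have "int (l + 1) - 2 = int l - 1" by simp
  finally show ?thesis .
qed

end

theorem theorem7p3:
  fixes k l n :: nat and \<epsilon> :: real and w :: "nat \<Rightarrow> real" and d :: int
  assumes "k \<ge> 1" and "l \<ge> 1"
    and "\<epsilon> = 1 / real l"
    and "n = k + 2"
    and "w 1 = 1" and "w 2 = 1" and "\<And>i. i \<in> {3..n} \<Longrightarrow> w i = \<epsilon>"
  shows "reduced_homology_nonzero d (Delta0 n w) \<longleftrightarrow>
         (\<exists>t::int. 0 \<le> t \<and> t \<le> \<lfloor>(real n - 2) / (real l + 1)\<rfloor> \<and>
                   d = int n - 4 - t * (int l - 1))"
proof -
  interpret tree_weights n l w
    by unfold_locales (use assms in auto)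
  \<comment> \<open>Clearing the positive denominator turns the floor into a bound on naturals;
    \<open>n \<ge> 3\<close> makes \<open>n - 2\<close> a true difference.\<close>
  have bound: "int t \<le> \<lfloor>(real n - 2) / (real l + 1)\<rfloor> \<longleftrightarrow> t * (l + 1) \<le> n - 2" for t
  proof -
    have "int t \<le> \<lfloor>(real n - 2) / (real l + 1)\<rfloor> \<longleftrightarrow> real t * (real l + 1) \<le> real (n - 2)"
      using n by (simp add: le_floor_iff le_divide_eq of_nat_diff)
    also have "\<dots> \<longleftrightarrow> real (t * (l + 1)) \<le> real (n - 2)"
      by (simp add: algebra_simps)
    finally show ?thesis by (simp only: of_nat_le_iff)
  qed
  show ?thesis
    unfolding Delta0_nonzero_iff
  proof
    assume "\<exists>t::nat. t * (l + 1) \<le> n - 2 \<and> d = int n - 4 - int t * (int l - 1)"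
    then show "\<exists>t::int. 0 \<le> t \<and> t \<le> \<lfloor>(real n - 2) / (real l + 1)\<rfloor> \<and> d = int n - 4 - t * (int l - 1)"
      using bound by (metis of_nat_0_le_iff)
  next
    assume "\<exists>t::int. 0 \<le> t \<and> t \<le> \<lfloor>(real n - 2) / (real l + 1)\<rfloor> \<and> d = int n - 4 - t * (int l - 1)"
    then show "\<exists>t::nat. t * (l + 1) \<le> n - 2 \<and> d = int n - 4 - int t * (int l - 1)"
      using bound by (metis nonneg_int_cases)
  qed
qed

end
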